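(* Let $k,i$ be positive integers and let $G$ be a finite simple graph with $m=c_k(G)\ge1$. Write $m=\binom{n_k}{k}+\binom{n_{k-1}}{k-1}+\sum_{j=1}^{t}\binom{a_{k-j}}{k-j}$ as the unique representation with $t\ge0$, $n_k>n_{k-1}\ge k-2$, $a_{k-1}>\dots>a_{k-t}\ge k-t>0$ and $\binom{n_{k-1}}{k-2}>\sum_{j=1}^t\binom{a_{k-j}}{k-j}$; and, when $n_k>k$, write $m=\sum_{j=0}^{s}\binom{b_{k-j}}{k-j}_{n_k-1-j}$ as the unique Turán representation with $r=n_k-1$. Then $$c_{k+i}(G)\le\max\Big\{\binom{n_k}{k+i}+\binom{n_{k-1}}{k+i-1}+\sum_{j=1}^t\binom{a_{k-j}}{k+i-j},\ \ \sum_{j=0}^s\binom{b_{k-j}}{k+i-j}_{n_k-1-j}\Big\},$$ where if $n_k=k$ the second expression is undefined and the maximum is understood as the first expression.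
   Context: $c_i(G)$ is the number of $i$-vertex cliques of $G$; $\binom{n}{j}=0$ if $j>n$ or $j<0$. Turán graph $T_{n,r}$: $n$ vertices partitioned into $r$ parts as evenly as possible, adjacent iff in different parts; $\binom{n}{k}_r$ denotes the number of $k$-vertex cliques of $T_{n,r}$. For $r\ge k$, each positive integer $m$ has a unique Turán representation $m=\sum_{j=0}^{s}\binom{b_{k-j}}{k-j}_{r-j}$ with $b_{k-j}-\lfloor b_{k-j}/(r-j)\rfloor>b_{k-j-1}$ for $0\le j<s$ and $b_{k-s}\ge k-s>0$. In the first representation, $t=0$ means no $a$-terms.
   Formalization: For k=1 the condition C(n_{k-1},k-2) > sum reads 0>0, so no first representation exists; there the representation m=C(n_1,1) with n_0=-1 and t=0 is used instead. All cases k≥2 are as stated. *)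

theory Defs
  imports Graph_Theory.Pair_Digraph
begin

text \<open>Finite simple graphs are the finite, loop-free, symmetric pair digraphs, i.e. instances of
  the locale \<^locale>\<open>pair_graph\<close>; an edge \<open>uv\<close> is the pair of arcs \<open>(u, v)\<close> and \<open>(v, u)\<close>.\<close>

definition cliques :: "'a pair_pre_digraph \<Rightarrow> nat \<Rightarrow> 'a set set" where
  "cliques G i = {S. S \<subseteq> pverts G \<and> finite S \<and> card S = i \<and>
                     (\<forall>u\<in>S. \<forall>v\<in>S. u \<noteq> v \<longrightarrow> (u, v) \<in> parcs G)}"

definition num_cliques :: "'a pair_pre_digraph \<Rightarrow> nat \<Rightarrow> nat" where
  "num_cliques G i = card (cliques G i)"

text \<open>The parts of the Turan graph are the residue classes modulo \<open>r\<close> in \<open>{0, \<dots>, n - 1}\<close>, whose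
  sizes differ by at most one. Only \<open>r \<ge> 1\<close> is meaningful.\<close>

definition turan_graph :: "nat \<Rightarrow> nat \<Rightarrow> nat pair_pre_digraph" where
  "turan_graph n r =
     \<lparr>pverts = {..<n}, parcs = {(u, v). u < n \<and> v < n \<and> u mod r \<noteq> v mod r}\<rparr>"

lemma pair_graph_turan_graph: "pair_graph (turan_graph n r)"
proof
  have "parcs (turan_graph n r) \<subseteq> {..<n} \<times> {..<n}"
    by (auto simp: turan_graph_def)
  then show "finite (parcs (turan_graph n r))"
    by (rule finite_subset) simp
qed (auto simp: turan_graph_def symmetric_def arcs_ends_def arc_to_ends_def intro!: symI)

definition turan_binom :: "nat \<Rightarrow> nat \<Rightarrow> nat \<Rightarrow> nat" where
  "turan_binom n k r = num_cliques (turan_graph n r) k"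

text \<open>Binomial coefficients with the convention that they vanish if \<open>j > n\<close> or \<open>j < 0\<close>. The integer
  version is needed because \<open>n\<^bsub>k-1\<^esub>\<close> and \<open>k - 2\<close> below may be \<open>-1\<close>.\<close>

definition int_binom :: "int \<Rightarrow> int \<Rightarrow> nat" where
  "int_binom n j = (if 0 \<le> j \<and> j \<le> n then nat n choose nat j else 0)"

text \<open>In both representations the families \<open>a\<close> and \<open>b\<close> are indexed by their subscripts, so
  \<open>a (k - j)\<close> is \<open>a\<^bsub>k-j\<^esub>\<close>; \<open>nk\<close> and \<open>nk1\<close> are \<open>n\<^bsub>k\<^esub>\<close> and \<open>n\<^bsub>k-1\<^esub>\<close>. All subtractions on
  \<^typ>\<open>nat\<close> are proper since \<open>t < k\<close>, and \<open>s < k \<le> r\<close>.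

  The last disjunct only concerns \<open>k = 1\<close>. There \<open>int_binom nk1 (k - 2) = 0\<close>, so the strict
  inequality alone could never hold; the disjunct admits the degenerate representation
  \<open>m = n\<^bsub>1\<^esub> choose 1\<close>, with \<open>n\<^bsub>0\<^esub> = -1\<close> and no further terms.\<close>

definition clique_representation ::
    "nat \<Rightarrow> nat \<Rightarrow> nat \<Rightarrow> int \<Rightarrow> nat \<Rightarrow> (nat \<Rightarrow> nat) \<Rightarrow> bool" where
  "clique_representation k m nk nk1 t a \<longleftrightarrow>
     m = (nk choose k) + int_binom nk1 (int k - 1) + (\<Sum>j=1..t. a (k - j) choose (k - j)) \<and>
     int nk > nk1 \<and> nk1 \<ge> int k - 2 \<and>
     t < k \<and>
     (\<forall>j. 1 \<le> j \<and> j < t \<longrightarrow> a (k - j) > a (k - j - 1)) \<and>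
     (t \<ge> 1 \<longrightarrow> a (k - t) \<ge> k - t) \<and>
     (int_binom nk1 (int k - 2) > (\<Sum>j=1..t. a (k - j) choose (k - j)) \<or> k = 1 \<and> nk1 = -1)"

definition turan_representation ::
    "nat \<Rightarrow> nat \<Rightarrow> nat \<Rightarrow> nat \<Rightarrow> (nat \<Rightarrow> nat) \<Rightarrow> bool" where
  "turan_representation k r m s b \<longleftrightarrow>
     m = (\<Sum>j=0..s. turan_binom (b (k - j)) (k - j) (r - j)) \<and>
     s < k \<and>
     (\<forall>j<s. b (k - j) - b (k - j) div (r - j) > b (k - j - 1)) \<and>
     b (k - s) \<ge> k - s"

end

theory Submission
  imports Defs "HOL-Library.Nat_Bijection"
begin

text \<open>Let \<open>Q\<close> be a clique with \<open>n\<^bsub>k\<^esub>\<close> vertices, if there is one.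

  If there is none, the graph is compared with a family of \<open>k\<close>-sets on vertices coloured by
  residues modulo \<open>n\<^bsub>k\<^esub> - 1\<close>, all of whose members have distinct colours (Frohmader's
  symmetrisation). For such families the colexicographic initial segments are optimal
  (Frankl--Fueredi--Kalai), and a Turan representation describes the initial segment.

  If \<open>Q\<close> exists, the \<open>k\<close>-cliques not contained in \<open>Q\<close> are counted. Vertices of \<open>Q\<close> missed by a
  vertex of large degree are deleted one by one, each deletion being controlled by a cone inequality
  for the Kruskal--Katona function. Once \<open>Q\<close> has \<open>n\<^bsub>k-1\<^esub> + 1\<close> vertices or all degrees are
  small, the clique counts are realised by a family with \<open>n\<^bsub>k-1\<^esub> + 1\<close> colours, where the optimal family is explicit.

  Optimality of coloured initial segments is proved by compressing one colour class at a time. If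
  a family is stable under all compressions but not an initial segment, exchanging its largest
  member for the smallest missing set does not decrease the number of spanned sets.\<close>

subsection \<open>Colexicographic initial segments\<close>

text \<open>The subsets of a clique Q contribute a plain binomial, so only the k-cliques not inside
  Q matter; there are \<open>(n choose (k - 1)) + Y\<close> of them, with n for \<open>nk1\<close>
  and Y for the sum of the a-terms. The target for them does not involve |Q|, so Q may be shrunk as
  long as the lost cliques are accounted for. Since their number is below
  \<open>Suc n choose (k - 1)\<close>, no clique with n + 2 vertices leaves Q, which is why n + 1
  colours suffice once |Q| = n + 1. In the optimal family with n + 1 colours, a clique on n + 1
  vertices and a vertex joined to n of them give the leading binomials. All other cliques use a
  vertex beyond these, and deleting it lowers the level by one; hence the a-terms form an ordinary
  Kruskal-Katona cascade at level k - 1. The obstacle is the shrinking: the cliques through a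
  deleted vertex can be absorbed only if the remaining cliques dominate its link. Bounds are carried
  by finite families (\<open>kk_feasible\<close>, \<open>realizable\<close>) and not by numerical
  functions, because unions, cones and links act directly on families.\<close>

lemma set_encode_ge_power: "finite A \<Longrightarrow> x \<in> A \<Longrightarrow> 2 ^ x \<le> set_encode A"
  unfolding set_encode_def by (rule member_le_sum) auto

lemma set_encode_less_power:
  assumes "\<And>x. x \<in> A \<Longrightarrow> x < b"
  shows "set_encode A < 2 ^ b"
proof -
  have "A \<subseteq> {0..<b}" using assms by auto
  then have "set_encode A \<le> sum ((^) 2) {0..<b}"
    unfolding set_encode_def by (intro sum_mono2) auto
  also have "\<dots> < 2 ^ b" using sum_power2[of b] by simp
  finally show ?thesis .
qed

lemma set_encode_less_of_max:
  assumes "finite B" "b \<in> B" "\<And>x. x \<in> A \<Longrightarrow> x < b"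
  shows "set_encode A < set_encode B"
  using set_encode_less_power[of A b] set_encode_ge_power[of B b] assms
  by (meson order.strict_trans2)

lemma set_encode_remove:
  "finite A \<Longrightarrow> x \<in> A \<Longrightarrow> set_encode A = 2 ^ x + set_encode (A - {x})"
  using set_encode_insert[of "A - {x}" x] by (simp add: insert_absorb)

lemma set_encode_exchange:
  assumes "finite B" "y \<in> B" "x \<notin> B" "x < y"
  shows "set_encode (insert x (B - {y})) < set_encode B"
  using assms set_encode_remove[of B y] by (simp add: set_encode_insert)

lemma set_encode_split:
  "finite A \<Longrightarrow> set_encode A = set_encode {x \<in> A. P x} + set_encode {x \<in> A. \<not> P x}"
  unfolding set_encode_def
  by (subst sum.union_disjoint[symmetric]) (auto intro!: sum.cong)

text \<open>The parts above the largest point of difference cancel, and that point outweighs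
  everything below it.\<close>

lemma set_encode_less_iff:
  assumes "finite A" "finite B"
  shows "set_encode A < set_encode B \<longleftrightarrow> (\<exists>d\<in>B - A. \<forall>x>d. x \<in> A \<longleftrightarrow> x \<in> B)"
proof -
  have imp: "set_encode A < set_encode B"
    if "finite A" "finite B" "d \<in> B - A" "\<forall>x>d. x \<in> A \<longleftrightarrow> x \<in> B" for A B d
  proof -
    have "{x \<in> A. d < x} = {x \<in> B. d < x}" using that by auto
    moreover have "set_encode {x \<in> A. \<not> d < x} < set_encode {x \<in> B. \<not> d < x}"
      using that by (intro set_encode_less_of_max[of _ d]) (auto simp: not_less le_less)
    ultimately show ?thesis
      using set_encode_split[of A "\<lambda>x. d < x"] set_encode_split[of B "\<lambda>x. d < x"] that by simp
  qed
  show ?thesis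
  proof
    assume less: "set_encode A < set_encode B"
    define D where "D = (A - B) \<union> (B - A)"
    have D: "finite D" "D \<noteq> {}" using assms less by (auto simp: D_def)
    define d where "d = Max D"
    have d: "d \<in> D" "\<forall>x>d. x \<notin> D" using D Max_ge[of D] by (auto simp: d_def not_le[symmetric])
    have "d \<notin> A - B" using imp[of B A d] assms less d by (auto simp: D_def)
    then show "\<exists>d\<in>B - A. \<forall>x>d. x \<in> A \<longleftrightarrow> x \<in> B" using d by (auto simp: D_def intro!: bexI[of _ d])
  next
    assume "\<exists>d\<in>B - A. \<forall>x>d. x \<in> A \<longleftrightarrow> x \<in> B"
    then show "set_encode A < set_encode B" using imp assms by blast
  qed
qed

text \<open>On finite sets, \<^const>\<open>set_encode\<close> induces the colexicographic order.\<close>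

definition initial :: "nat set set \<Rightarrow> nat set set \<Rightarrow> bool" where
  "initial X I \<longleftrightarrow> finite I \<and> I \<subseteq> X \<and>
     (\<forall>S\<in>I. \<forall>T\<in>X. set_encode T < set_encode S \<longrightarrow> T \<in> I)"

lemma initialD:
  "initial X I \<Longrightarrow> S \<in> I \<Longrightarrow> T \<in> X \<Longrightarrow> set_encode T < set_encode S \<Longrightarrow> T \<in> I"
  by (auto simp: initial_def)

text \<open>Finite sets are totally ordered by \<open>set_encode\<close>, so two initial segments of
  \<open>X\<close> are comparable by inclusion and their sizes decide the direction. Below, this
  turns size comparisons into inclusions.\<close>

lemma initial_mono:
  assumes "initial X I" "initial X J" "card I \<le> card J" "\<And>S. S \<in> X \<Longrightarrow> finite S"
  shows "I \<subseteq> J"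
proof (rule ccontr)
  assume "\<not> I \<subseteq> J"
  then obtain S where S: "S \<in> I" "S \<notin> J" by auto
  have "J \<subseteq> I"
  proof
    fix T assume T: "T \<in> J"
    have SX: "S \<in> X" "T \<in> X" using S T assms by (auto simp: initial_def)
    have "\<not> set_encode S < set_encode T" using initialD[OF assms(2) T SX(1)] S by blast
    moreover have "set_encode S \<noteq> set_encode T" using S T SX assms(4) set_encode_eq by metis
    ultimately have "set_encode T < set_encode S" by simp
    then show "T \<in> I" using initialD[OF assms(1) S(1) SX(2)] by simp
  qed
  then have "J \<subset> I" using S by auto
  then have "card J < card I" using assms(1) by (auto simp: initial_def intro!: psubset_card_mono)
  then show False using assms(3) by simp
qed

text \<open>\<open>X\<close> may be infinite; \<open>F\<close> only guarantees that it has enough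
  members. Each step adds a set of least encoding among those not yet chosen.\<close>

lemma initial_exists_le:
  assumes fin: "\<And>S. S \<in> X \<Longrightarrow> finite S" and F: "F \<subseteq> X" "finite F" and "n \<le> card F"
  shows "\<exists>I. initial X I \<and> card I = n"
  using \<open>n \<le> card F\<close>
proof (induction n)
  case 0
  show ?case by (rule exI[of _ "{}"]) (simp add: initial_def)
next
  case (Suc n)
  then obtain I where I: "initial X I" "card I = n" by auto
  have "\<not> F \<subseteq> I"
    using Suc.prems I card_mono[of I F] by (auto simp: initial_def)
  then have "\<exists>S. S \<in> X - I" using F by auto
  then obtain S where S: "S \<in> X - I" "\<And>T. T \<in> X - I \<Longrightarrow> set_encode S \<le> set_encode T"
    using ex_has_least_nat[of "\<lambda>S. S \<in> X - I" _ set_encode] by blast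
  have "initial X (insert S I)"
    unfolding initial_def
  proof (intro conjI ballI impI)
    fix T U assume T: "T \<in> insert S I" and U: "U \<in> X" and less: "set_encode U < set_encode T"
    show "U \<in> insert S I"
    proof (cases "T = S")
      case True
      then show ?thesis using S(2)[of U] U less by auto
    next
      case False
      then show ?thesis using initialD[OF I(1)] T U less by auto
    qed
  qed (use I S in \<open>auto simp: initial_def\<close>)
  moreover have "card (insert S I) = Suc n" using I S by (auto simp: initial_def)
  ultimately show ?case by blast
qed

lemma initial_exists:
  assumes "\<And>S. S \<in> X \<Longrightarrow> finite S" "F \<subseteq> X" "finite F"
  obtains I where "initial X I" "card I = card F"
  using initial_exists_le[OF assms order_refl] by blast

text \<open>The sum of the encodings is the termination measure for compressions and exchanges.
  \<open>I - F\<close> and \<open>F - I\<close> have the same size, and every member of the former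
  lies below every member of the latter.\<close>

lemma initial_sum_le:
  assumes I: "initial X I" and F: "F \<subseteq> X" "finite F" "card I = card F"
    and fin: "\<And>S. S \<in> X \<Longrightarrow> finite S"
  shows "(\<Sum>S\<in>I. set_encode S) \<le> (\<Sum>S\<in>F. set_encode S)"
    and "\<not> initial X F \<Longrightarrow> (\<Sum>S\<in>I. set_encode S) < (\<Sum>S\<in>F. set_encode S)"
proof -
  have fI: "finite I" using I by (simp add: initial_def)
  have split: "(\<Sum>S\<in>I. set_encode S) = (\<Sum>S\<in>I \<inter> F. set_encode S) + (\<Sum>S\<in>I - F. set_encode S)"
    "(\<Sum>S\<in>F. set_encode S) = (\<Sum>S\<in>I \<inter> F. set_encode S) + (\<Sum>S\<in>F - I. set_encode S)"
    using sum.Int_Diff[OF fI, of set_encode F] sum.Int_Diff[OF F(2), of set_encode I]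
    by (simp_all add: Int_commute)
  have lt: "(\<Sum>S\<in>I - F. set_encode S) < (\<Sum>S\<in>F - I. set_encode S)" if "I \<noteq> F"
  proof -
    have c: "card (I - F) = card (F - I)"
      using fI F(2,3) by (simp add: card_Diff_subset_Int Int_commute)
    have ne: "I - F \<noteq> {}"
    proof
      assume "I - F = {}"
      then show False using card_subset_eq[of F I] F(2,3) that by auto
    qed
    have ne': "F - I \<noteq> {}" using ne c fI F(2) by (metis card_eq_0_iff finite_Diff)
    define M where "M = Min (set_encode ` (F - I))"
    have lo: "M \<le> set_encode S" if "S \<in> F - I" for S
      unfolding M_def using that F(2) by (intro Min_le) auto
    have "M \<in> set_encode ` (F - I)" unfolding M_def using F(2) ne' by (intro Min_in) auto
    then obtain T where T: "T \<in> F - I" "M = set_encode T" by auto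
    have hi: "set_encode S < M" if "S \<in> I - F" for S
    proof -
      have "\<not> set_encode T < set_encode S" using initialD[OF I, of S T] that T F(1) by auto
      moreover have "set_encode T \<noteq> set_encode S"
        using fin I F(1) T that set_encode_eq[of T S] by (auto simp: initial_def)
      ultimately show ?thesis using T by simp
    qed
    have "(\<Sum>S\<in>I - F. set_encode S) < card (I - F) * M"
      using sum_strict_mono[of "I - F" set_encode "\<lambda>_. M"] fI ne hi by simp
    also have "\<dots> \<le> (\<Sum>S\<in>F - I. set_encode S)"
      using sum_bounded_below[of "F - I" M set_encode] lo c by simp
    finally show ?thesis .
  qed
  show "(\<Sum>S\<in>I. set_encode S) \<le> (\<Sum>S\<in>F. set_encode S)"
  proof (cases "I = F")
    case False
    then show ?thesis using lt split by linarith
  qed simp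
  show "(\<Sum>S\<in>I. set_encode S) < (\<Sum>S\<in>F. set_encode S)" if "\<not> initial X F"
  proof -
    have "I \<noteq> F" using that I by auto
    then show ?thesis using lt split by linarith
  qed
qed

section \<open>Spanned families and rainbow sets\<close>

definition spanned :: "nat \<Rightarrow> 'a set set \<Rightarrow> nat \<Rightarrow> 'a set set" where
  "spanned k F l = {T. finite T \<and> card T = l \<and> (\<forall>S. S \<subseteq> T \<and> card S = k \<longrightarrow> S \<in> F)}"

lemma spannedD: "T \<in> spanned k F l \<Longrightarrow> S \<subseteq> T \<Longrightarrow> card S = k \<Longrightarrow> S \<in> F"
  by (auto simp: spanned_def)

lemma spanned_mono: "F \<subseteq> F' \<Longrightarrow> spanned k F l \<subseteq> spanned k F' l"
  by (auto simp: spanned_def)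

lemma spanned_same: "spanned k F k = {T \<in> F. finite T \<and> card T = k}"
  unfolding spanned_def by (auto dest: card_subset_eq)

lemma spanned_spanned:
  assumes "k \<le> l" "l \<le> n"
  shows "spanned l (spanned k F l) n = spanned k F n"
proof (intro equalityI subsetI)
  fix T assume T: "T \<in> spanned l (spanned k F l) n"
  have "S \<in> F" if S: "S \<subseteq> T" "card S = k" for S
  proof -
    have fT: "finite T" "card T = n" using T by (auto simp: spanned_def)
    obtain U where "S \<subseteq> U" "U \<subseteq> T" "card U = l"
      using exists_subset_between[of S l T] S assms fT by auto
    then show ?thesis using T S by (auto simp: spanned_def)
  qed
  then show "T \<in> spanned k F n" using T by (auto simp: spanned_def)
next
  fix T assume "T \<in> spanned k F n"
  then show "T \<in> spanned l (spanned k F l) n"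
    by (auto simp: spanned_def intro: finite_subset)
qed

text \<open>The colour of a vertex is its residue modulo \<open>r\<close>; only colours in \<open>C\<close> are allowed.\<close>

definition rainbow :: "nat \<Rightarrow> nat set \<Rightarrow> nat \<Rightarrow> nat set set" where
  "rainbow r C k = {S. finite S \<and> card S = k \<and> inj_on (\<lambda>v. v mod r) S \<and> (\<lambda>v. v mod r) ` S \<subseteq> C}"

lemma rainbow_finite: "S \<in> rainbow r C k \<Longrightarrow> finite S"
  by (simp add: rainbow_def)

lemma rainbow_subset: "S \<in> rainbow r C k \<Longrightarrow> T \<subseteq> S \<Longrightarrow> T \<in> rainbow r C (card T)"
  by (auto simp: rainbow_def intro: finite_subset inj_on_subset)

lemma rainbow_insert:
  assumes "S \<in> rainbow r C k" "v mod r \<in> C" "v mod r \<notin> (\<lambda>v. v mod r) ` S"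
  shows "insert v S \<in> rainbow r C (Suc k)"
proof -
  have "v \<notin> S" using assms by auto
  then show ?thesis using assms by (auto simp: rainbow_def)
qed

lemma rainbow_mono: "C \<subseteq> D \<Longrightarrow> rainbow r C k \<subseteq> rainbow r D k"
  by (auto simp: rainbow_def)

lemma rainbow_colors_card:
  "S \<in> rainbow r C k \<Longrightarrow> card ((\<lambda>v. v mod r) ` S) = k"
  by (auto simp: rainbow_def card_image)

lemma rainbow_card_le: "S \<in> rainbow r C k \<Longrightarrow> finite C \<Longrightarrow> k \<le> card C"
  using rainbow_colors_card[of S r C k] card_mono[of C "(\<lambda>v. v mod r) ` S"]
  by (auto simp: rainbow_def)

text \<open>Let d be the largest point of difference, which belongs to \<open>T\<close>. If
  \<open>S\<close> had no element below d, then \<open>insert d S\<close> would be a subset of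
  \<open>T\<close>, against the sizes. If d is not the minimum of \<open>T\<close>, it survives and
  still decides. Otherwise the rest of \<open>T\<close> lies above d, where both sets agree, and by
  size it equals \<open>S - {Min S}\<close>.\<close>

lemma set_encode_remove_Min_mono:
  assumes "finite S" "finite T" "card S = card T" "S \<noteq> {}" "set_encode S \<le> set_encode T"
  shows "set_encode (S - {Min S}) \<le> set_encode (T - {Min T})"
proof (cases "set_encode S = set_encode T")
  case True
  then show ?thesis using assms set_encode_eq by simp
next
  case False
  have Tne: "T \<noteq> {}" using assms by auto
  obtain d where d: "d \<in> T" "d \<notin> S" "\<And>x. d < x \<Longrightarrow> x \<in> S \<longleftrightarrow> x \<in> T"
    using False assms set_encode_less_iff[of S T] by auto
  have minS: "Min S < d"
  proof (rule ccontr)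
    assume "\<not> Min S < d"
    then have "d < x" if "x \<in> S" for x
      using that assms d(2) Min_le[of S x] by (metis le_neq_implies_less less_le_trans not_less Min_in)
    then have "insert d S \<subseteq> T" using d by auto
    then have "card (insert d S) \<le> card T" using assms by (intro card_mono) auto
    then show False using assms d by simp
  qed
  show ?thesis
  proof (cases "Min T = d")
    case True
    have eq: "T - {d} = {x \<in> T. d < x}" using True assms Min_le[of T] by (auto simp: le_less)
    then have sub: "T - {d} \<subseteq> S - {Min S}" using d minS by auto
    have "card (T - {d}) = card (S - {Min S})"
      using assms d by (simp add: card_Diff_singleton)
    then have "T - {d} = S - {Min S}" using sub assms by (intro card_subset_eq) auto
    then show ?thesis using True by simp
  next
    case False
    have "Min T < d" using False d(1) assms(2) Min_le[of T d] by linarith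
    then have "\<exists>d\<in>(T - {Min T}) - (S - {Min S}). \<forall>x>d. x \<in> S - {Min S} \<longleftrightarrow> x \<in> T - {Min T}"
      using d minS by (intro bexI[of _ d]) auto
    then have "set_encode (S - {Min S}) < set_encode (T - {Min T})"
      using set_encode_less_iff[of "S - {Min S}" "T - {Min T}"] assms by simp
    then show ?thesis by simp
  qed
qed

text \<open>Among the \<open>k\<close>-subsets of a \<open>(k + 1)\<close>-set the largest one omits the minimum.\<close>

lemma spanned_initial:
  assumes I: "initial (rainbow r C k) I" and T: "T \<in> spanned k I (Suc k)"
    and U: "U \<in> rainbow r C (Suc k)" "set_encode U \<le> set_encode T"
  shows "U \<in> spanned k I (Suc k)"
proof -
  have fT: "finite T" "card T = Suc k" using T by (auto simp: spanned_def)
  have fU: "finite U" "card U = Suc k" using U by (auto simp: rainbow_def)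
  have ne: "T \<noteq> {}" "U \<noteq> {}" using fT fU by auto
  have top: "T - {Min T} \<in> I"
    using spannedD[OF T, of "T - {Min T}"] fT ne by (simp add: card_Diff_singleton)
  have "S \<in> I" if S: "S \<subseteq> U" "card S = k" for S
  proof -
    have "\<exists>y\<in>U. S = U - {y}"
    proof -
      have "card (U - S) = 1" using S fU finite_subset[of S U] by (simp add: card_Diff_subset)
      then obtain y where "U - S = {y}" by (auto simp: card_1_singleton_iff)
      then show ?thesis using S by (intro bexI[of _ y]) auto
    qed
    then obtain y where y: "y \<in> U" "S = U - {y}" by auto
    have "set_encode S \<le> set_encode (U - {Min U})"
    proof -
      have "(2::nat) ^ Min U \<le> 2 ^ y" using y fU by simp
      moreover have "set_encode U = 2 ^ y + set_encode S"
        using set_encode_remove[of U y] y fU by simp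
      moreover have "set_encode U = 2 ^ Min U + set_encode (U - {Min U})"
        using set_encode_remove[of U "Min U"] fU ne by simp
      ultimately show ?thesis by linarith
    qed
    also have "\<dots> \<le> set_encode (T - {Min T})"
      using set_encode_remove_Min_mono[of U T] fT fU ne U by simp
    finally have le: "set_encode S \<le> set_encode (T - {Min T})" .
    have S': "S \<in> rainbow r C k" using rainbow_subset[OF U(1) S(1)] S by simp
    show ?thesis
    proof (cases "set_encode S = set_encode (T - {Min T})")
      case True
      then show ?thesis using top set_encode_eq[of S "T - {Min T}"] fT fU y by simp
    next
      case False
      then show ?thesis using initialD[OF I top S'] le by simp
    qed
  qed
  then show ?thesis using fU by (auto simp: spanned_def)
qed

subsection \<open>Compression\<close>

text \<open>Intended for \<open>W\<close> inside one colour class: \<open>X0\<close> is the part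
  avoiding the class and \<open>X v\<close> the link of \<open>v\<close>, so that each piece can be
  rearranged on its own. A single new vertex gives a cone.\<close>

definition join :: "'a set set \<Rightarrow> ('a \<Rightarrow> 'a set set) \<Rightarrow> 'a set \<Rightarrow> 'a set set" where
  "join X0 X W = X0 \<union> (\<Union>v\<in>W. insert v ` X v)"

lemma sum_join:
  fixes f :: "'a set \<Rightarrow> nat"
  assumes "finite W" "finite X0" "\<And>v. v \<in> W \<Longrightarrow> finite (X v)"
    and "\<And>v S. v \<in> W \<Longrightarrow> S \<in> X0 \<Longrightarrow> v \<notin> S"
    and "\<And>v w S. v \<in> W \<Longrightarrow> w \<in> W \<Longrightarrow> S \<in> X v \<Longrightarrow> w \<notin> S"
  shows "sum f (join X0 X W) = sum f X0 + (\<Sum>v\<in>W. \<Sum>S\<in>X v. f (insert v S))"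
proof -
  have inj: "inj_on (insert v) (X v)" if "v \<in> W" for v
    using assms(5)[OF that that] by (intro inj_onI) (metis insert_ident)
  have "sum f (join X0 X W) = sum f X0 + sum f (\<Union>v\<in>W. insert v ` X v)"
    unfolding join_def using assms(1-4) by (intro sum.union_disjoint) auto
  also have "sum f (\<Union>v\<in>W. insert v ` X v) = (\<Sum>v\<in>W. sum f (insert v ` X v))"
  proof (rule sum.UNION_disjoint)
    show "\<forall>v\<in>W. \<forall>w\<in>W. v \<noteq> w \<longrightarrow> insert v ` X v \<inter> insert w ` X w = {}"
    proof (intro ballI impI)
      fix v w assume vw: "v \<in> W" "w \<in> W" "v \<noteq> w"
      have "w \<notin> T" if "T \<in> insert v ` X v" for T
        using that vw assms(5)[OF vw(1,2)] by auto
      then show "insert v ` X v \<inter> insert w ` X w = {}" by auto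
    qed
  qed (simp_all add: assms(1,3))
  also have "\<dots> = (\<Sum>v\<in>W. \<Sum>S\<in>X v. f (insert v S))"
    by (rule sum.cong[OF refl], subst sum.reindex[OF inj]) (auto simp: comp_def)
  finally show ?thesis .
qed

lemma join_finite:
  "finite W \<Longrightarrow> finite X0 \<Longrightarrow> (\<And>v. v \<in> W \<Longrightarrow> finite (X v)) \<Longrightarrow> finite (join X0 X W)"
  by (auto simp: join_def)

text \<open>A subset of \<open>insert v T'\<close> that contains \<open>v\<close> is governed by the
  link \<open>X v\<close>, one that does not must belong to \<open>X0\<close>; hence the two
  conditions on \<open>J v\<close>.\<close>

lemma join_spanned:
  assumes "J0 \<subseteq> spanned (Suc k) X0 (Suc l)"
    and "\<And>v. v \<in> W \<Longrightarrow> J v \<subseteq> spanned k (X v) l \<inter> spanned (Suc k) X0 l"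
    and nin: "\<And>v S. v \<in> W \<Longrightarrow> S \<in> J v \<Longrightarrow> v \<notin> S"
  shows "join J0 J W \<subseteq> spanned (Suc k) (join X0 X W) (Suc l)"
proof
  fix T assume "T \<in> join J0 J W"
  then consider "T \<in> J0" | v T' where "v \<in> W" "T' \<in> J v" "T = insert v T'"
    by (auto simp: join_def)
  then show "T \<in> spanned (Suc k) (join X0 X W) (Suc l)"
  proof cases
    case 1
    have "spanned (Suc k) X0 (Suc l) \<subseteq> spanned (Suc k) (join X0 X W) (Suc l)"
      by (rule spanned_mono) (auto simp: join_def)
    then show ?thesis using 1 assms(1) by blast
  next
    case 2
    have T': "T' \<in> spanned k (X v) l" "T' \<in> spanned (Suc k) X0 l" using assms(2)[of v] 2 by auto
    have fin: "finite T'" "card T' = l" using T' by (auto simp: spanned_def)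
    have "v \<notin> T'" using nin[of v T'] 2 by blast
    have "S \<in> join X0 X W" if S: "S \<subseteq> T" "card S = Suc k" for S
    proof (cases "v \<in> S")
      case True
      have "S - {v} \<subseteq> T'" using S 2 by auto
      moreover have "card (S - {v}) = k" using S True by simp
      ultimately have "S - {v} \<in> X v" using spannedD[OF T'(1)] by blast
      moreover have "insert v (S - {v}) = S" using True by auto
      ultimately show ?thesis using 2 unfolding join_def by (metis UN_I UnI2 imageI)
    next
      case False
      then have "S \<subseteq> T'" using S 2 by auto
      then have "S \<in> X0" using spannedD[OF T'(2)] S by blast
      then show ?thesis by (simp add: join_def)
    qed
    then show ?thesis using 2 fin \<open>v \<notin> T'\<close> by (auto simp: spanned_def)
  qed
qed

lemma join_rainbow:
  assumes "X0 \<subseteq> rainbow r (C - {\<alpha>}) (Suc k)" "\<alpha> \<in> C"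
    and "\<And>v. v \<in> W \<Longrightarrow> v mod r = \<alpha>"
    and "\<And>v. v \<in> W \<Longrightarrow> X v \<subseteq> rainbow r (C - {\<alpha>}) k"
  shows "join X0 X W \<subseteq> rainbow r C (Suc k)"
proof -
  have "insert v S \<in> rainbow r C (Suc k)" if "v \<in> W" "S \<in> X v" for v S
  proof (rule rainbow_insert)
    have S: "S \<in> rainbow r (C - {\<alpha>}) k" using assms(4) that by blast
    then show "S \<in> rainbow r C k" using rainbow_mono[of "C - {\<alpha>}" C] by blast
    show "v mod r \<in> C" "v mod r \<notin> (\<lambda>v. v mod r) ` S"
      using S assms(2,3) that by (auto simp: rainbow_def)
  qed
  then show ?thesis
    using assms(1) rainbow_mono[of "C - {\<alpha>}" C r "Suc k"] by (auto simp: join_def)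
qed

definition avoid :: "nat \<Rightarrow> nat \<Rightarrow> nat set set \<Rightarrow> nat set set" where
  "avoid r \<alpha> F = {S \<in> F. \<alpha> \<notin> (\<lambda>v. v mod r) ` S}"

definition link :: "'a set set \<Rightarrow> 'a \<Rightarrow> 'a set set" where
  "link F v = {S. v \<notin> S \<and> insert v S \<in> F}"

lemma avoid_rainbow: "F \<subseteq> rainbow r C k \<Longrightarrow> avoid r \<alpha> F \<subseteq> rainbow r (C - {\<alpha>}) k"
  by (auto simp: avoid_def rainbow_def)

lemma link_rainbow:
  assumes "F \<subseteq> rainbow r C (Suc k)" "v mod r = \<alpha>"
  shows "link F v \<subseteq> rainbow r (C - {\<alpha>}) k"
proof
  fix S assume S: "S \<in> link F v"
  then have "insert v S \<in> rainbow r C (Suc k)" "v \<notin> S" using assms by (auto simp: link_def)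
  then show "S \<in> rainbow r (C - {\<alpha>}) k"
    using assms(2) by (auto simp: rainbow_def) (metis imageI)
qed

lemma link_finite:
  assumes "finite F" shows "finite (link F v)"
proof -
  have "S \<in> (\<lambda>S. S - {v}) ` F" if "S \<in> link F v" for S
    using that by (intro image_eqI[of _ _ "insert v S"]) (auto simp: link_def)
  then have "link F v \<subseteq> (\<lambda>S. S - {v}) ` F" by blast
  then show ?thesis using assms finite_surj by blast
qed

lemma join_decompose:
  assumes F: "F \<subseteq> rainbow r C k" and W: "{v \<in> \<Union>F. v mod r = \<alpha>} \<subseteq> W"
  shows "F = join (avoid r \<alpha> F) (link F) W"
proof (intro equalityI subsetI)
  fix S assume S: "S \<in> F"
  show "S \<in> join (avoid r \<alpha> F) (link F) W"
  proof (cases "\<alpha> \<in> (\<lambda>v. v mod r) ` S")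
    case True
    then obtain v where v: "v \<in> S" "v mod r = \<alpha>" by auto
    then have "v \<in> W" "S - {v} \<in> link F v" "insert v (S - {v}) = S"
      using S W by (auto simp: link_def insert_absorb)
    then show ?thesis unfolding join_def by (metis UN_I UnI2 imageI)
  next
    case False
    then show ?thesis using S by (auto simp: join_def avoid_def)
  qed
qed (auto simp: join_def avoid_def link_def)

text \<open>Only adjacent levels are compared. A finite \<open>H\<close> and an inclusion replace
  the cardinality of the spanned family, which can be infinite: for k = 0 the empty set spans every
  singleton.\<close>

definition ffk_optimal :: "nat \<Rightarrow> nat set \<Rightarrow> nat \<Rightarrow> bool" where
  "ffk_optimal r C k \<longleftrightarrow> (\<forall>F H I J. finite F \<longrightarrow> F \<subseteq> rainbow r C k \<longrightarrow>
     finite H \<longrightarrow> H \<subseteq> rainbow r C (Suc k) \<inter> spanned k F (Suc k) \<longrightarrow>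
     initial (rainbow r C k) I \<longrightarrow> card I = card F \<longrightarrow>
     initial (rainbow r C (Suc k)) J \<longrightarrow> card J \<le> card H \<longrightarrow> J \<subseteq> spanned k I (Suc k))"

lemma ffk_optimalD:
  assumes "ffk_optimal r C k" "finite F" "F \<subseteq> rainbow r C k" "finite H"
    "H \<subseteq> rainbow r C (Suc k) \<inter> spanned k F (Suc k)"
    "initial (rainbow r C k) I" "card I = card F"
    "initial (rainbow r C (Suc k)) J" "card J \<le> card H"
  shows "J \<subseteq> spanned k I (Suc k)"
  using assms(1)[unfolded ffk_optimal_def, rule_format, OF assms(2-9)] .

definition stable :: "nat \<Rightarrow> nat set \<Rightarrow> nat \<Rightarrow> nat set set \<Rightarrow> nat \<Rightarrow> bool" where
  "stable r C k F \<alpha> \<longleftrightarrow> initial (rainbow r (C - {\<alpha>}) (Suc k)) (avoid r \<alpha> F) \<and>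
     (\<forall>v. v mod r = \<alpha> \<longrightarrow> initial (rainbow r (C - {\<alpha>}) k) (link F v))"

text \<open>The part avoiding colour \<alpha> and every link at that colour are replaced by initial
  segments of the same sizes; these use one colour fewer, so the induction hypotheses apply. The
  measure drops because some piece of \<open>F\<close> was not initial.\<close>

lemma compress_unstable:
  assumes ih: "ffk_optimal r (C - {\<alpha>}) (Suc k)" "ffk_optimal r (C - {\<alpha>}) k" and \<alpha>: "\<alpha> \<in> C"
    and F: "finite F" "F \<subseteq> rainbow r C (Suc k)"
    and H: "finite H" "H \<subseteq> rainbow r C (Suc (Suc k)) \<inter> spanned (Suc k) F (Suc (Suc k))"
    and unstable: "\<not> stable r C k F \<alpha>"
  shows "\<exists>F' H'. finite F' \<and> F' \<subseteq> rainbow r C (Suc k) \<and> finite H' \<and>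
    H' \<subseteq> rainbow r C (Suc (Suc k)) \<inter> spanned (Suc k) F' (Suc (Suc k)) \<and>
    card F' = card F \<and> card H' = card H \<and> (\<Sum>S\<in>F'. set_encode S) < (\<Sum>S\<in>F. set_encode S)"
proof -
  define W where "W = {v \<in> \<Union>F \<union> \<Union>H. v mod r = \<alpha>}"
  have H': "H \<subseteq> rainbow r C (Suc (Suc k))" using H by blast
  have W: "finite W" "\<And>v. v \<in> W \<Longrightarrow> v mod r = \<alpha>"
  proof -
    have "finite (\<Union>F \<union> \<Union>H)" using F H' H(1) rainbow_finite by blast
    then show "finite W" unfolding W_def by (rule finite_subset[rotated]) blast
  qed (simp add: W_def)
  have sub: "avoid r \<alpha> F \<subseteq> rainbow r (C - {\<alpha>}) (Suc k)"
    "avoid r \<alpha> H \<subseteq> rainbow r (C - {\<alpha>}) (Suc (Suc k))"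
    using F(2) H' by (auto dest!: avoid_rainbow[of _ _ _ _ \<alpha>])
  have lsub: "link F v \<subseteq> rainbow r (C - {\<alpha>}) k" "link H v \<subseteq> rainbow r (C - {\<alpha>}) (Suc k)"
    if "v mod r = \<alpha>" for v
    using link_rainbow[OF F(2) that] link_rainbow[OF H' that] by auto
  have fin: "finite (avoid r \<alpha> F)" "finite (avoid r \<alpha> H)" "finite (link F v)" "finite (link H v)" for v
    using F H link_finite by (auto simp: avoid_def)
  obtain I0 where I0: "initial (rainbow r (C - {\<alpha>}) (Suc k)) I0" "card I0 = card (avoid r \<alpha> F)"
    using initial_exists[OF _ sub(1) fin(1)] rainbow_finite by blast
  obtain J0 where J0: "initial (rainbow r (C - {\<alpha>}) (Suc (Suc k))) J0" "card J0 = card (avoid r \<alpha> H)"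
    using initial_exists[OF _ sub(2) fin(2)] rainbow_finite by blast
  have "\<exists>I. initial (rainbow r (C - {\<alpha>}) k) I \<and> card I = card (link F v)" if "v \<in> W" for v
    using initial_exists[OF _ lsub(1)[OF W(2)[OF that]] fin(3)] rainbow_finite by metis
  then obtain I where I: "\<And>v. v \<in> W \<Longrightarrow> initial (rainbow r (C - {\<alpha>}) k) (I v)"
    "\<And>v. v \<in> W \<Longrightarrow> card (I v) = card (link F v)"
    by metis
  have "\<exists>J. initial (rainbow r (C - {\<alpha>}) (Suc k)) J \<and> card J = card (link H v)" if "v \<in> W" for v
    using initial_exists[OF _ lsub(2)[OF W(2)[OF that]] fin(4)] rainbow_finite by metis
  then obtain J where J: "\<And>v. v \<in> W \<Longrightarrow> initial (rainbow r (C - {\<alpha>}) (Suc k)) (J v)"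
    "\<And>v. v \<in> W \<Longrightarrow> card (J v) = card (link H v)"
    by metis
  have nin: "v \<notin> S" if "v \<in> W" "S \<in> rainbow r (C - {\<alpha>}) n" for v S n
    using that W by (auto simp: rainbow_def)
  have isub: "I0 \<subseteq> rainbow r (C - {\<alpha>}) (Suc k)" "J0 \<subseteq> rainbow r (C - {\<alpha>}) (Suc (Suc k))" "finite I0" "finite J0"
    using I0 J0 by (auto simp: initial_def)
  have vsub: "I v \<subseteq> rainbow r (C - {\<alpha>}) k" "J v \<subseteq> rainbow r (C - {\<alpha>}) (Suc k)" "finite (I v)" "finite (J v)"
    if "v \<in> W" for v
    using I(1)[OF that] J(1)[OF that] by (auto simp: initial_def)
  have H0: "avoid r \<alpha> H \<subseteq> rainbow r (C - {\<alpha>}) (Suc (Suc k)) \<inter> spanned (Suc k) (avoid r \<alpha> F) (Suc (Suc k))"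
  proof (intro Int_greatest sub(2) subsetI)
    fix T assume T: "T \<in> avoid r \<alpha> H"
    then have T': "T \<in> spanned (Suc k) F (Suc (Suc k))" "\<alpha> \<notin> (\<lambda>v. v mod r) ` T"
      using H(2) by (auto simp: avoid_def)
    have "S \<in> avoid r \<alpha> F" if "S \<subseteq> T" "card S = Suc k" for S
      using spannedD[OF T'(1) that] T'(2) that(1) by (auto simp: avoid_def)
    then show "T \<in> spanned (Suc k) (avoid r \<alpha> F) (Suc (Suc k))"
      using T' by (auto simp: spanned_def)
  qed
  have Hv: "link H v \<subseteq> rainbow r (C - {\<alpha>}) (Suc k) \<inter> spanned k (link F v) (Suc k)"
    and HvF: "link H v \<subseteq> avoid r \<alpha> F" if v: "v \<in> W" for v
  proof -
    have "T \<in> spanned k (link F v) (Suc k) \<and> T \<in> avoid r \<alpha> F" if T: "T \<in> link H v" for T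
    proof -
      have vT: "v \<notin> T" "insert v T \<in> spanned (Suc k) F (Suc (Suc k))"
        using T H by (auto simp: link_def)
      have T': "T \<in> rainbow r (C - {\<alpha>}) (Suc k)" using lsub(2)[OF W(2)[OF v]] T by blast
      have fT: "finite T" "card T = Suc k" using T' by (auto simp: rainbow_def)
      have "S \<in> link F v" if S: "S \<subseteq> T" "card S = k" for S
      proof -
        have "card (insert v S) = Suc k" using S vT fT finite_subset[of S T] by (subst card_insert_disjoint) auto
        then have "insert v S \<in> F" using spannedD[OF vT(2), of "insert v S"] S by auto
        then show ?thesis using S vT by (auto simp: link_def)
      qed
      moreover have "T \<in> F" using spannedD[OF vT(2), of T] fT by auto
      ultimately show ?thesis using fT T' by (auto simp: spanned_def avoid_def rainbow_def)
    qed
    then show "link H v \<subseteq> rainbow r (C - {\<alpha>}) (Suc k) \<inter> spanned k (link F v) (Suc k)"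
      "link H v \<subseteq> avoid r \<alpha> F" using lsub(2)[OF W(2)[OF v]] by auto
  qed
  have J0I0: "J0 \<subseteq> spanned (Suc k) I0 (Suc (Suc k))"
    using ffk_optimalD[OF ih(1) fin(1) sub(1) fin(2) H0 I0 J0(1)] J0(2) by simp
  have JI: "J v \<subseteq> spanned k (I v) (Suc k)" if "v \<in> W" for v
    using ffk_optimalD[OF ih(2) fin(3) lsub(1)[OF W(2)[OF that]] fin(4) Hv[OF that] I(1)[OF that] I(2)[OF that]
        J(1)[OF that]] J(2)[OF that] by simp
  \<comment> \<open>This makes the compressed pieces fit together: \<open>link H v\<close> was
    contained in \<open>avoid r \<alpha> F\<close>, and between initial segments of the same
    universe the size comparison is again an inclusion.\<close>
  have JI0: "J v \<subseteq> spanned (Suc k) I0 (Suc k)" if "v \<in> W" for v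
  proof -
    have "card (J v) \<le> card I0"
      using card_mono[OF fin(1) HvF[OF that]] J(2)[OF that] I0(2) by simp
    then have "J v \<subseteq> I0" using initial_mono[OF J(1)[OF that] I0(1)] rainbow_finite by blast
    then show ?thesis using vsub(2)[OF that] by (auto simp: spanned_same rainbow_def)
  qed
  define F' where "F' = join I0 I W"
  define H1 where "H1 = join J0 J W"
  have sumF: "sum f F = sum f (avoid r \<alpha> F) + (\<Sum>v\<in>W. \<Sum>S\<in>link F v. f (insert v S))" for f :: "nat set \<Rightarrow> nat"
  proof -
    have "F = join (avoid r \<alpha> F) (link F) W"
      by (rule join_decompose[OF F(2)]) (auto simp: W_def)
    then have "sum f F = sum f (join (avoid r \<alpha> F) (link F) W)" by simp
    also have "\<dots> = sum f (avoid r \<alpha> F) + (\<Sum>v\<in>W. \<Sum>S\<in>link F v. f (insert v S))"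
      by (rule sum_join) (use W fin sub lsub nin in blast)+
    finally show ?thesis .
  qed
  have sumH: "sum f H = sum f (avoid r \<alpha> H) + (\<Sum>v\<in>W. \<Sum>S\<in>link H v. f (insert v S))" for f :: "nat set \<Rightarrow> nat"
  proof -
    have "H = join (avoid r \<alpha> H) (link H) W"
      by (rule join_decompose[OF H']) (auto simp: W_def)
    then have "sum f H = sum f (join (avoid r \<alpha> H) (link H) W)" by simp
    also have "\<dots> = sum f (avoid r \<alpha> H) + (\<Sum>v\<in>W. \<Sum>S\<in>link H v. f (insert v S))"
      by (rule sum_join) (use W fin sub lsub nin in blast)+
    finally show ?thesis .
  qed
  have sumF': "sum f F' = sum f I0 + (\<Sum>v\<in>W. \<Sum>S\<in>I v. f (insert v S))" for f :: "nat set \<Rightarrow> nat"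
    unfolding F'_def by (rule sum_join) (use W isub vsub nin in blast)+
  have sumH1: "sum f H1 = sum f J0 + (\<Sum>v\<in>W. \<Sum>S\<in>J v. f (insert v S))" for f :: "nat set \<Rightarrow> nat"
    unfolding H1_def by (rule sum_join) (use W isub vsub nin in blast)+
  have cF: "card F' = card F"
    using sumF[of "\<lambda>_. 1"] sumF'[of "\<lambda>_. 1"] I0(2) I(2) by simp
  have cH: "card H1 = card H"
    using sumH[of "\<lambda>_. 1"] sumH1[of "\<lambda>_. 1"] J0(2) J(2) by simp
  have enc: "(\<Sum>S\<in>X. set_encode (insert v S)) = card X * 2 ^ v + (\<Sum>S\<in>X. set_encode S)"
    if "v \<in> W" "X \<subseteq> rainbow r (C - {\<alpha>}) k" for v X
  proof -
    have "set_encode (insert v S) = 2 ^ v + set_encode S" if "S \<in> X" for S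
      using that \<open>X \<subseteq> _\<close> nin[OF \<open>v \<in> W\<close>] rainbow_finite set_encode_insert by (metis subsetD)
    then show ?thesis by (simp add: sum.distrib)
  qed
  have le0: "(\<Sum>S\<in>I0. set_encode S) \<le> (\<Sum>S\<in>avoid r \<alpha> F. set_encode S)"
    using initial_sum_le(1)[OF I0(1) sub(1) fin(1) I0(2)] rainbow_finite by blast
  have lev: "(\<Sum>S\<in>I v. set_encode (insert v S)) \<le> (\<Sum>S\<in>link F v. set_encode (insert v S))"
    if "v \<in> W" for v
    using initial_sum_le(1)[OF I(1)[OF that] lsub(1)[OF W(2)[OF that]] fin(3) I(2)[OF that]]
      rainbow_finite enc[OF that vsub(1)[OF that]] enc[OF that lsub(1)[OF W(2)[OF that]]] I(2)[OF that]
    by force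
  have "(\<Sum>S\<in>F'. set_encode S) < (\<Sum>S\<in>F. set_encode S)"
  proof (cases "initial (rainbow r (C - {\<alpha>}) (Suc k)) (avoid r \<alpha> F)")
    case False
    have "(\<Sum>S\<in>I0. set_encode S) < (\<Sum>S\<in>avoid r \<alpha> F. set_encode S)"
      using initial_sum_le(2)[OF I0(1) sub(1) fin(1) I0(2)] rainbow_finite False by blast
    then show ?thesis unfolding sumF' sumF by (intro add_less_le_mono sum_mono lev)
  next
    case True
    then obtain v where v: "v mod r = \<alpha>" "\<not> initial (rainbow r (C - {\<alpha>}) k) (link F v)"
      using unstable by (auto simp: stable_def)
    \<comment> \<open>The empty family is initial, so a link that is not initial is nonempty and its
      vertex occurs in \<open>W\<close>.\<close>
    have "link F v \<noteq> {}" using v by (auto simp: initial_def)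
    then have vW: "v \<in> W" using v by (auto simp: W_def link_def)
    have "(\<Sum>S\<in>I v. set_encode (insert v S)) < (\<Sum>S\<in>link F v. set_encode (insert v S))"
      using initial_sum_le(2)[OF I(1)[OF vW] lsub(1)[OF W(2)[OF vW]] fin(3) I(2)[OF vW]]
        rainbow_finite enc[OF vW vsub(1)[OF vW]] enc[OF vW lsub(1)[OF W(2)[OF vW]]] I(2)[OF vW] v(2)
      by force
    then have "(\<Sum>v\<in>W. \<Sum>S\<in>I v. set_encode (insert v S)) < (\<Sum>v\<in>W. \<Sum>S\<in>link F v. set_encode (insert v S))"
      using vW by (intro sum_strict_mono_ex1[OF W(1)]) (auto intro: lev)
    then show ?thesis unfolding sumF' sumF by (intro add_le_less_mono le0)
  qed
  moreover have "F' \<subseteq> rainbow r C (Suc k)"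
    unfolding F'_def by (rule join_rainbow[OF isub(1) \<alpha> W(2) vsub(1)])
  moreover have "H1 \<subseteq> rainbow r C (Suc (Suc k))"
    unfolding H1_def by (rule join_rainbow[OF isub(2) \<alpha> W(2) vsub(2)])
  moreover have "H1 \<subseteq> spanned (Suc k) F' (Suc (Suc k))"
    unfolding F'_def H1_def
  proof (rule join_spanned[OF J0I0])
    show "J v \<subseteq> spanned k (I v) (Suc k) \<inter> spanned (Suc k) I0 (Suc k)" if "v \<in> W" for v
      using JI[OF that] JI0[OF that] by blast
    show "v \<notin> S" if "v \<in> W" "S \<in> J v" for v S
      using nin[OF that(1)] vsub(2)[OF that(1)] that(2) by blast
  qed
  moreover have "finite F'" "finite H1"
    unfolding F'_def H1_def by (rule join_finite[OF W(1)]; use isub vsub in blast)+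
  ultimately show ?thesis using cF cH by (intro exI[of _ F'] exI[of _ H1]) simp
qed

subsection \<open>The coloured Kruskal--Katona theorem\<close>

text \<open>Removing a common vertex subtracts the same power of two from both encodings, so the
  order passes to the link of \<open>v\<close>, which is an initial segment.\<close>

lemma stable_shared_vertex:
  assumes "stable r C k F (v mod r)" "A \<in> rainbow r C (Suc k)" "B \<in> F" "F \<subseteq> rainbow r C (Suc k)"
    and "set_encode A < set_encode B" "v \<in> A" "v \<in> B"
  shows "A \<in> F"
proof -
  have fin: "finite A" "finite B" using assms rainbow_finite by blast+
  have "{A} \<subseteq> rainbow r C (Suc k)" using assms by simp
  then have "link {A} v \<subseteq> rainbow r (C - {v mod r}) k" by (rule link_rainbow) simp
  moreover have "A - {v} \<in> link {A} v" using assms by (auto simp: link_def)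
  ultimately have A: "A - {v} \<in> rainbow r (C - {v mod r}) k" by blast
  have B: "B - {v} \<in> link F v" using assms by (auto simp: link_def insert_absorb)
  have "set_encode (A - {v}) < set_encode (B - {v})"
    using set_encode_remove[OF fin(1) assms(6)] set_encode_remove[OF fin(2) assms(7)] assms(5) by simp
  then have "A - {v} \<in> link F v"
    using assms(1) A B unfolding stable_def by (metis initialD)
  then show ?thesis using assms(6) by (auto simp: link_def insert_absorb)
qed

lemma stable_missing_color:
  assumes "stable r C k F \<alpha>" "A \<in> rainbow r C (Suc k)" "B \<in> F"
    and "set_encode A < set_encode B" "\<alpha> \<notin> (\<lambda>v. v mod r) ` A" "\<alpha> \<notin> (\<lambda>v. v mod r) ` B"
  shows "A \<in> F"
proof -
  have "A \<in> rainbow r (C - {\<alpha>}) (Suc k)" using assms by (auto simp: rainbow_def)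
  moreover have "B \<in> avoid r \<alpha> F" using assms by (auto simp: avoid_def)
  ultimately have "A \<in> avoid r \<alpha> F" using assms unfolding stable_def by (metis initialD)
  then show ?thesis by (simp add: avoid_def)
qed

lemma mod_eq_gap:
  fixes x z r :: nat
  assumes "x < z" "x mod r = z mod r"
  shows "x + r \<le> z"
proof -
  have "r dvd z - x" using mod_eq_dvd_iff_nat[of x z r] assms by simp
  then have "r \<le> z - x" using assms by (intro dvd_imp_le) auto
  then show ?thesis using assms by simp
qed

lemma rainbow_exchange:
  assumes B: "B \<in> rainbow r C k" and y: "y \<in> B" and x: "x \<notin> B" "x mod r \<in> C"
    and "x mod r \<notin> (\<lambda>v. v mod r) ` (B - {y})"
  shows "insert x (B - {y}) \<in> rainbow r C k"
proof -
  have k: "Suc (card (B - {y})) = k" using B y card_Suc_Diff1[of B y] by (simp add: rainbow_def)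
  have "B - {y} \<in> rainbow r C (card (B - {y}))" by (rule rainbow_subset[OF B]) auto
  from rainbow_insert[OF this x(2) assms(5)] show ?thesis using k by simp
qed

text \<open>The set \<open>L\<close> below indexes the members of \<open>H\<close> lost when \<open>B\<close> is deleted from \<open>F\<close>. If it is
  nonempty then \<open>A\<close> misses a single colour, and \<open>A\<close> lies a full period above \<open>L\<close>.\<close>

lemma stable_gap:
  assumes r: "r > 0" and C: "finite C" "Suc k < card C"
    and F: "F \<subseteq> rainbow r C (Suc k)"
    and H: "H \<subseteq> rainbow r C (Suc (Suc k)) \<inter> spanned (Suc k) F (Suc (Suc k))"
    and st: "\<And>\<alpha>. \<alpha> \<in> C \<Longrightarrow> stable r C k F \<alpha>"
    and A: "A \<in> rainbow r C (Suc k)" "A \<notin> F" and B: "B \<in> F" and AB: "set_encode A < set_encode B"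
    and L: "\<And>x. x \<in> L \<Longrightarrow> (\<forall>y\<in>B. x < y) \<and> insert x B \<in> H" and "L \<noteq> {}"
  shows "\<exists>\<rho> \<gamma>. \<rho> \<in> C - (\<lambda>v. v mod r) ` A \<and> (\<forall>x\<in>L. x mod r = \<gamma>) \<and> (\<forall>x\<in>L. \<forall>z\<in>A. x + r \<le> z)"
proof -
  let ?c = "\<lambda>S. (\<lambda>v. v mod r) ` S"
  have BR: "B \<in> rainbow r C (Suc k)" using B F by blast
  have fin: "finite A" "finite B" and card: "card A = Suc k" "card B = Suc k"
    and sub: "?c A \<subseteq> C" "?c B \<subseteq> C" and inj: "inj_on (\<lambda>v. v mod r) A" "inj_on (\<lambda>v. v mod r) B"
    using A BR by (auto simp: rainbow_def)
  have ne: "A \<noteq> {}" "B \<noteq> {}" using card by auto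
  have shared: "A \<in> F" if "S \<in> F" "set_encode A < set_encode S" "v \<in> A" "v \<in> S" for S v
    using stable_shared_vertex[OF st A(1) that(1) F that(2-4)] sub that by auto
  have missing: "A \<in> F" if "S \<in> F" "set_encode A < set_encode S" "\<alpha> \<in> C" "\<alpha> \<notin> ?c A" "\<alpha> \<notin> ?c S" for S \<alpha>
    using stable_missing_color[OF st[OF that(3)] A(1) that(1,2,4,5)] .
  have disj: "A \<inter> B = {}" using shared[OF B AB] A(2) by auto
  have cover: "?c A \<union> ?c B = C" using missing[OF B AB] A(2) sub by auto
  define b where "b = Max B"
  have b: "b \<in> B" "\<And>y. y \<in> B \<Longrightarrow> y \<le> b" using fin ne by (auto simp: b_def)
  have Ab: "z < b" if z: "z \<in> A" for z
  proof (rule ccontr)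
    assume "\<not> z < b"
    moreover have "z \<noteq> b" using disj z b(1) by auto
    ultimately have "b < z" by simp
    then have "set_encode B < set_encode A" using b(2) z fin
      by (intro set_encode_less_of_max[of A z]) (auto intro: le_less_trans)
    then show False using AB by simp
  qed
  \<comment> \<open>Consequently a member of \<open>F\<close> containing \<open>b\<close> can
    neither share a vertex with \<open>A\<close> nor miss a colour that \<open>A\<close> misses. The
    contradictions in the case of a larger \<open>B\<close> arise from such a member.\<close>
  have Aless: "set_encode A < set_encode S" if "b \<in> S" "finite S" for S
    using set_encode_less_of_max[OF that(2,1)] Ab by blast
  have Lx: "x \<notin> B" "x mod r \<in> C" "x mod r \<notin> ?c B" if "x \<in> L" for x
  proof -
    show "x \<notin> B" using L[OF that] by auto
    have "insert x B \<in> rainbow r C (Suc (Suc k))" using L[OF that] H by blast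
    then have "x mod r \<in> C" "inj_on (\<lambda>v. v mod r) (insert x B)" by (auto simp: rainbow_def)
    then show "x mod r \<in> C" "x mod r \<notin> ?c B" using \<open>x \<notin> B\<close> by auto
  qed
  have ex_missing: "\<exists>\<rho>. \<rho> \<in> C - ?c A"
  proof -
    have "card (?c A) < card C" using C card inj by (simp add: card_image)
    then have "?c A \<noteq> C" by auto
    then show ?thesis using sub by auto
  qed
  show ?thesis
  proof (cases "B = {b}")
    case True
    then obtain a where a: "A = {a}" using card by (auto simp: card_1_singleton_iff)
    have Cab: "C = {a mod r, b mod r}" using cover a True by auto
    have ab: "a mod r \<noteq> b mod r" using C Cab card a by auto
    have Lc: "x mod r = a mod r" if "x \<in> L" for x using Lx[OF that] Cab True by auto
    have "x + r \<le> a" if x: "x \<in> L" for x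
    proof -
      have "insert x B \<in> spanned (Suc k) F (Suc (Suc k))" using L[OF x] H by blast
      then have xF: "{x} \<in> F" using spannedD[of "insert x B" "Suc k" F _ "{x}"] card True by auto
      have "x < a"
      proof (rule ccontr)
        assume "\<not> x < a"
        moreover have "x \<noteq> a" using xF A a by auto
        ultimately have "a < x" by simp
        then have less: "set_encode A < set_encode {x}"
          using a by (intro set_encode_less_of_max[of _ x]) auto
        show False using missing[OF xF less, of "b mod r"] A(2) a ab Lc[OF x] Cab by auto
      qed
      then show ?thesis using mod_eq_gap Lc[OF x] by blast
    qed
    then show ?thesis using Lc a ab Cab by (intro exI[of _ "b mod r"] exI[of _ "a mod r"]) auto
  next
    case False
    then obtain y0 where y0: "y0 \<in> B" "y0 \<noteq> b" using b(1) by auto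
    obtain x0 where x0: "x0 \<in> L" using \<open>L \<noteq> {}\<close> by auto
    \<comment> \<open>Exchanging such a \<open>y\<close> for \<open>x0\<close> gives a member of
      \<open>F\<close>, because \<open>insert x0 B\<close> is spanned; it contains \<open>b\<close>
      and misses the same colour as \<open>A\<close>. So only the colour of \<open>b\<close> is
      missing from \<open>A\<close>, which forces \<open>C\<close> to have exactly k + 2
      colours.\<close>
    have cA: "y mod r \<in> ?c A" if y: "y \<in> B" "y \<noteq> b" for y
    proof (rule ccontr)
      assume n: "y mod r \<notin> ?c A"
      let ?S = "insert x0 (B - {y})"
      have "insert x0 B \<in> spanned (Suc k) F (Suc (Suc k))" using L[OF x0] H by blast
      moreover have "card ?S = Suc k" using fin card y Lx(1)[OF x0] by simp
      ultimately have SF: "?S \<in> F" using spannedD[of "insert x0 B" "Suc k" F _ ?S] by blast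
      have "y mod r \<notin> ?c ?S"
      proof
        assume "y mod r \<in> ?c ?S"
        then obtain w where w: "w \<in> ?S" "y mod r = w mod r" by auto
        show False
        proof (cases "w = x0")
          case True
          then show False using Lx(3)[OF x0] y w by (metis imageI)
        next
          case False
          then show False using inj_onD[OF inj(2), of y w] w y by auto
        qed
      qed
      moreover have "set_encode A < set_encode ?S" using Aless[of ?S] b y fin by auto
      ultimately show False using missing[OF SF _ _ n] A(2) sub y by auto
    qed
    have only: "\<rho> = b mod r" if "\<rho> \<in> C - ?c A" for \<rho> using that cover cA by auto
    obtain \<rho> where \<rho>: "\<rho> \<in> C - ?c A" using ex_missing by auto
    have \<rho>b: "\<rho> = b mod r" using only[OF \<rho>] .
    have "C - ?c A = {\<rho>}" using only \<rho> by auto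
    then have cardC: "card C = Suc (Suc k)"
      using card_Diff_subset[of "?c A" C] fin sub C inj card by (simp add: card_image)
    have "card (C - ?c B) = 1"
      using card_Diff_subset[of "?c B" C] fin sub cardC inj card by (simp add: card_image)
    then obtain \<gamma> where \<gamma>: "C - ?c B = {\<gamma>}" by (auto simp: card_1_singleton_iff)
    have Lc: "x mod r = \<gamma>" if "x \<in> L" for x using Lx(2,3)[OF that] \<gamma> by auto
    \<comment> \<open>If z were below y, replacing y by z in \<open>B\<close> would give an earlier
      set that still contains \<open>b\<close>, hence a member of \<open>F\<close> by stability at
      the colour of \<open>b\<close>. It follows \<open>A\<close> and shares z with it, so
      \<open>A\<close> would be in \<open>F\<close>.\<close>
    have above: "y < z" if z: "z \<in> A" and y: "y \<in> B" "y \<noteq> b" and c: "z mod r \<notin> ?c (B - {y})" for z y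
    proof (rule ccontr)
      assume "\<not> y < z"
      moreover have "z \<noteq> y" using disj z y by auto
      ultimately have zy: "z < y" by simp
      let ?S = "insert z (B - {y})"
      have zB: "z \<notin> B" using disj z by auto
      have SR: "?S \<in> rainbow r C (Suc k)"
        using rainbow_exchange[OF BR y(1) zB _ c] sub z by auto
      have "set_encode ?S < set_encode B" using set_encode_exchange[OF fin(2) y(1) zB zy] .
      moreover have "b \<in> ?S" using b y by auto
      ultimately have SF: "?S \<in> F"
        using stable_shared_vertex[OF st SR B F _ _ b(1)] sub b(1) by auto
      show False using shared[OF SF Aless] \<open>b \<in> ?S\<close> fin z A(2) by auto
    qed
    have "x + r \<le> z" if x: "x \<in> L" and z: "z \<in> A" for x z
    proof (cases "z mod r = \<gamma>")
      case True
      have "z mod r \<notin> ?c (B - {y0})" using True \<gamma> by auto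
      then have "y0 < z" using above[OF z y0] by simp
      then have "x < z" using L[OF x] y0(1) by (meson less_trans)
      then show ?thesis using mod_eq_gap Lc[OF x] True by auto
    next
      case False
      then have "z mod r \<in> ?c B" using \<gamma> sub z by auto
      then obtain y where y: "y \<in> B" "y mod r = z mod r" by auto
      have "y \<noteq> b" using y \<rho>b \<rho> z by auto
      moreover have "z mod r \<notin> ?c (B - {y})"
      proof
        assume "z mod r \<in> ?c (B - {y})"
        then obtain w where "w \<in> B - {y}" "z mod r = w mod r" by auto
        then show False using inj_onD[OF inj(2), of y w] y by auto
      qed
      ultimately have "y < z" using above[OF z y(1)] by simp
      then have "y + r \<le> z" using mod_eq_gap y by simp
      moreover have "x < y" using L[OF x] y by blast
      ultimately show ?thesis by simp
    qed
    then show ?thesis using \<rho> Lc by blast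
  qed
qed

text \<open>With \<open>A\<close> the least missing set and \<open>B\<close> the largest member, the
  exchange lowers the measure. It loses \<open>insert x B\<close> for x in \<open>L\<close> and
  gains \<open>insert x A\<close> for x in \<open>G\<close>, whose other (k+1)-subsets precede
  \<open>A\<close> and therefore are in \<open>F\<close>. What remains is the comparison of
  \<open>L\<close> with \<open>G\<close>.\<close>

lemma swap_stable:
  assumes r: "r > 0" and C: "finite C" "Suc k < card C"
    and F: "finite F" "F \<subseteq> rainbow r C (Suc k)"
    and H: "finite H" "H \<subseteq> rainbow r C (Suc (Suc k)) \<inter> spanned (Suc k) F (Suc (Suc k))"
    and st: "\<And>\<alpha>. \<alpha> \<in> C \<Longrightarrow> stable r C k F \<alpha>" and ni: "\<not> initial (rainbow r C (Suc k)) F"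
  shows "\<exists>F' H'. finite F' \<and> F' \<subseteq> rainbow r C (Suc k) \<and> finite H' \<and>
    H' \<subseteq> rainbow r C (Suc (Suc k)) \<inter> spanned (Suc k) F' (Suc (Suc k)) \<and>
    card F' = card F \<and> card H \<le> card H' \<and> (\<Sum>S\<in>F'. set_encode S) < (\<Sum>S\<in>F. set_encode S)"
proof -
  let ?c = "\<lambda>S. (\<lambda>v. v mod r) ` S"
  obtain S0 T0 where ST: "S0 \<in> F" "T0 \<in> rainbow r C (Suc k)" "set_encode T0 < set_encode S0" "T0 \<notin> F"
    using ni F by (auto simp: initial_def)
  obtain A where A: "A \<in> rainbow r C (Suc k) - F"
    "\<And>T. T \<in> rainbow r C (Suc k) - F \<Longrightarrow> set_encode A \<le> set_encode T"
    using ex_has_least_nat[of "\<lambda>S. S \<in> rainbow r C (Suc k) - F" T0 set_encode] ST by blast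
  obtain B where B: "B \<in> F" "\<And>T. T \<in> F \<Longrightarrow> set_encode T \<le> set_encode B"
  proof -
    have "Max (set_encode ` F) \<in> set_encode ` F" using F ST by (intro Max_in) auto
    then obtain B where "B \<in> F" "set_encode B = Max (set_encode ` F)" by auto
    then show ?thesis using that[of B] F by simp
  qed
  have AB: "set_encode A < set_encode B" using A(2)[of T0] B(2)[of S0] ST by simp
  have AR: "A \<in> rainbow r C (Suc k)" "A \<notin> F" using A by auto
  have BR: "B \<in> rainbow r C (Suc k)" using B F by blast
  have fin: "finite A" "finite B" and card: "card A = Suc k" "card B = Suc k"
    using AR BR by (auto simp: rainbow_def)
  define F' where "F' = insert A (F - {B})"
  have F': "finite F'" "F' \<subseteq> rainbow r C (Suc k)" using F AR by (auto simp: F'_def)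
  have cF: "card F' = card F" unfolding F'_def using F(1) B(1) AR(2)
      card_Suc_Diff1[OF F(1) B(1)] by simp
  have "(\<Sum>S\<in>F. set_encode S) = set_encode B + (\<Sum>S\<in>F - {B}. set_encode S)"
    using F B by (simp add: sum.remove)
  moreover have "(\<Sum>S\<in>F'. set_encode S) = set_encode A + (\<Sum>S\<in>F - {B}. set_encode S)"
    unfolding F'_def using F AR by simp
  ultimately have sum: "(\<Sum>S\<in>F'. set_encode S) < (\<Sum>S\<in>F. set_encode S)" using AB by simp
  define L where "L = {x. x \<notin> B \<and> insert x B \<in> H}"
  define G where "G = {x. (\<forall>y\<in>A. x < y) \<and> x mod r \<in> C - ?c A}"
  \<comment> \<open>An x above some y in \<open>B\<close> would make
    \<open>insert x (B - {y})\<close> a member of \<open>F\<close> larger than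
    \<open>B\<close>.\<close>
  have L: "(\<forall>y\<in>B. x < y) \<and> insert x B \<in> H" if "x \<in> L" for x
  proof (intro conjI ballI)
    show xH: "insert x B \<in> H" using that by (simp add: L_def)
    fix y assume y: "y \<in> B"
    have xB: "x \<notin> B" using that by (simp add: L_def)
    have "insert x (B - {y}) \<in> F"
      using spannedD[of "insert x B" "Suc k" F _ "insert x (B - {y})"] H xH y xB card fin by auto
    then have "set_encode (insert x (B - {y})) \<le> set_encode B" by (rule B(2))
    then have "(2::nat) ^ x \<le> 2 ^ y"
      using set_encode_remove[OF fin(2) y] set_encode_insert[of "B - {y}" x] fin xB by simp
    then show "x < y" using xB y by (cases "x = y") auto
  qed
  have finG: "finite G"
  proof -
    obtain a where "a \<in> A" using card by (metis card.empty ex_in_conv nat.distinct(1))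
    then have "G \<subseteq> {..<a}" by (auto simp: G_def)
    then show ?thesis by (rule finite_subset) simp
  qed
  have LG: "card L \<le> card G"
  proof (cases "L = {}")
    case False
    obtain \<rho> \<gamma> where \<rho>: "\<rho> \<in> C - ?c A" "\<And>x. x \<in> L \<Longrightarrow> x mod r = \<gamma>" "\<And>x z. x \<in> L \<Longrightarrow> z \<in> A \<Longrightarrow> x + r \<le> z"
      using stable_gap[OF r C F(2) H(2) st AR B(1) AB L False] by blast
    \<comment> \<open>\<open>C\<close> may contain numbers that are not residues, so \<rho> must be
      recognised as the colour of a vertex of \<open>B\<close>.\<close>
    have "\<rho> < r"
    proof -
      have "\<rho> \<in> ?c B"
      proof (rule ccontr)
        assume "\<rho> \<notin> ?c B"
        then show False using stable_missing_color[OF st AR(1) B(1) AB] \<rho>(1) AR(2) by auto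
      qed
      then show ?thesis using r by auto
    qed
    \<comment> \<open>Each x moves to colour \<rho> within its block of r consecutive numbers. The
      image is below x + r, hence below \<open>A\<close>; as all of \<open>L\<close> has colour
      \<gamma>, no two elements share a block.\<close>
    show ?thesis
    proof (rule card_inj_on_le[of "\<lambda>x. r * (x div r) + \<rho>"])
      show "inj_on (\<lambda>x. r * (x div r) + \<rho>) L"
      proof (rule inj_onI)
        fix x y assume xy: "x \<in> L" "y \<in> L" "r * (x div r) + \<rho> = r * (y div r) + \<rho>"
        have "x = r * (x div r) + \<gamma>" "y = r * (y div r) + \<gamma>"
          using \<rho>(2)[OF xy(1)] \<rho>(2)[OF xy(2)] mult_div_mod_eq[of r x] mult_div_mod_eq[of r y] by simp_all
        then show "x = y" using xy(3) by linarith
      qed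
      show "(\<lambda>x. r * (x div r) + \<rho>) ` L \<subseteq> G"
      proof (rule image_subsetI)
        fix x assume x: "x \<in> L"
        have "r * (x div r) + \<rho> < z" if "z \<in> A" for z
        proof -
          have "r * (x div r) \<le> x" by simp
          then show ?thesis using \<rho>(3)[OF x that] \<open>\<rho> < r\<close> by linarith
        qed
        then show "r * (x div r) + \<rho> \<in> G" using \<rho>(1) \<open>\<rho> < r\<close> by (auto simp: G_def)
      qed
    qed (rule finG)
  qed simp
  define H0 where "H0 = {T \<in> H. \<not> B \<subseteq> T}"
  define H1 where "H1 = (\<lambda>x. insert x A) ` G"
  have finH: "finite H0" "finite H1" using H finG by (auto simp: H0_def H1_def)
  have lost: "H - H0 = (\<lambda>x. insert x B) ` L"
  proof (intro equalityI subsetI)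
    fix T assume T: "T \<in> H - H0"
    then have BT: "B \<subseteq> T" "T \<in> H" by (auto simp: H0_def)
    have "finite T" "card T = Suc (Suc k)" using BT H by (auto simp: spanned_def)
    then have "card (T - B) = 1" using BT fin card by (simp add: card_Diff_subset)
    then obtain x where "T - B = {x}" by (auto simp: card_1_singleton_iff)
    then have "T = insert x B" "x \<notin> B" using BT by auto
    then show "T \<in> (\<lambda>x. insert x B) ` L" using BT by (auto simp: L_def)
  qed (auto simp: L_def H0_def)
  have finL: "finite L"
  proof -
    have "L \<subseteq> \<Union>H" by (auto simp: L_def)
    moreover have "finite (\<Union>H)" using H by (auto simp: spanned_def)
    ultimately show ?thesis by (rule finite_subset)
  qed
  have "card H = card H0 + card (H - H0)"
    using H(1) card_Diff_subset[of H0 H] card_mono[of H H0] finH by (auto simp: H0_def)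
  also have "\<dots> \<le> card H0 + card L" unfolding lost by (simp add: card_image_le finL)
  also have "\<dots> \<le> card H0 + card G" using LG by simp
  also have "card G = card H1"
  proof -
    have "inj_on (\<lambda>x. insert x A) G" by (intro inj_onI) (auto simp: G_def)
    then show ?thesis by (simp add: H1_def card_image)
  qed
  also have "card H0 + card H1 = card (H0 \<union> H1)"
  proof -
    have "T \<notin> H1" if T: "T \<in> H0" for T
    proof
      assume "T \<in> H1"
      then have "A \<subseteq> T" by (auto simp: H1_def)
      moreover have "T \<in> spanned (Suc k) F (Suc (Suc k))" using T H by (auto simp: H0_def)
      ultimately have "A \<in> F" using spannedD card by blast
      then show False using AR by simp
    qed
    then show ?thesis using finH by (subst card_Un_disjoint) auto
  qed
  finally have cH: "card H \<le> card (H0 \<union> H1)" .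
  have H0': "H0 \<subseteq> rainbow r C (Suc (Suc k)) \<inter> spanned (Suc k) F' (Suc (Suc k))"
  proof
    fix T assume T: "T \<in> H0"
    then have T': "T \<in> rainbow r C (Suc (Suc k))" "T \<in> spanned (Suc k) F (Suc (Suc k))" "\<not> B \<subseteq> T"
      using H by (auto simp: H0_def)
    have "S \<in> F'" if "S \<subseteq> T" "card S = Suc k" for S
      using spannedD[OF T'(2) that] T'(3) that by (auto simp: F'_def)
    then show "T \<in> rainbow r C (Suc (Suc k)) \<inter> spanned (Suc k) F' (Suc (Suc k))"
      using T' by (auto simp: spanned_def)
  qed
  have H1': "H1 \<subseteq> rainbow r C (Suc (Suc k)) \<inter> spanned (Suc k) F' (Suc (Suc k))"
  proof
    fix T assume "T \<in> H1"
    then obtain x where x: "x \<in> G" "T = insert x A" by (auto simp: H1_def)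
    have xA: "x \<notin> A" using x by (auto simp: G_def)
    have TR: "T \<in> rainbow r C (Suc (Suc k))"
      unfolding x(2) using x(1) by (intro rainbow_insert[OF AR(1)]) (auto simp: G_def)
    have fT: "finite T" "card T = Suc (Suc k)" using TR by (auto simp: rainbow_def)
    have "S \<in> F'" if S: "S \<subseteq> T" "card S = Suc k" for S
    proof (cases "S = A")
      case False
      have "card (T - S) = 1" using S fT finite_subset[of S T] by (simp add: card_Diff_subset)
      then obtain y where y: "T - S = {y}" by (auto simp: card_1_singleton_iff)
      have "y \<noteq> x"
      proof
        assume "y = x"
        then have "S = A" using y x(2) xA S by auto
        then show False using False by simp
      qed
      then have yA: "y \<in> A" and Seq: "S = insert x (A - {y})" using y S x(2) xA by auto
      have less: "set_encode S < set_encode A"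
        unfolding Seq using x(1) yA by (intro set_encode_exchange[OF fin(1) yA xA]) (auto simp: G_def)
      have "S \<in> rainbow r C (Suc k)" using rainbow_subset[OF TR S(1)] S(2) by simp
      then have "S \<in> F" using A(2)[of S] less by auto
      moreover have "S \<noteq> B" using less AB by auto
      ultimately show ?thesis by (simp add: F'_def)
    qed (simp add: F'_def)
    then show "T \<in> rainbow r C (Suc (Suc k)) \<inter> spanned (Suc k) F' (Suc (Suc k))"
      using TR fT by (auto simp: spanned_def)
  qed
  show ?thesis using F' cF sum finH cH H0' H1'
    by (intro exI[of _ F'] exI[of _ "H0 \<union> H1"]) simp
qed

text \<open>By \<open>spanned_initial\<close> the spanned rainbow sets form a down-set. A member
  \<open>T\<close> of \<open>J\<close> outside it comes after all of \<open>H\<close>, so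
  \<open>J\<close> would contain \<open>H\<close> and also \<open>T\<close>.\<close>

lemma ffk_initial:
  assumes F: "initial (rainbow r C k) F"
    and H: "finite H" "H \<subseteq> rainbow r C (Suc k) \<inter> spanned k F (Suc k)"
    and J: "initial (rainbow r C (Suc k)) J" "card J \<le> card H"
  shows "J \<subseteq> spanned k F (Suc k)"
proof (rule ccontr)
  assume "\<not> J \<subseteq> spanned k F (Suc k)"
  then obtain T where T: "T \<in> J" "T \<notin> spanned k F (Suc k)" by auto
  have TR: "T \<in> rainbow r C (Suc k)" using T J by (auto simp: initial_def)
  have "H \<subseteq> J"
  proof
    fix U assume U: "U \<in> H"
    then have "\<not> set_encode T \<le> set_encode U" using spanned_initial[OF F _ TR] T H by blast
    then show "U \<in> J" using initialD[OF J(1) T(1)] U H by auto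
  qed
  moreover have "T \<notin> H" using T H by blast
  ultimately have "H \<subset> J" using T by auto
  moreover have "finite J" using J by (simp add: initial_def)
  ultimately show False using J(2) psubset_card_mono[of J H] by simp
qed

lemma rainbow_zero: "rainbow r C 0 = {{}}"
  by (auto simp: rainbow_def)

text \<open>The outer induction on the number of colours serves the compressions, the inner one on
  the sum of encodings serves both moves. Each move keeps the size of \<open>F\<close> and does not
  shrink \<open>H\<close>, so \<open>I\<close> and \<open>J\<close> stay valid throughout.\<close>

theorem ffk_holds:
  assumes r: "r > 0" and "finite C"
  shows "ffk_optimal r C k"
  using \<open>finite C\<close>
proof (induction "card C" arbitrary: C k rule: less_induct)
  case (less C k)
  note C = \<open>finite C\<close>
  have "J \<subseteq> spanned k I (Suc k)"
    if "finite F" "F \<subseteq> rainbow r C k" "finite H"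
      "H \<subseteq> rainbow r C (Suc k) \<inter> spanned k F (Suc k)"
      "initial (rainbow r C k) I" "card I = card F"
      "initial (rainbow r C (Suc k)) J" "card J \<le> card H" for F H I J
    using that
  proof (induction "\<Sum>S\<in>F. set_encode S" arbitrary: F H rule: less_induct)
    case (less F H)
    note F = less.prems(1,2) and H = less.prems(3,4) and I = less.prems(5,6) and J = less.prems(7,8)
    consider "initial (rainbow r C k) F" | "H = {}" | "\<not> initial (rainbow r C k) F" "H \<noteq> {}" by blast
    then show ?case
    proof cases
      case 1
      have "F = I"
        using initial_mono[OF 1 I(1)] initial_mono[OF I(1) 1] I(2) rainbow_finite by (simp add: subset_antisym)
      then show ?thesis using ffk_initial[OF 1 H J] by simp
    next
      case 2
      then show ?thesis using J by (auto simp: initial_def)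
    next
      case 3
      have "k \<noteq> 0"
      proof
        assume "k = 0"
        then show False using 3(1) F by (auto simp: rainbow_zero initial_def)
      qed
      then obtain k' where k: "k = Suc k'" using not0_implies_Suc by blast
      obtain T where "T \<in> H" using 3 by auto
      then have "Suc k \<le> card C" using rainbow_card_le[of T r C "Suc k"] H C by blast
      then have kC: "Suc k' < card C" using k by simp
      have "\<exists>F' H'. finite F' \<and> F' \<subseteq> rainbow r C k \<and> finite H' \<and>
        H' \<subseteq> rainbow r C (Suc k) \<inter> spanned k F' (Suc k) \<and>
        card F' = card F \<and> card H \<le> card H' \<and> (\<Sum>S\<in>F'. set_encode S) < (\<Sum>S\<in>F. set_encode S)"
      proof (cases "\<forall>\<alpha>\<in>C. stable r C k' F \<alpha>")
        case True
        then show ?thesis using swap_stable[OF r C kC F(1) _ H(1)] F(2) H(2) 3(1) unfolding k by blast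
      next
        case False
        then obtain \<alpha> where \<alpha>: "\<alpha> \<in> C" "\<not> stable r C k' F \<alpha>" by auto
        have "card (C - {\<alpha>}) < card C" using \<alpha> C by (meson card_Diff1_less)
        then have ih: "ffk_optimal r (C - {\<alpha>}) n" for n
          using \<open>\<And>D n. card D < card C \<Longrightarrow> finite D \<Longrightarrow> ffk_optimal r D n\<close> C by simp
        obtain F' H' where "finite F'" "F' \<subseteq> rainbow r C k" "finite H'"
          "H' \<subseteq> rainbow r C (Suc k) \<inter> spanned k F' (Suc k)"
          "card F' = card F" "card H' = card H" "(\<Sum>S\<in>F'. set_encode S) < (\<Sum>S\<in>F. set_encode S)"
          using compress_unstable[OF ih ih \<alpha>(1) F(1) F(2)[unfolded k] H(1) H(2)[unfolded k] \<alpha>(2)]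
          unfolding k by blast
        then show ?thesis by (intro exI[of _ F'] exI[of _ H']) simp
      qed
      then obtain F' H' where FH: "finite F'" "F' \<subseteq> rainbow r C k" "finite H'"
        "H' \<subseteq> rainbow r C (Suc k) \<inter> spanned k F' (Suc k)"
        "card F' = card F" "card H \<le> card H'" "(\<Sum>S\<in>F'. set_encode S) < (\<Sum>S\<in>F. set_encode S)"
        by blast
      show ?thesis
        by (rule less.hyps[OF FH(7,1-4) I(1) _ J(1)]) (use FH I J in simp_all)
    qed
  qed
  then show ?case unfolding ffk_optimal_def by presburger
qed

theorem colored_kruskal_katona:
  assumes r: "r > 0" and C: "finite C" and kl: "k \<le> l"
    and F: "finite F" "F \<subseteq> rainbow r C k"
    and H: "finite H" "H \<subseteq> rainbow r C l \<inter> spanned k F l"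
    and I: "initial (rainbow r C k) I" "card I = card F"
    and J: "initial (rainbow r C l) J" "card J \<le> card H"
  shows "J \<subseteq> spanned k I l"
  using kl H J
proof (induction l arbitrary: H J rule: dec_induct)
  case base
  have "H \<subseteq> F" using base by (auto simp: spanned_same)
  then have "card H \<le> card F" using F by (intro card_mono)
  then have "card J \<le> card I" using base I by simp
  then have "J \<subseteq> I" using initial_mono[OF base(3) I(1)] rainbow_finite by blast
  moreover have "J \<subseteq> rainbow r C k" using base by (simp add: initial_def)
  ultimately show ?case by (auto simp: spanned_same rainbow_def)
next
  case (step l)
  \<comment> \<open>The shadow of \<open>H\<close> at level l is spanned by \<open>F\<close> and
    itself spans \<open>H\<close>, so it links the induction hypothesis with the result for adjacent
    levels.\<close>
  define H' where "H' = {S. card S = l \<and> (\<exists>T\<in>H. S \<subseteq> T)}"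
  have HR: "H \<subseteq> rainbow r C (Suc l)" using step.prems by blast
  have "finite (\<Union>H)" using step.prems(1) HR rainbow_finite by blast
  then have "finite (Pow (\<Union>H))" by simp
  moreover have "H' \<subseteq> Pow (\<Union>H)" by (auto simp: H'_def)
  ultimately have fH': "finite H'" by (rule finite_subset[rotated])
  have H'R: "H' \<subseteq> rainbow r C l"
  proof
    fix S assume "S \<in> H'"
    then obtain T where "T \<in> H" "S \<subseteq> T" "card S = l" by (auto simp: H'_def)
    then show "S \<in> rainbow r C l" using rainbow_subset[of T r C "Suc l" S] HR by blast
  qed
  have H'S: "H' \<subseteq> spanned k F l"
  proof
    fix S assume S: "S \<in> H'"
    then obtain T where T: "T \<in> H" "S \<subseteq> T" by (auto simp: H'_def)
    have "T \<in> spanned k F (Suc l)" using T step.prems by blast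
    then show "S \<in> spanned k F l" using S T H'R by (auto simp: spanned_def rainbow_def)
  qed
  have HH': "H \<subseteq> spanned l H' (Suc l)"
    using HR by (auto simp: spanned_def rainbow_def H'_def)
  obtain J' where J': "initial (rainbow r C l) J'" "card J' = card H'"
    using initial_exists[OF _ H'R fH'] rainbow_finite by blast
  have "J' \<subseteq> spanned k I l" using step.IH[OF fH' _ J'(1)] H'R H'S J'(2) by simp
  moreover have "J \<subseteq> spanned l J' (Suc l)"
    using ffk_optimalD[OF ffk_holds[OF r C] fH' H'R step.prems(1) _ J' step.prems(3,4)] HR HH' by blast
  ultimately have "J \<subseteq> spanned l (spanned k I l) (Suc l)"
    using spanned_mono[of J' "spanned k I l" l "Suc l"] by blast
  then show ?case using spanned_spanned[of k l "Suc l" I] step.hyps by simp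
qed

subsection \<open>The Kruskal--Katona theorem\<close>

definition ksets :: "nat \<Rightarrow> 'a set set" where
  "ksets k = {S. finite S \<and> card S = k}"

lemma ksets_finite: "S \<in> ksets k \<Longrightarrow> finite S"
  by (simp add: ksets_def)

lemma spanned_subset_ksets: "spanned k F l \<subseteq> ksets l"
  by (auto simp: spanned_def ksets_def)

lemma rainbow_subset_ksets: "rainbow r C k \<subseteq> ksets k"
  by (auto simp: rainbow_def ksets_def)

lemma rainbow_of_small:
  assumes "S \<subseteq> {..<r}" "card S = k"
  shows "S \<in> rainbow r {..<r} k"
proof -
  have "v mod r = v" if "v \<in> S" for v using assms that by auto
  then have "inj_on (\<lambda>v. v mod r) S" "(\<lambda>v. v mod r) ` S = S" by (auto simp: inj_on_def)
  moreover have "finite S" using assms finite_subset by blast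
  ultimately show ?thesis using assms by (simp add: rainbow_def)
qed

lemma bounded_families:
  fixes X :: "nat set set"
  assumes "finite X" "\<And>S. S \<in> X \<Longrightarrow> finite S"
  obtains N where "N > 0" "\<And>S. S \<in> X \<Longrightarrow> S \<subseteq> {..<N}"
proof -
  have "finite (\<Union>X)" using assms by auto
  then obtain N where "\<Union>X \<subseteq> {..<N}" using finite_nat_iff_bounded by blast
  then have "S \<subseteq> {..<Suc N}" if "S \<in> X" for S using that by fastforce
  then show thesis using that[of "Suc N"] by blast
qed

text \<open>\<open>kk_feasible k l m h\<close> says that the Kruskal--Katona bound for the number of \<open>l\<close>-sets spanned
  by \<open>m\<close> sets of size \<open>k\<close> is at least \<open>h\<close>.\<close>

definition kk_feasible :: "nat \<Rightarrow> nat \<Rightarrow> nat \<Rightarrow> nat \<Rightarrow> bool" where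
  "kk_feasible k l m h \<longleftrightarrow> (\<exists>F H :: nat set set. finite F \<and> F \<subseteq> ksets k \<and> finite H \<and>
     H \<subseteq> spanned k F l \<and> card F \<le> m \<and> h \<le> card H)"

lemma kk_mono: "kk_feasible k l m h \<Longrightarrow> m \<le> m' \<Longrightarrow> h' \<le> h \<Longrightarrow> kk_feasible k l m' h'"
  unfolding kk_feasible_def by (meson order_trans)

lemma kk_zero: "kk_feasible k l m 0"
  unfolding kk_feasible_def by (intro exI[of _ "{}"]) auto

lemma spanned_image:
  assumes inj: "inj_on f V" and T: "T \<in> spanned k F l" "T \<subseteq> V"
  shows "f ` T \<in> spanned k ((`) f ` F) l"
proof -
  have injT: "inj_on f T" using inj T inj_on_subset by blast
  have "S \<in> (`) f ` F" if S: "S \<subseteq> f ` T" "card S = k" for S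
  proof -
    define S0 where "S0 = T \<inter> f -` S"
    have eq: "S = f ` S0" using S by (auto simp: S0_def)
    have "inj_on f S0" using injT by (rule inj_on_subset) (auto simp: S0_def)
    then have "card S0 = k" using S eq by (simp add: card_image)
    then have "S0 \<in> F" using spannedD[OF T(1)] by (auto simp: S0_def)
    then show ?thesis using eq by blast
  qed
  then show ?thesis using T injT by (auto simp: spanned_def card_image)
qed

text \<open>Relabelling the finitely many vertices by naturals makes cliques of arbitrary graphs
  available as witnesses.\<close>

lemma kk_feasibleI:
  fixes F H :: "'a set set"
  assumes F: "finite F" "F \<subseteq> ksets k" and H: "finite H" "H \<subseteq> spanned k F l"
    and c: "card F \<le> m" "h \<le> card H"
  shows "kk_feasible k l m h"
proof -
  define V where "V = \<Union>F \<union> \<Union>H"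
  have "finite V" using F H by (auto simp: V_def ksets_def spanned_def)
  then obtain f :: "'a \<Rightarrow> nat" where f: "inj_on f V" using finite_imp_inj_to_nat_seg by metis
  have cards: "card ((`) f ` X) = card X" if "\<Union>X \<subseteq> V" for X
  proof (rule card_image, rule inj_on_image)
    show "inj_on f (\<Union>X)" using f that inj_on_subset by blast
  qed
  have "(`) f ` F \<subseteq> ksets k"
  proof
    fix T assume "T \<in> (`) f ` F"
    then obtain S where S: "S \<in> F" "T = f ` S" by auto
    then have "inj_on f S" using f by (auto simp: V_def intro: inj_on_subset)
    then show "T \<in> ksets k" using S F by (auto simp: ksets_def card_image)
  qed
  moreover have "(`) f ` H \<subseteq> spanned k ((`) f ` F) l"
  proof
    fix T assume "T \<in> (`) f ` H"
    then obtain S where S: "S \<in> H" "T = f ` S" by auto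
    then show "T \<in> spanned k ((`) f ` F) l" using spanned_image[OF f, of S k F l] H(2) by (auto simp: V_def)
  qed
  moreover have "card ((`) f ` F) = card F" "card ((`) f ` H) = card H"
    by (rule cards, auto simp: V_def)+
  ultimately show ?thesis
    unfolding kk_feasible_def using F H c by (intro exI[of _ "(`) f ` F"] exI[of _ "(`) f ` H"]) simp
qed

lemma initial_ksets_exists:
  fixes F :: "nat set set"
  assumes "finite F" "F \<subseteq> ksets k" "n \<le> card F"
  shows "\<exists>I. initial (ksets k) I \<and> card I = n"
  by (rule initial_exists_le[OF _ assms(2,1,3)]) (simp add: ksets_def)

text \<open>The coloured theorem with r above every vertex that occurs, so that these vertices have
  distinct colours. An initial segment of all k-sets remains one among the fewer rainbow
  sets.\<close>

theorem kruskal_katona: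
  assumes kk_feasible: "kk_feasible k l m h" and kl: "k \<le> l"
    and I: "initial (ksets k) I" "m \<le> card I" and J: "initial (ksets l) J" "card J \<le> h"
  shows "J \<subseteq> spanned k I l"
proof -
  obtain F H :: "nat set set" where F: "finite F" "F \<subseteq> ksets k" and H: "finite H" "H \<subseteq> spanned k F l"
    and c: "card F \<le> m" "h \<le> card H" using kk_feasible by (auto simp: kk_feasible_def)
  have IJ: "finite I" "I \<subseteq> ksets k" "finite J" "J \<subseteq> ksets l" using I J by (auto simp: initial_def)
  have HK: "H \<subseteq> ksets l" using H spanned_subset_ksets by blast
  obtain I0 where I0: "initial (ksets k) I0" "card I0 = card F"
    using initial_ksets_exists[OF F order_refl] by blast
  have "I0 \<subseteq> I" by (rule initial_mono[OF I0(1) I(1)]) (use I0(2) c I(2) ksets_finite in auto)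
  have "finite (F \<union> H \<union> I \<union> J)" "\<And>S. S \<in> F \<union> H \<union> I \<union> J \<Longrightarrow> finite S"
    using F H IJ HK by (auto simp: ksets_def)
  then obtain r where r: "r > 0" "\<And>S. S \<in> F \<union> H \<union> I \<union> J \<Longrightarrow> S \<subseteq> {..<r}"
    using bounded_families[of "F \<union> H \<union> I \<union> J"] by blast
  have rb: "S \<in> rainbow r {..<r} n" if "S \<in> F \<union> H \<union> I \<union> J" "S \<in> ksets n" for S n
    using rainbow_of_small[OF r(2)[OF that(1)]] that(2) by (simp add: ksets_def)
  have ini: "initial (rainbow r {..<r} n) X" if "initial (ksets n) X" "X \<subseteq> F \<union> H \<union> I \<union> J" for X n
    unfolding initial_def
  proof (intro conjI ballI impI)
    show "X \<subseteq> rainbow r {..<r} n" using that rb by (meson initial_def subset_iff)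
    fix S T assume "S \<in> X" "T \<in> rainbow r {..<r} n" "set_encode T < set_encode S"
    then show "T \<in> X" using initialD[OF that(1)] rainbow_subset_ksets by blast
  qed (use that in \<open>simp add: initial_def\<close>)
  have "J \<subseteq> spanned k I0 l"
  proof (rule colored_kruskal_katona[OF r(1) _ kl F(1) _ H(1)])
    show "F \<subseteq> rainbow r {..<r} k" using rb F(2) by blast
    show "H \<subseteq> rainbow r {..<r} l \<inter> spanned k F l" using rb H(2) HK by blast
    show "initial (rainbow r {..<r} k) I0" using ini[OF I0(1)] \<open>I0 \<subseteq> I\<close> by blast
    show "initial (rainbow r {..<r} l) J" using ini[OF J(1)] by blast
  qed (use I0 J c in simp_all)
  then show ?thesis using spanned_mono[OF \<open>I0 \<subseteq> I\<close>] by blast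
qed

text \<open>A shift by \<open>N\<close> makes the second pair of families disjoint from the first.
  This needs k positive, because the empty set cannot be shifted away.\<close>

lemma kk_add:
  assumes "kk_feasible k l m h" "kk_feasible k l m' h'" and k: "0 < k" "k \<le> l"
  shows "kk_feasible k l (m + m') (h + h')"
proof -
  obtain F H :: "nat set set" where F: "finite F" "F \<subseteq> ksets k" and H: "finite H" "H \<subseteq> spanned k F l"
    and c: "card F \<le> m" "h \<le> card H" using assms(1) by (auto simp: kk_feasible_def)
  obtain F' H' :: "nat set set" where F': "finite F'" "F' \<subseteq> ksets k" and H': "finite H'" "H' \<subseteq> spanned k F' l"
    and c': "card F' \<le> m'" "h' \<le> card H'" using assms(2) by (auto simp: kk_feasible_def)
  have K: "H \<subseteq> ksets l" "H' \<subseteq> ksets l" using H H' spanned_subset_ksets by blast+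
  have "finite (F \<union> H)" "\<And>S. S \<in> F \<union> H \<Longrightarrow> finite S"
    using F H K by (auto simp: ksets_def)
  then obtain N where N: "\<And>S. S \<in> F \<union> H \<Longrightarrow> S \<subseteq> {..<N}"
    using bounded_families[of "F \<union> H"] by blast
  let ?f = "(+) N"
  have inj: "inj_on ?f V" for V by simp
  have injI: "inj_on ((`) ?f) X" for X by (rule inj_on_image) simp
  have disj: "X \<inter> (`) ?f ` Y = {}" if X: "X \<subseteq> F \<union> H" "X \<subseteq> ksets n" "0 < n" for X Y n
  proof -
    have "S \<noteq> ?f ` T" if S: "S \<in> X" for S T
    proof
      assume eq: "S = ?f ` T"
      have "S \<noteq> {}" using S X by (auto simp: ksets_def)
      then obtain x where x: "x \<in> S" by auto
      have "x < N" using N[of S] S X x by auto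
      moreover have "N \<le> x" using x eq by auto
      ultimately show False by simp
    qed
    then show ?thesis by auto
  qed
  have F'K: "(`) ?f ` F' \<subseteq> ksets k"
    using F' by (auto simp: ksets_def card_image)
  have cF: "card (F \<union> (`) ?f ` F') = card F + card F'"
    using F F' disj[of F k F'] k by (subst card_Un_disjoint) (auto simp: card_image injI)
  have cH: "card (H \<union> (`) ?f ` H') = card H + card H'"
    using H H' K disj[of H l H'] k by (subst card_Un_disjoint) (auto simp: card_image injI)
  have "(`) ?f ` H' \<subseteq> spanned k ((`) ?f ` F') l"
    using spanned_image[OF inj[of UNIV], of _ k F' l] H' by blast
  then have "H \<union> (`) ?f ` H' \<subseteq> spanned k (F \<union> (`) ?f ` F') l"
    using H spanned_mono[of F "F \<union> (`) ?f ` F'" k l] spanned_mono[of "(`) ?f ` F'" "F \<union> (`) ?f ` F'" k l]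
    by blast
  then show ?thesis
    using F F' F'K H H' c c' cF cH by (intro kk_feasibleI[of "F \<union> (`) ?f ` F'" k "H \<union> (`) ?f ` H'"]) auto
qed

lemma card_cone:
  assumes "finite X0" "finite X" "\<And>S. S \<in> X0 \<Longrightarrow> w \<notin> S" "\<And>S. S \<in> X \<Longrightarrow> w \<notin> S"
  shows "card (join X0 (\<lambda>_. X) {w}) = card X0 + card X"
  using sum_join[of "{w}" X0 "\<lambda>_. X" "\<lambda>_. 1"] assms by simp

text \<open>The new vertex of the cone is joined to initial segments, where the smaller of two
  families is contained in the larger one.\<close>

lemma kk_cone:
  assumes kz: "kk_feasible (Suc k) (Suc l) z hz" and ka: "kk_feasible k l a h" and kz': "kk_feasible (Suc k) l z h" and kl: "Suc k \<le> l"
  shows "kk_feasible (Suc k) (Suc l) (z + a) (hz + h)"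
proof -
  obtain F1 H1 :: "nat set set" where 1: "finite F1" "F1 \<subseteq> ksets (Suc k)" "finite H1"
    "H1 \<subseteq> spanned (Suc k) F1 (Suc l)" "card F1 \<le> z" "hz \<le> card H1" using kz by (auto simp: kk_feasible_def)
  obtain F2 H2 :: "nat set set" where 2: "finite F2" "F2 \<subseteq> ksets k" "finite H2"
    "H2 \<subseteq> spanned k F2 l" "card F2 \<le> a" "h \<le> card H2" using ka by (auto simp: kk_feasible_def)
  obtain F3 H3 :: "nat set set" where 3: "finite F3" "F3 \<subseteq> ksets (Suc k)" "finite H3"
    "H3 \<subseteq> spanned (Suc k) F3 l" "card F3 \<le> z" "h \<le> card H3" using kz' by (auto simp: kk_feasible_def)
  \<comment> \<open>A single segment must span \<open>J1\<close> at level \<open>Suc l\<close> and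
    \<open>J\<close> at level \<open>l\<close>, so it takes the larger of the two sizes; both are at
    most \<open>z\<close>.\<close>
  obtain I where I: "initial (ksets (Suc k)) I" "card I = max (card F1) (card F3)"
    using initial_ksets_exists[OF 1(1,2) order_refl] initial_ksets_exists[OF 3(1,2) order_refl]
    by (metis max_def)
  obtain Ia where Ia: "initial (ksets k) Ia" "card Ia = card F2"
    using initial_ksets_exists[OF 2(1,2) order_refl] by blast
  have K: "H1 \<subseteq> ksets (Suc l)" "H2 \<subseteq> ksets l" using 1 2 spanned_subset_ksets by blast+
  obtain J1 where J1: "initial (ksets (Suc l)) J1" "card J1 = hz"
    using initial_ksets_exists[OF 1(3) K(1) 1(6)] by blast
  obtain J where J: "initial (ksets l) J" "card J = h"
    using initial_ksets_exists[OF 2(3) K(2) 2(6)] by blast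
  have "kk_feasible (Suc k) (Suc l) (card I) hz" using 1 I(2) by (intro kk_feasibleI[of F1 _ H1]) auto
  then have s1: "J1 \<subseteq> spanned (Suc k) I (Suc l)" using kruskal_katona[OF _ _ I(1) _ J1(1)] J1(2) kl by simp
  have "kk_feasible k l (card Ia) h" using 2 Ia(2) by (intro kk_feasibleI[of F2 _ H2]) auto
  then have s2: "J \<subseteq> spanned k Ia l" using kruskal_katona[OF _ _ Ia(1) _ J(1)] J(2) kl by simp
  have "kk_feasible (Suc k) l (card I) h" using 3 I(2) by (intro kk_feasibleI[of F3 _ H3]) auto
  then have s3: "J \<subseteq> spanned (Suc k) I l" using kruskal_katona[OF _ _ I(1) _ J(1)] J(2) kl by simp
  have fin: "finite I" "finite Ia" "finite J1" "finite J" and sub: "I \<subseteq> ksets (Suc k)" "Ia \<subseteq> ksets k"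
    "J1 \<subseteq> ksets (Suc l)" "J \<subseteq> ksets l"
    using I Ia J1 J by (auto simp: initial_def)
  have "finite (I \<union> Ia \<union> J1 \<union> J)" "\<And>S. S \<in> I \<union> Ia \<union> J1 \<union> J \<Longrightarrow> finite S"
    using fin sub by (auto simp: ksets_def)
  then obtain w where w: "\<And>S. S \<in> I \<union> Ia \<union> J1 \<union> J \<Longrightarrow> S \<subseteq> {..<w}"
    using bounded_families[of "I \<union> Ia \<union> J1 \<union> J"] by blast
  have nw: "w \<notin> S" if "S \<in> I \<union> Ia \<union> J1 \<union> J" for S using w[OF that] by auto
  show ?thesis
  proof (rule kk_feasibleI)
    show "join I (\<lambda>_. Ia) {w} \<subseteq> ksets (Suc k)" using sub nw by (auto simp: join_def ksets_def)
    show "join J1 (\<lambda>_. J) {w} \<subseteq> spanned (Suc k) (join I (\<lambda>_. Ia) {w}) (Suc l)"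
      using join_spanned[OF s1, of "{w}" "\<lambda>_. J" "\<lambda>_. Ia"] s2 s3 nw by blast
    show "card (join I (\<lambda>_. Ia) {w}) \<le> z + a"
      using card_cone[of I Ia w] fin nw 1 2 3 I Ia by auto
    show "hz + h \<le> card (join J1 (\<lambda>_. J) {w})"
      using card_cone[of J1 J w] fin nw J1 J by auto
  qed (use fin in \<open>auto simp: join_def\<close>)
qed

text \<open>At level 0 the bound is infinite: the empty set alone spans every l-set, and intervals
  supply as many of these as desired.\<close>

lemma kk_zero_level:
  assumes "0 < m" "0 < l"
  shows "kk_feasible 0 l m h"
proof (rule kk_feasibleI)
  let ?H = "(\<lambda>x. {x..<x + l}) ` {..<h}"
  have inj: "inj_on (\<lambda>x::nat. {x..<x + l}) {..<h}"
  proof (rule inj_onI)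
    fix x y assume eq: "{x..<x + l} = {y..<y + l}"
    have "x \<in> {y..<y + l}" using assms unfolding eq[symmetric] by simp
    moreover have "y \<in> {x..<x + l}" using assms unfolding eq by simp
    ultimately show "x = y" by simp
  qed
  show "h \<le> card ?H" using card_image[OF inj] by simp
  show "?H \<subseteq> spanned 0 {{}} l" by (auto simp: spanned_def dest: finite_subset)
qed (use assms in \<open>auto simp: ksets_def\<close>)

lemma kk_meeting:
  fixes F H :: "'a set set"
  assumes W: "finite W" and F: "finite F" "F \<subseteq> ksets (Suc k)"
    and H: "finite H" "H \<subseteq> spanned (Suc k) F (Suc l)" and kl: "k \<le> l" "0 < l"
  shows "kk_feasible k l (card {S \<in> F. S \<inter> W \<noteq> {}}) (card {T \<in> H. T \<inter> W \<noteq> {}})"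
proof (cases "k = 0")
  case True
  show ?thesis
  proof (cases "{S \<in> F. S \<inter> W \<noteq> {}} = {}")
    case empty: True
    have "T \<inter> W = {}" if T: "T \<in> H" for T
    proof (rule ccontr)
      assume "T \<inter> W \<noteq> {}"
      then obtain w where w: "w \<in> T" "w \<in> W" by auto
      have "{w} \<in> F" using spannedD[of T "Suc k" F "Suc l" "{w}"] T H w True by auto
      then show False using empty w by auto
    qed
    then have "{T \<in> H. T \<inter> W \<noteq> {}} = {}" by auto
    then show ?thesis by (simp only: card.empty kk_zero)
  next
    case False
    then have "0 < card {S \<in> F. S \<inter> W \<noteq> {}}" using F by (simp add: card_gt_0_iff)
    then show ?thesis using kk_zero_level kl True by simp
  qed
next
  case False
  show ?thesis using W
  proof (induction W rule: finite_induct)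
    case empty
    then show ?case using kk_zero by simp
  next
    case (insert w W)
    define F1 where "F1 = {S \<in> F. w \<in> S \<and> S \<inter> W = {}}"
    define H1 where "H1 = {T \<in> H. w \<in> T \<and> T \<inter> W = {}}"
    have split: "card {S \<in> X. S \<inter> insert w W \<noteq> {}}
        = card {S \<in> X. S \<inter> W \<noteq> {}} + card {S \<in> X. w \<in> S \<and> S \<inter> W = {}}" if "finite X" for X
    proof -
      have "{S \<in> X. S \<inter> insert w W \<noteq> {}} = {S \<in> X. S \<inter> W \<noteq> {}} \<union> {S \<in> X. w \<in> S \<and> S \<inter> W = {}}" by auto
      then show ?thesis using that by (simp add: card_Un_disjoint disjoint_iff)
    qed
    have inj: "inj_on (\<lambda>S. S - {w}) {S. w \<in> S}" by (auto simp: inj_on_def)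
    have cards: "card ((\<lambda>S. S - {w}) ` F1) = card F1" "card ((\<lambda>S. S - {w}) ` H1) = card H1"
      by (rule card_image, rule inj_on_subset[OF inj], auto simp: F1_def H1_def)+
    have "kk_feasible k l (card F1) (card H1)"
    proof (rule kk_feasibleI)
      show "(\<lambda>S. S - {w}) ` F1 \<subseteq> ksets k" using F by (auto simp: F1_def ksets_def)
      show "(\<lambda>S. S - {w}) ` H1 \<subseteq> spanned k ((\<lambda>S. S - {w}) ` F1) l"
      proof (rule image_subsetI)
        fix T assume T: "T \<in> H1"
        then have T': "T \<in> spanned (Suc k) F (Suc l)" "w \<in> T" "T \<inter> W = {}" using H by (auto simp: H1_def)
        have fT: "finite T" "card T = Suc l" using T' by (auto simp: spanned_def)
        have "S \<in> (\<lambda>S. S - {w}) ` F1" if S: "S \<subseteq> T - {w}" "card S = k" for S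
        proof -
          have "finite S" using S fT finite_subset by blast
          then have "card (insert w S) = Suc k" using S by (subst card_insert_disjoint) auto
          then have "insert w S \<in> F" using spannedD[OF T'(1), of "insert w S"] S T' by auto
          then have "insert w S \<in> F1" using S T' by (auto simp: F1_def)
          moreover have "S = insert w S - {w}" using S by auto
          ultimately show ?thesis by blast
        qed
        then show "T - {w} \<in> spanned k ((\<lambda>S. S - {w}) ` F1) l" using fT T' by (auto simp: spanned_def)
      qed
    qed (use F H cards in \<open>auto simp: F1_def H1_def\<close>)
    from kk_add[OF insert.IH this] show ?case
      using False kl split[OF F(1)] split[OF H(1)] by (simp add: F1_def H1_def)
  qed
qed

subsection \<open>Turan representations\<close>

definition tsets :: "nat \<Rightarrow> nat \<Rightarrow> nat \<Rightarrow> nat set set" where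
  "tsets n k r = {S \<in> rainbow r {..<r} k. S \<subseteq> {..<n}}"

lemma finite_tsets: "finite (tsets n k r)"
  by (rule finite_subset[of _ "Pow {..<n}"]) (auto simp: tsets_def)

lemma turan_binom_eq_card:
  assumes "r > 0" shows "turan_binom n k r = card (tsets n k r)"
proof -
  have "cliques (turan_graph n r) k = tsets n k r"
    using assms
    by (auto simp: cliques_def turan_graph_def tsets_def rainbow_def inj_on_def)
  then show ?thesis by (simp add: turan_binom_def num_cliques_def)
qed

lemma turan_binom_eq_choose:
  assumes "n \<le> r" "r > 0" shows "turan_binom n k r = n choose k"
proof -
  have "tsets n k r = {S. S \<subseteq> {..<n} \<and> card S = k}"
  proof (intro equalityI subsetI)
    fix S assume S: "S \<in> {S. S \<subseteq> {..<n} \<and> card S = k}"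
    then have "S \<subseteq> {..<r}" using assms by auto
    then show "S \<in> tsets n k r" using rainbow_of_small[of S r k] S by (simp add: tsets_def)
  qed (auto simp: tsets_def rainbow_def)
  then show ?thesis using turan_binom_eq_card[OF assms(2)] n_subsets[of "{..<n}" k] by simp
qed

text \<open>The increasing enumeration of the numbers that are not congruent to \<open>\<alpha>\<close> modulo \<open>p + 1\<close>.\<close>

definition skip :: "nat \<Rightarrow> nat \<Rightarrow> nat \<Rightarrow> nat" where
  "skip \<alpha> p u = u + (u + p - \<alpha>) div p"

definition skip_color :: "nat \<Rightarrow> nat \<Rightarrow> nat" where
  "skip_color \<alpha> c = (if c < \<alpha> then c else Suc c)"

lemma skip_strict_mono: "u < u' \<Longrightarrow> skip \<alpha> p u < skip \<alpha> p u'"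
  unfolding skip_def by (intro add_less_le_mono div_le_mono) auto

lemma inj_skip: "inj (skip \<alpha> p)"
  by (rule injI) (metis skip_strict_mono less_irrefl linorder_neqE_nat)

text \<open>Each block of p numbers is stretched to length p + 1 with a hole at position \<alpha>;
  the quotient in \<open>skip\<close> counts the holes passed so far.\<close>

lemma skip_eq:
  assumes "\<alpha> \<le> p" "0 < p"
  shows "skip \<alpha> p u = (u div p) * Suc p + skip_color \<alpha> (u mod p)"
proof -
  have lt: "u mod p < p" using assms by simp
  have u: "u = u div p * p + u mod p" by simp
  have "u + p - \<alpha> = (u mod p + p - \<alpha>) + u div p * p" using assms u by linarith
  then have "(u + p - \<alpha>) div p = u div p + (u mod p + p - \<alpha>) div p"
    using assms by (simp only: div_mult_self1)
  moreover have "(u mod p + p - \<alpha>) div p = (if u mod p < \<alpha> then 0 else 1)"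
  proof (cases "u mod p < \<alpha>")
    case False
    then have eq: "u mod p + p - \<alpha> = (u mod p - \<alpha>) + p" by simp
    have "u mod p - \<alpha> < p" using lt by linarith
    then have "(u mod p - \<alpha> + p) div p = 1" using div_add_self2[of p "u mod p - \<alpha>"] assms(2)
      by (simp only: div_less)
    then show ?thesis using False unfolding eq by (simp only: if_False)
  qed (use lt in simp)
  ultimately have "skip \<alpha> p u = u + u div p + (if u mod p < \<alpha> then 0 else 1)" by (simp add: skip_def)
  then show ?thesis using u by (auto simp: skip_color_def)
qed

lemma skip_mod:
  assumes "\<alpha> \<le> p" "0 < p"
  shows "skip \<alpha> p u mod Suc p = skip_color \<alpha> (u mod p)"
proof -
  have "skip_color \<alpha> (u mod p) < Suc p"
    using assms mod_less_divisor[of p u] by (auto simp: skip_color_def)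
  then show ?thesis using skip_eq[OF assms, of u] by (metis mod_less mod_mult_self3)
qed

lemma skip_surj:
  assumes "\<alpha> \<le> p" "0 < p" "v mod Suc p \<noteq> \<alpha>"
  shows "\<exists>u. skip \<alpha> p u = v"
proof -
  define c where "c = (if v mod Suc p < \<alpha> then v mod Suc p else v mod Suc p - 1)"
  have vlt: "v mod Suc p < Suc p" by simp
  have c: "c < p" "skip_color \<alpha> c = v mod Suc p"
    using assms vlt by (auto simp: c_def skip_color_def simp del: mod_less_divisor)
  have "(v div Suc p * p + c) div p = v div Suc p" "(v div Suc p * p + c) mod p = c"
    using c assms by auto
  then have "skip \<alpha> p (v div Suc p * p + c) = v"
    using skip_eq[OF assms(1,2)] c by (metis div_mult_mod_eq)
  then show ?thesis by blast
qed

text \<open>Exactly \<open>b div Suc p\<close> numbers below b are congruent to b, so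
  \<open>b - b div Suc p\<close> are left with other residues. This is the origin of the gap
  condition in a Turan representation.\<close>

lemma skip_bound:
  assumes "0 < p" "u < b - b div Suc p"
  shows "skip (b mod Suc p) p u < b"
proof -
  define B \<alpha> where "B = b div Suc p" and "\<alpha> = b mod Suc p"
  have b: "b = B * Suc p + \<alpha>" unfolding B_def \<alpha>_def by (rule div_mult_mod_eq[symmetric])
  moreover have "b - b div Suc p = b - B" by (simp add: B_def)
  ultimately have "u < B * p + \<alpha>" using assms(2) by auto
  moreover have "\<alpha> \<le> p" using mod_less_divisor[of "Suc p" b] by (simp add: \<alpha>_def)
  ultimately have "u + p - \<alpha> < Suc B * p" by simp
  then have "(u + p - \<alpha>) div p < Suc B" using assms(1) less_mult_imp_div_less by blast
  then have "skip \<alpha> p u \<le> u + B" by (simp add: skip_def)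
  also have "\<dots> < b" using \<open>u < B * p + \<alpha>\<close> b by simp
  finally show ?thesis by (simp add: \<alpha>_def)
qed

lemma skip_color_inj: "skip_color \<alpha> c = skip_color \<alpha> c' \<Longrightarrow> c = c'"
  by (auto simp: skip_color_def split: if_splits)

lemma skip_rainbow_iff:
  assumes "\<alpha> \<le> p" "0 < p"
  shows "skip \<alpha> p ` S \<in> rainbow (Suc p) ({..<Suc p} - {\<alpha>}) k \<longleftrightarrow> S \<in> rainbow p {..<p} k"
proof -
  have inj: "inj_on (skip \<alpha> p) S" using inj_skip by (rule inj_on_subset) simp
  have "inj_on (\<lambda>v. v mod Suc p) (skip \<alpha> p ` S) \<longleftrightarrow> inj_on (\<lambda>v. v mod p) S"
  proof -
    have "inj_on (\<lambda>v. v mod Suc p) (skip \<alpha> p ` S) \<longleftrightarrow> inj_on ((\<lambda>v. v mod Suc p) \<circ> skip \<alpha> p) S"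
      using inj comp_inj_on_iff by blast
    also have "(\<lambda>v. v mod Suc p) \<circ> skip \<alpha> p = (\<lambda>u. skip_color \<alpha> (u mod p))"
      using skip_mod[OF assms] by (auto simp: comp_def)
    also have "inj_on (\<lambda>u. skip_color \<alpha> (u mod p)) S \<longleftrightarrow> inj_on (\<lambda>v. v mod p) S"
      by (auto simp: inj_on_def dest: skip_color_inj)
    finally show ?thesis .
  qed
  moreover have "(\<lambda>v. v mod Suc p) ` skip \<alpha> p ` S \<subseteq> {..<Suc p} - {\<alpha>}"
  proof -
    have "skip_color \<alpha> c \<noteq> \<alpha>" for c by (auto simp: skip_color_def)
    then have "skip \<alpha> p u mod Suc p \<noteq> \<alpha>" for u using skip_mod[OF assms] by simp
    moreover have "skip \<alpha> p u mod Suc p < Suc p" for u by (rule mod_less_divisor) simp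
    ultimately show ?thesis by (intro image_subsetI) (auto simp del: mod_less_divisor)
  qed
  moreover have "(\<lambda>v. v mod p) ` S \<subseteq> {..<p}" using assms by auto
  ultimately show ?thesis
    using inj by (auto simp: rainbow_def card_image finite_image_iff)
qed

lemma skip_image:
  assumes "\<alpha> \<le> p" "0 < p" "T \<in> rainbow (Suc p) ({..<Suc p} - {\<alpha>}) k"
  shows "\<exists>S \<in> rainbow p {..<p} k. T = skip \<alpha> p ` S"
proof -
  have "v \<in> range (skip \<alpha> p)" if "v \<in> T" for v
  proof -
    have "v mod Suc p \<noteq> \<alpha>" using assms(3) that by (auto simp: rainbow_def)
    then show ?thesis using skip_surj[OF assms(1,2)] by blast
  qed
  then have "T = skip \<alpha> p ` (skip \<alpha> p -` T)" by auto
  then show ?thesis using skip_rainbow_iff[OF assms(1,2), of "skip \<alpha> p -` T" k] assms(3) by metis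
qed

text \<open>The order depends only on the largest point of difference, which an increasing
  relabelling preserves.\<close>

lemma set_encode_image_less_iff:
  assumes mono: "\<And>x y. x < y \<Longrightarrow> f x < (f y :: nat)" and fin: "finite A" "finite B"
  shows "set_encode (f ` A) < set_encode (f ` B) \<longleftrightarrow> set_encode A < set_encode B"
proof -
  have inj: "f x = f y \<longleftrightarrow> x = y" for x y using mono by (metis less_irrefl linorder_neqE_nat)
  have lt: "f x < f y \<longleftrightarrow> x < y" for x y using mono by (metis less_asym linorder_neqE_nat less_irrefl)
  have imp: "set_encode (f ` A) < set_encode (f ` B)"
    if less: "set_encode A < set_encode B" and fin: "finite A" "finite B" for A B
  proof -
    obtain d where d: "d \<in> B - A" "\<forall>x>d. x \<in> A \<longleftrightarrow> x \<in> B" using less set_encode_less_iff[OF fin] by blast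
    have "f d \<in> f ` B - f ` A" using d(1) inj by auto
    moreover have "\<forall>x>f d. x \<in> f ` A \<longleftrightarrow> x \<in> f ` B"
      using d(2) lt by (auto simp: image_iff)
    ultimately show ?thesis using set_encode_less_iff[of "f ` A" "f ` B"] fin by blast
  qed
  show ?thesis
  proof
    assume less: "set_encode (f ` A) < set_encode (f ` B)"
    show "set_encode A < set_encode B"
    proof (rule ccontr)
      assume "\<not> set_encode A < set_encode B"
      then consider "set_encode A = set_encode B" | "set_encode B < set_encode A" by linarith
      then show False
        using imp[of B A] less fin set_encode_eq[OF fin] by cases auto
    qed
  qed (use imp fin in blast)
qed

text \<open>Under the gap condition this lists the rainbow sets below \<open>b k\<close> and then
  some with maximum \<open>b k\<close>. The rest of such a set avoids the colour of
  \<open>b k\<close>; \<open>skip\<close> identifies the available numbers with a universe of r - 1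
  colours, where the next term takes over.\<close>

fun turan_family :: "nat \<Rightarrow> nat \<Rightarrow> nat \<Rightarrow> (nat \<Rightarrow> nat) \<Rightarrow> nat set set" where
  "turan_family 0 k r b = tsets (b k) k r"
| "turan_family (Suc s) k r b = tsets (b k) k r \<union>
     (\<lambda>S. insert (b k) (skip (b k mod r) (r - 1) ` S)) ` turan_family s (k - 1) (r - 1) b"

declare turan_family.simps(2) [simp del]

lemma tsets_initial: "initial (rainbow r {..<r} k) (tsets n k r)"
  unfolding initial_def
proof (intro conjI ballI impI finite_tsets)
  fix S T assume S: "S \<in> tsets n k r" and T: "T \<in> rainbow r {..<r} k" "set_encode T < set_encode S"
  have "T \<subseteq> {..<n}"
  proof (rule ccontr)
    assume "\<not> T \<subseteq> {..<n}"
    then obtain x where "x \<in> T" "n \<le> x" by (meson lessThan_iff not_less subsetI)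
    then have "set_encode S < set_encode T"
      using S T(1) rainbow_finite[OF T(1)] by (intro set_encode_less_of_max[of T x]) (auto simp: tsets_def)
    then show False using T(2) by simp
  qed
  then show "T \<in> tsets n k r" using T by (simp add: tsets_def)
qed (auto simp: tsets_def)

lemma tsets_spanned:
  assumes "0 < k" "k \<le> l"
  shows "rainbow r {..<r} l \<inter> spanned k (tsets n k r) l \<subseteq> tsets n l r"
proof
  fix T assume T: "T \<in> rainbow r {..<r} l \<inter> spanned k (tsets n k r) l"
  have "x < n" if x: "x \<in> T" for x
  proof -
    have "finite T" "card T = l" using T by (auto simp: spanned_def)
    then obtain S where "{x} \<subseteq> S" "S \<subseteq> T" "card S = k"
      using exists_subset_between[of "{x}" k T] x assms by auto
    then show ?thesis using T by (auto simp: spanned_def tsets_def)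
  qed
  then show "T \<in> tsets n l r" using T by (auto simp: tsets_def)
qed

text \<open>The claims are proved together, since the vertex bound of the inner family is needed to
  place it below \<open>b k\<close>. A spanned set has no vertex beyond \<open>b k\<close>. Without
  \<open>b k\<close> it is counted by the first Turan number; otherwise, removing \<open>b k\<close>
  and undoing \<open>skip\<close> leaves a set spanned by the inner family.\<close>

lemma turan_family_initial_spanned:
  assumes "s < k" "k \<le> r" "\<And>j. j < s \<Longrightarrow> b (k - j - 1) < b (k - j) - b (k - j) div (r - j)"
  shows "initial (rainbow r {..<r} k) (turan_family s k r b) \<and>
    (\<forall>S\<in>turan_family s k r b. S \<subseteq> {..b k}) \<and>
    card (turan_family s k r b) = (\<Sum>j=0..s. turan_binom (b (k - j)) (k - j) (r - j)) \<and>
    (\<forall>l\<ge>k. card (rainbow r {..<r} l \<inter> spanned k (turan_family s k r b) l)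
        \<le> (\<Sum>j=0..s. turan_binom (b (k - j)) (l - j) (r - j)))"
  using assms
proof (induction s arbitrary: k r)
  case 0
  have "card (rainbow r {..<r} l \<inter> spanned k (tsets (b k) k r) l) \<le> card (tsets (b k) l r)" if "k \<le> l" for l
    using tsets_spanned[of k l r "b k"] that 0 by (intro card_mono finite_tsets) auto
  then show ?case
    using 0 tsets_initial by (auto simp: turan_binom_eq_card tsets_def)
next
  case (Suc s)
  define p where "p = r - 1"
  define \<alpha> where "\<alpha> = b k mod r"
  let ?C = "{..<Suc p} - {\<alpha>}"
  let ?E = "skip \<alpha> p"
  let ?Y = "turan_family s (k - 1) p b"
  let ?X = "turan_family (Suc s) k r b"
  have p: "r = Suc p" "0 < p" using Suc.prems by (auto simp: p_def)
  have \<alpha>: "\<alpha> \<le> p" using mod_less_divisor[of "Suc p" "b k"] by (simp add: \<alpha>_def p(1) less_Suc_eq_le)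
  have X: "?X = tsets (b k) k r \<union> (\<lambda>S. insert (b k) (?E ` S)) ` ?Y"
    by (simp add: turan_family.simps(2) p_def \<alpha>_def)
  have "s < k - 1" "k - 1 \<le> p" using Suc.prems p by auto
  moreover have "b (k - 1 - j - 1) < b (k - 1 - j) - b (k - 1 - j) div (p - j)" if "j < s" for j
    using Suc.prems(3)[of "Suc j"] that by (simp add: p_def)
  ultimately have Y: "initial (rainbow p {..<p} (k - 1)) ?Y" "\<And>S. S \<in> ?Y \<Longrightarrow> S \<subseteq> {..b (k - 1)}"
    "card ?Y = (\<Sum>j=0..s. turan_binom (b (k - 1 - j)) (k - 1 - j) (p - j))"
    "\<And>l. k - 1 \<le> l \<Longrightarrow> card (rainbow p {..<p} l \<inter> spanned (k - 1) ?Y l)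
        \<le> (\<Sum>j=0..s. turan_binom (b (k - 1 - j)) (l - j) (p - j))"
    using Suc.IH[of "k - 1" p] by auto
  have below: "?E ` S \<subseteq> {..<b k}" if "S \<in> ?Y" for S
  proof
    fix v assume "v \<in> ?E ` S"
    then obtain u where u: "u \<in> S" "v = ?E u" by auto
    have "u \<le> b (k - 1)" using Y(2)[OF that] u by auto
    also have "\<dots> < b k - b k div r" using Suc.prems(3)[of 0] by simp
    finally show "v \<in> {..<b k}" using skip_bound[of p u "b k"] p u by (simp add: \<alpha>_def)
  qed
  have notE: "b k \<noteq> ?E u" for u
  proof
    assume "b k = ?E u"
    then have "\<alpha> = skip_color \<alpha> (u mod p)" using skip_mod[OF \<alpha> p(2), of u] by (simp add: \<alpha>_def p(1))
    then show False by (auto simp: skip_color_def split: if_splits)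
  qed
  have insert_rainbow: "insert (b k) (?E ` S) \<in> rainbow r {..<r} (Suc n) \<longleftrightarrow> S \<in> rainbow p {..<p} n" for S n
  proof
    assume "S \<in> rainbow p {..<p} n"
    then have "?E ` S \<in> rainbow (Suc p) ?C n" using skip_rainbow_iff[OF \<alpha> p(2)] by simp
    then have "?E ` S \<in> rainbow r {..<r} n" "\<alpha> \<notin> (\<lambda>v. v mod r) ` ?E ` S"
      using p(1) by (auto simp: rainbow_def)
    then show "insert (b k) (?E ` S) \<in> rainbow r {..<r} (Suc n)"
      using p by (intro rainbow_insert) (auto simp: \<alpha>_def)
  next
    assume a: "insert (b k) (?E ` S) \<in> rainbow r {..<r} (Suc n)"
    have "?E ` S \<in> link {insert (b k) (?E ` S)} (b k)" using notE by (auto simp: link_def)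
    moreover have "link {insert (b k) (?E ` S)} (b k) \<subseteq> rainbow r ({..<r} - {\<alpha>}) n"
      by (rule link_rainbow) (use a in \<open>auto simp: \<alpha>_def\<close>)
    ultimately have "?E ` S \<in> rainbow r ({..<r} - {\<alpha>}) n" by (rule rev_subsetD)
    then show "S \<in> rainbow p {..<p} n" using skip_rainbow_iff[OF \<alpha> p(2)] p(1) by simp
  qed
  have split: "\<exists>S \<in> rainbow p {..<p} n. T = insert (b k) (?E ` S)"
    if T: "T \<in> rainbow r {..<r} (Suc n)" "b k \<in> T" for T n
  proof -
    have "T - {b k} \<in> link {T} (b k)" using T by (auto simp: link_def)
    moreover have "link {T} (b k) \<subseteq> rainbow r ({..<r} - {\<alpha>}) n"
      by (rule link_rainbow) (simp_all add: T \<alpha>_def)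
    ultimately have "T - {b k} \<in> rainbow (Suc p) ?C n" unfolding p(1) by (rule rev_subsetD)
    then obtain S where "S \<in> rainbow p {..<p} n" "T - {b k} = ?E ` S" using skip_image[OF \<alpha> p(2)] by blast
    then show ?thesis using T(2) by (metis insert_Diff)
  qed
  have Einj: "?E ` S = ?E ` S' \<longleftrightarrow> S = S'" for S S' using inj_image_eq_iff[OF inj_skip] by blast
  have ins_inj: "S = S'" if "insert (b k) (?E ` S) = insert (b k) (?E ` S')" for S S'
    using that notE Einj by (metis image_iff insert_ident)
  have Yfin: "finite ?Y" "?Y \<subseteq> rainbow p {..<p} (k - 1)" using Y(1) by (auto simp: initial_def)
  have k: "Suc (k - 1) = k" using Suc.prems by simp
  have bound: "\<forall>S\<in>?X. S \<subseteq> {..b k}"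
    unfolding X using below by (fastforce simp: tsets_def)
  have init: "initial (rainbow r {..<r} k) ?X"
    unfolding initial_def
  proof (intro conjI ballI impI)
    show "finite ?X" unfolding X using finite_tsets Yfin by auto
    show "?X \<subseteq> rainbow r {..<r} k" unfolding X using insert_rainbow[of _ "k - 1"] Yfin k by (auto simp: tsets_def)
    fix S T assume S: "S \<in> ?X" and T: "T \<in> rainbow r {..<r} k" "set_encode T < set_encode S"
    have fT: "finite T" using T rainbow_finite by blast
    have Tle: "T \<subseteq> {..b k}"
    proof (rule ccontr)
      assume "\<not> T \<subseteq> {..b k}"
      then obtain x where "x \<in> T" "b k < x" by (meson atMost_iff not_le subsetI)
      moreover have "y \<le> b k" if "y \<in> S" for y using bound S that by blast
      ultimately have "set_encode S < set_encode T"
        using fT by (intro set_encode_less_of_max[of T x]) (auto intro: le_less_trans)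
      then show False using T(2) by simp
    qed
    show "T \<in> ?X"
    proof (cases "b k \<in> T")
      case False
      then have "T \<subseteq> {..<b k}" using Tle by (force simp: le_less)
      then show ?thesis using T X by (simp add: tsets_def)
    next
      case True
      then obtain T' where T': "T' \<in> rainbow p {..<p} (k - 1)" "T = insert (b k) (?E ` T')"
        using split[of T "k - 1"] T k by auto
      have "S \<notin> tsets (b k) k r"
      proof
        assume "S \<in> tsets (b k) k r"
        then have "set_encode S < set_encode T"
          using True fT by (intro set_encode_less_of_max[of T "b k"]) (auto simp: tsets_def)
        then show False using T(2) by simp
      qed
      then obtain S' where S': "S' \<in> ?Y" "S = insert (b k) (?E ` S')" using S X by auto
      have fin: "finite T'" "finite S'" using T' S' Yfin rainbow_finite by blast+
      have "set_encode (insert (b k) (?E ` U)) = 2 ^ b k + set_encode (?E ` U)" if "finite U" for U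
        using that notE by (intro set_encode_insert) auto
      then have "set_encode (?E ` T') < set_encode (?E ` S')" using T(2) T' S' fin by simp
      then have "set_encode T' < set_encode S'"
        using set_encode_image_less_iff[of ?E T' S'] skip_strict_mono fin by blast
      then have "T' \<in> ?Y" using initialD[OF Y(1) S'(1) T'(1)] by simp
      then show ?thesis using T' X by auto
    qed
  qed
  have shift: "(\<Sum>j=0..Suc s. g j) = g 0 + (\<Sum>j=0..s. g (Suc j))" for g :: "nat \<Rightarrow> nat"
    by (simp only: sum.atLeast0_atMost_Suc_shift comp_def)
  have cardX: "card ?X = (\<Sum>j=0..Suc s. turan_binom (b (k - j)) (k - j) (r - j))"
  proof -
    have "card ?X = card (tsets (b k) k r) + card ((\<lambda>S. insert (b k) (?E ` S)) ` ?Y)"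
      unfolding X by (rule card_Un_disjoint) (use Yfin(1) finite_tsets in \<open>auto simp: tsets_def\<close>)
    also have "card ((\<lambda>S. insert (b k) (?E ` S)) ` ?Y) = card ?Y"
      by (rule card_image) (auto intro!: inj_onI dest: ins_inj)
    also have "card (tsets (b k) k r) = turan_binom (b k) k r" using turan_binom_eq_card p by simp
    finally show ?thesis using Y(3) unfolding shift by (simp add: p_def)
  qed
  have "card (rainbow r {..<r} l \<inter> spanned k ?X l) \<le> (\<Sum>j=0..Suc s. turan_binom (b (k - j)) (l - j) (r - j))"
    if l: "k \<le> l" for l
  proof -
    let ?Z = "rainbow p {..<p} (l - 1) \<inter> spanned (k - 1) ?Y (l - 1)"
    have lS: "Suc (l - 1) = l" using l k by simp
    have sub: "rainbow r {..<r} l \<inter> spanned k ?X l \<subseteq> tsets (b k) l r \<union> (\<lambda>S. insert (b k) (?E ` S)) ` ?Z"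
    proof
      fix T assume T: "T \<in> rainbow r {..<r} l \<inter> spanned k ?X l"
      have fT: "finite T" "card T = l" using T by (auto simp: spanned_def)
      have Tle: "x \<le> b k" if x: "x \<in> T" for x
      proof -
        obtain S where "{x} \<subseteq> S" "S \<subseteq> T" "card S = k"
          using exists_subset_between[of "{x}" k T] x l k fT by auto
        moreover have "S \<in> ?X" using T calculation by (auto intro: spannedD)
        ultimately show ?thesis using bound by auto
      qed
      show "T \<in> tsets (b k) l r \<union> (\<lambda>S. insert (b k) (?E ` S)) ` ?Z"
      proof (cases "b k \<in> T")
        case False
        have "x < b k" if "x \<in> T" for x using Tle[OF that] False that by (cases "x = b k") auto
        then show ?thesis using T by (auto simp: tsets_def)
      next
        case True
        then obtain T' where T': "T' \<in> rainbow p {..<p} (l - 1)" "T = insert (b k) (?E ` T')"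
          using split[of T "l - 1"] T lS by auto
        have "S \<in> ?Y" if S: "S \<subseteq> T'" "card S = k - 1" for S
        proof -
          have "S \<in> rainbow p {..<p} (k - 1)" using rainbow_subset[OF T'(1) S(1)] S(2) by simp
          then have "insert (b k) (?E ` S) \<in> rainbow r {..<r} k" using insert_rainbow[of S "k - 1"] k by simp
          then have "card (insert (b k) (?E ` S)) = k" by (simp add: rainbow_def)
          moreover have "insert (b k) (?E ` S) \<subseteq> T" using T' S by auto
          ultimately have "insert (b k) (?E ` S) \<in> ?X" using T by (auto intro: spannedD)
          then obtain S' where "S' \<in> ?Y" "insert (b k) (?E ` S) = insert (b k) (?E ` S')"
            unfolding X by (auto simp: tsets_def)
          then show ?thesis using ins_inj by metis
        qed
        then have "T' \<in> ?Z" using T' by (auto simp: spanned_def rainbow_def)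
        then show ?thesis using T' by blast
      qed
    qed
    \<comment> \<open>\<open>spanned\<close> does not by itself confine the vertices. Here k - 1 is
      positive, so every vertex lies in a (k-1)-subset and thus in a member of the inner
      family.\<close>
    have Zfin: "finite ?Z"
    proof (rule finite_subset)
      show "finite (Pow {..b (k - 1)})" by simp
      show "?Z \<subseteq> Pow {..b (k - 1)}"
      proof
        fix T assume T: "T \<in> ?Z"
        have fT: "finite T" "card T = l - 1" using T by (auto simp: spanned_def)
        have "x \<le> b (k - 1)" if x: "x \<in> T" for x
        proof -
          have "1 \<le> k - 1" "k - 1 \<le> l - 1" using l Suc.prems(1) by linarith+
          then obtain S where "{x} \<subseteq> S" "S \<subseteq> T" "card S = k - 1"
            using exists_subset_between[of "{x}" "k - 1" T] x fT by auto
          moreover have "S \<in> ?Y" using T calculation by (auto intro: spannedD)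
          ultimately show ?thesis using Y(2) by blast
        qed
        then show "T \<in> Pow {..b (k - 1)}" by auto
      qed
    qed
    have "card (rainbow r {..<r} l \<inter> spanned k ?X l) \<le> card (tsets (b k) l r \<union> (\<lambda>S. insert (b k) (?E ` S)) ` ?Z)"
      by (rule card_mono[OF _ sub]) (use finite_tsets Zfin in blast)
    also have "\<dots> \<le> card (tsets (b k) l r) + card ((\<lambda>S. insert (b k) (?E ` S)) ` ?Z)" by (rule card_Un_le)
    also have "\<dots> \<le> turan_binom (b k) l r + card ?Z"
      using card_image_le[OF Zfin] turan_binom_eq_card p by simp
    also have "\<dots> \<le> turan_binom (b k) l r + (\<Sum>j=0..s. turan_binom (b (k - 1 - j)) (l - 1 - j) (p - j))"
      using Y(4)[of "l - 1"] l by simp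
    also have "\<dots> = (\<Sum>j=0..Suc s. turan_binom (b (k - j)) (l - j) (r - j))"
      unfolding shift by (simp add: p_def)
    finally show ?thesis .
  qed
  then show ?case using init bound cardX by blast
qed

theorem turan_representation_bound:
  assumes s: "s < k" "k \<le> r" "\<And>j. j < s \<Longrightarrow> b (k - j - 1) < b (k - j) - b (k - j) div (r - j)"
    and F: "finite F" "F \<subseteq> rainbow r {..<r} k" "card F \<le> (\<Sum>j=0..s. turan_binom (b (k - j)) (k - j) (r - j))"
    and H: "finite H" "H \<subseteq> rainbow r {..<r} l \<inter> spanned k F l" and kl: "k \<le> l"
  shows "card H \<le> (\<Sum>j=0..s. turan_binom (b (k - j)) (l - j) (r - j))"
proof -
  let ?X = "turan_family s k r b"
  have X: "initial (rainbow r {..<r} k) ?X" "\<And>S. S \<in> ?X \<Longrightarrow> S \<subseteq> {..b k}"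
    "card ?X = (\<Sum>j=0..s. turan_binom (b (k - j)) (k - j) (r - j))"
    "card (rainbow r {..<r} l \<inter> spanned k ?X l) \<le> (\<Sum>j=0..s. turan_binom (b (k - j)) (l - j) (r - j))"
    using turan_family_initial_spanned[OF s] kl by auto
  have HR: "H \<subseteq> rainbow r {..<r} l" using H by blast
  obtain I where I: "initial (rainbow r {..<r} k) I" "card I = card F"
    using initial_exists[OF _ F(2,1)] rainbow_finite by blast
  obtain J where J: "initial (rainbow r {..<r} l) J" "card J = card H"
    using initial_exists[OF _ HR H(1)] rainbow_finite by blast
  have "J \<subseteq> spanned k I l"
    using colored_kruskal_katona[OF _ _ kl F(1,2) H I J(1)] J(2) s by simp
  moreover have "I \<subseteq> ?X"
    by (rule initial_mono[OF I(1) X(1)]) (use I(2) F(3) X(3) rainbow_finite in auto)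
  ultimately have "J \<subseteq> spanned k ?X l" using spanned_mono[of I ?X k l] by blast
  then have sub: "J \<subseteq> rainbow r {..<r} l \<inter> spanned k ?X l" using J by (auto simp: initial_def)
  have "rainbow r {..<r} l \<inter> spanned k ?X l \<subseteq> Pow {..b k}"
  proof
    fix T assume T: "T \<in> rainbow r {..<r} l \<inter> spanned k ?X l"
    have fT: "finite T" "card T = l" using T by (auto simp: spanned_def)
    have "x \<le> b k" if x: "x \<in> T" for x
    proof -
      obtain S where "{x} \<subseteq> S" "S \<subseteq> T" "card S = k"
        using exists_subset_between[of "{x}" k T] x kl s fT by auto
      moreover have "S \<in> ?X" using T calculation by (auto intro: spannedD)
      ultimately show ?thesis using X(2) by blast
    qed
    then show "T \<in> Pow {..b k}" by auto
  qed
  then have "finite (rainbow r {..<r} l \<inter> spanned k ?X l)" by (rule finite_subset) simp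
  from card_mono[OF this sub] show ?thesis using J X(4) by simp
qed

text \<open>A Turan representation with very many parts: the quotients in the gap condition vanish,
  and Turan numbers become binomials.\<close>

theorem kk_bound:
  assumes kk_feasible: "kk_feasible k l (\<Sum>j=0..s. a (k - j) choose (k - j)) h" and kl: "k \<le> l" and s: "s < k"
    and dec: "\<And>j. j < s \<Longrightarrow> a (k - j - 1) < a (k - j)"
  shows "h \<le> (\<Sum>j=0..s. a (k - j) choose (l - j))"
proof -
  obtain F H :: "nat set set" where F: "finite F" "F \<subseteq> ksets k" and H: "finite H" "H \<subseteq> spanned k F l"
    and c: "card F \<le> (\<Sum>j=0..s. a (k - j) choose (k - j))" "h \<le> card H" using kk_feasible by (auto simp: kk_feasible_def)
  have HK: "H \<subseteq> ksets l" using H spanned_subset_ksets by blast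
  have "finite (F \<union> H)" "\<And>S. S \<in> F \<union> H \<Longrightarrow> finite S" using F H HK by (auto simp: ksets_def)
  then obtain N where N: "\<And>S. S \<in> F \<union> H \<Longrightarrow> S \<subseteq> {..<N}"
    using bounded_families[of "F \<union> H"] by blast
  \<comment> \<open>\<open>N\<close> gives all vertices distinct colours, the sum exceeds each term,
    and k absorbs the later subtraction of j.\<close>
  define r where "r = N + k + (\<Sum>j=0..s. a (k - j))"
  have ar: "a (k - j) < r - j" if "j \<le> s" for j
  proof -
    have "a (k - j) \<le> (\<Sum>j=0..s. a (k - j))" using that by (intro member_le_sum) auto
    then show ?thesis using that s by (simp add: r_def)
  qed
  have tb: "turan_binom (a (k - j)) n (r - j) = a (k - j) choose n" if "j \<le> s" for j n
    using turan_binom_eq_choose[of "a (k - j)" "r - j" n] ar[OF that] by simp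
  have small: "S \<in> rainbow r {..<r} n" if "S \<in> F \<union> H" "S \<in> ksets n" for S n
    using N[OF that(1)] that(2) by (intro rainbow_of_small) (auto simp: r_def ksets_def)
  have "card H \<le> (\<Sum>j=0..s. turan_binom (a (k - j)) (l - j) (r - j))"
  proof (rule turan_representation_bound[OF s])
    show "a (k - j - 1) < a (k - j) - a (k - j) div (r - j)" if "j < s" for j
      using dec[OF that] ar[of j] that by simp
    show "F \<subseteq> rainbow r {..<r} k" using small F by blast
    show "H \<subseteq> rainbow r {..<r} l \<inter> spanned k F l" using small H HK by blast
    show "card F \<le> (\<Sum>j=0..s. turan_binom (a (k - j)) (k - j) (r - j))" using c tb by simp
  qed (use F H kl in \<open>auto simp: r_def\<close>)
  then show ?thesis using c tb by simp
qed

subsection \<open>Clique counts and coloured families\<close>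

definition clique_sets :: "('a \<Rightarrow> 'a \<Rightarrow> bool) \<Rightarrow> 'a set \<Rightarrow> nat \<Rightarrow> 'a set set" where
  "clique_sets E V k = {S. S \<subseteq> V \<and> finite S \<and> card S = k \<and> (\<forall>u\<in>S. \<forall>v\<in>S. u \<noteq> v \<longrightarrow> E u v)}"

definition nbrs :: "('a \<Rightarrow> 'a \<Rightarrow> bool) \<Rightarrow> 'a \<Rightarrow> 'a set" where
  "nbrs E v = {u. E v u \<and> u \<noteq> v}"

lemma cl_finite: "finite V \<Longrightarrow> finite (clique_sets E V k)"
  by (rule finite_subset[of _ "Pow V"]) (auto simp: clique_sets_def)

lemma cl_mono: "V \<subseteq> V' \<Longrightarrow> clique_sets E V k \<subseteq> clique_sets E V' k"
  by (auto simp: clique_sets_def)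

lemma cl_subset_ksets: "clique_sets E V k \<subseteq> ksets k"
  by (auto simp: clique_sets_def ksets_def)

lemma cl_subset: "S \<in> clique_sets E V k \<Longrightarrow> T \<subseteq> S \<Longrightarrow> T \<in> clique_sets E V (card T)"
  by (auto simp: clique_sets_def intro: finite_subset)

lemma cl_spanned: "clique_sets E V l \<subseteq> spanned k (clique_sets E V k) l"
  by (auto simp: clique_sets_def spanned_def intro: finite_subset)

lemma insert_mem_cl_iff:
  assumes "symp E" "v \<notin> S"
  shows "insert v S \<in> clique_sets E V (Suc k) \<longleftrightarrow> v \<in> V \<and> S \<in> clique_sets E (V \<inter> nbrs E v) k"
proof
  assume a: "insert v S \<in> clique_sets E V (Suc k)"
  then have "finite S" "card S = k" using assms(2) by (auto simp: clique_sets_def)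
  moreover have "E v u" if "u \<in> S" for u using a that assms(2) by (auto simp: clique_sets_def)
  ultimately show "v \<in> V \<and> S \<in> clique_sets E (V \<inter> nbrs E v) k"
    using a assms(2) by (auto simp: clique_sets_def nbrs_def)
next
  assume a: "v \<in> V \<and> S \<in> clique_sets E (V \<inter> nbrs E v) k"
  have "E v u" "E u v" if "u \<in> S" for u
  proof -
    show "E v u" using a that by (auto simp: clique_sets_def nbrs_def)
    then show "E u v" by (rule sympD[OF assms(1)])
  qed
  then show "insert v S \<in> clique_sets E V (Suc k)" using a assms(2) by (auto simp: clique_sets_def)
qed

lemma cl_insert:
  assumes "symp E" "v \<notin> V"
  shows "clique_sets E (insert v V) (Suc k) = join (clique_sets E V (Suc k)) (\<lambda>_. clique_sets E (V \<inter> nbrs E v) k) {v}"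
proof -
  have "clique_sets E (insert v V \<inter> nbrs E v) k = clique_sets E (V \<inter> nbrs E v) k"
    by (rule arg_cong[of _ _ "\<lambda>V. clique_sets E V k"]) (auto simp: nbrs_def)
  then have iff: "insert v S \<in> clique_sets E (insert v V) (Suc k) \<longleftrightarrow> S \<in> clique_sets E (V \<inter> nbrs E v) k" if "v \<notin> S" for S
    using insert_mem_cl_iff[OF assms(1) that, of "insert v V" k] by simp
  show ?thesis
  proof (intro equalityI subsetI)
    fix S assume S: "S \<in> clique_sets E (insert v V) (Suc k)"
    show "S \<in> join (clique_sets E V (Suc k)) (\<lambda>_. clique_sets E (V \<inter> nbrs E v) k) {v}"
    proof (cases "v \<in> S")
      case True
      then have "S = insert v (S - {v})" by auto
      moreover have "S - {v} \<in> clique_sets E (V \<inter> nbrs E v) k" using iff[of "S - {v}"] S True by (simp add: insert_absorb)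
      ultimately show ?thesis unfolding join_def by blast
    next
      case False
      then show ?thesis using S by (auto simp: join_def clique_sets_def)
    qed
  next
    fix S assume "S \<in> join (clique_sets E V (Suc k)) (\<lambda>_. clique_sets E (V \<inter> nbrs E v) k) {v}"
    then consider "S \<in> clique_sets E V (Suc k)" | T where "T \<in> clique_sets E (V \<inter> nbrs E v) k" "S = insert v T"
      by (auto simp: join_def)
    then show "S \<in> clique_sets E (insert v V) (Suc k)"
    proof cases
      case 1
      then show ?thesis using cl_mono[of V "insert v V"] by blast
    next
      case 2
      then have "v \<notin> T" by (auto simp: clique_sets_def nbrs_def)
      then show ?thesis using iff[of T] 2 by simp
    qed
  qed
qed

lemma card_cl_insert:
  assumes "symp E" "v \<notin> V" "finite V"
  shows "card (clique_sets E (insert v V) (Suc k)) = card (clique_sets E V (Suc k)) + card (clique_sets E (V \<inter> nbrs E v) k)"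
  unfolding cl_insert[OF assms(1,2)] using assms
  by (intro card_cone) (auto simp: cl_finite clique_sets_def)

section \<open>Realising clique counts by coloured families\<close>

lemma rainbow_extend:
  assumes r: "r > 0" and \<alpha>: "\<alpha> \<in> C" "\<alpha> < r"
    and F: "finite F" "F \<subseteq> rainbow r C (Suc k)" and H: "finite H" "H \<subseteq> rainbow r C (Suc l) \<inter> spanned (Suc k) F (Suc l)"
    and X: "finite X" "X \<subseteq> rainbow r (C - {\<alpha>}) k"
    and Y: "finite Y" "Y \<subseteq> rainbow r (C - {\<alpha>}) l" "Y \<subseteq> spanned k X l" "Y \<subseteq> spanned (Suc k) F l"
  shows "\<exists>F' H'. finite F' \<and> F' \<subseteq> rainbow r C (Suc k) \<and> F \<subseteq> F' \<and>
    finite H' \<and> H' \<subseteq> rainbow r C (Suc l) \<inter> spanned (Suc k) F' (Suc l) \<and>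
    card F' = card F + card X \<and> card H' = card H + card Y"
proof -
  have fin: "finite S" if "S \<in> F \<union> H \<union> X \<union> Y" for S
    using that F H X Y rainbow_finite by blast
  then obtain N where N: "\<And>S. S \<in> F \<union> H \<union> X \<union> Y \<Longrightarrow> S \<subseteq> {..<N}"
    using bounded_families[of "F \<union> H \<union> X \<union> Y"] F(1) H(1) X(1) Y(1) by (metis finite_Un)
  \<comment> \<open>A vertex of the prescribed colour \<alpha> that lies beyond all vertices used so
    far.\<close>
  define w where "w = \<alpha> + N * r"
  have w: "w mod r = \<alpha>" "N \<le> w" using \<alpha> r by (auto simp: w_def trans_le_add2)
  have nw: "w \<notin> S" if "S \<in> F \<union> H \<union> X \<union> Y" for S using N[OF that] w(2) by auto
  have ins: "insert w S \<in> rainbow r C (Suc m)" if "S \<in> rainbow r (C - {\<alpha>}) m" for S m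
    using that w \<alpha> by (intro rainbow_insert) (auto simp: rainbow_def)
  have "join F (\<lambda>_. X) {w} \<subseteq> rainbow r C (Suc k)" using F X ins by (auto simp: join_def)
  moreover have "join H (\<lambda>_. Y) {w} \<subseteq> rainbow r C (Suc l)" using H Y ins by (auto simp: join_def)
  moreover have "join H (\<lambda>_. Y) {w} \<subseteq> spanned (Suc k) (join F (\<lambda>_. X) {w}) (Suc l)"
    using H Y nw by (intro join_spanned) auto
  moreover have "card (join F (\<lambda>_. X) {w}) = card F + card X" "card (join H (\<lambda>_. Y) {w}) = card H + card Y"
    using F H X Y nw by (auto intro!: card_cone)
  moreover have "finite (join F (\<lambda>_. X) {w})" "finite (join H (\<lambda>_. Y) {w})" "F \<subseteq> join F (\<lambda>_. X) {w}"
    using F H X Y by (auto simp: join_def)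
  ultimately show ?thesis by (intro exI[of _ "join F (\<lambda>_. X) {w}"] exI[of _ "join H (\<lambda>_. Y) {w}"]) simp
qed

text \<open>The sizes are exact, so realisations of the same m for different l can be based on one
  and the same initial segment.\<close>

definition realizable :: "nat \<Rightarrow> nat set \<Rightarrow> nat \<Rightarrow> nat \<Rightarrow> nat \<Rightarrow> nat \<Rightarrow> bool" where
  "realizable r C k l m h \<longleftrightarrow> (\<exists>F H. finite F \<and> F \<subseteq> rainbow r C k \<and> finite H \<and>
     H \<subseteq> rainbow r C l \<inter> spanned k F l \<and> card F = m \<and> card H = h)"

lemma realizable_initial:
  assumes "realizable r C k l m h" "r > 0" "finite C" "k \<le> l"
  shows "\<exists>I J. initial (rainbow r C k) I \<and> card I = m \<and> initial (rainbow r C l) J \<and> card J = h \<and>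
    J \<subseteq> spanned k I l"
proof -
  obtain F H where F: "finite F" "F \<subseteq> rainbow r C k" and H: "finite H" "H \<subseteq> rainbow r C l \<inter> spanned k F l"
    and c: "card F = m" "card H = h" using assms(1) by (auto simp: realizable_def)
  have HR: "H \<subseteq> rainbow r C l" using H by blast
  obtain I where I: "initial (rainbow r C k) I" "card I = card F"
    using initial_exists[OF _ F(2,1)] rainbow_finite by blast
  obtain J where J: "initial (rainbow r C l) J" "card J = card H"
    using initial_exists[OF _ HR H(1)] rainbow_finite by blast
  have "J \<subseteq> spanned k I l"
    using colored_kruskal_katona[OF assms(2-4) F H I J(1)] J(2) by simp
  then show ?thesis using I J c by blast
qed

lemma initial_rainbow_unique:
  assumes "initial (rainbow r C k) I" "initial (rainbow r C k) J" "card I = card J"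
  shows "I = J"
  using initial_mono[OF assms(1,2)] initial_mono[OF assms(2,1)] assms(3) rainbow_finite by (simp add: subset_antisym)

text \<open>Zykov-type step: the vertices outside the neighbourhood of \<open>v0\<close> all receive one colour, and
  \<open>v0\<close> is chosen so that the link of every other vertex has at most as many \<open>(l - 1)\<close>-cliques as
  the link of \<open>v0\<close>; after compression the links are then nested.\<close>

lemma cliques_realizable_step:
  assumes r: "r > 0" and C: "finite C" "C \<subseteq> {..<r}" and V: "finite V" and E: "symp E"
    and \<omega>: "clique_sets E V (Suc (card C)) = {}" and kl: "k < l"
    and IH: "\<And>\<alpha> U k' l'. \<alpha> \<in> C \<Longrightarrow> finite U \<Longrightarrow> clique_sets E U (card C) = {} \<Longrightarrow> k' \<le> l' \<Longrightarrow>
      realizable r (C - {\<alpha>}) k' l' (card (clique_sets E U k')) (card (clique_sets E U l'))"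
  shows "realizable r C (Suc k) (Suc l) (card (clique_sets E V (Suc k))) (card (clique_sets E V (Suc l)))"
proof (cases "V = {}")
  case True
  then have "clique_sets E V (Suc n) = {}" for n by (auto simp: clique_sets_def)
  then show ?thesis unfolding realizable_def by (intro exI[of _ "{}"]) auto
next
  case False
  have "C \<noteq> {}"
  proof
    assume "C = {}"
    moreover obtain v where "v \<in> V" using False by auto
    ultimately have "{v} \<in> clique_sets E V (Suc (card C))" by (auto simp: clique_sets_def)
    then show False using \<omega> by simp
  qed
  then obtain \<alpha> where \<alpha>: "\<alpha> \<in> C" "\<alpha> < r" using C by auto
  have fC: "finite (C - {\<alpha>})" using C by simp
  define f where "f v = card (clique_sets E (V \<inter> nbrs E v) l)" for v
  obtain v0 where v0: "v0 \<in> V" "\<And>v. v \<in> V \<Longrightarrow> f v \<le> f v0"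
  proof -
    have "Max (f ` V) \<in> f ` V" using V False by (intro Max_in) auto
    then obtain v0 where "v0 \<in> V" "f v0 = Max (f ` V)" by auto
    then show ?thesis using that[of v0] V by simp
  qed
  have small: "clique_sets E (U \<inter> nbrs E v) (card C) = {}" if "v \<in> V" "U \<subseteq> V" for U v
  proof -
    have "insert v S \<in> clique_sets E V (Suc (card C))" if S: "S \<in> clique_sets E (U \<inter> nbrs E v) (card C)" for S
    proof -
      have "v \<notin> S" using S by (auto simp: clique_sets_def nbrs_def)
      moreover have "S \<in> clique_sets E (V \<inter> nbrs E v) (card C)" using S \<open>U \<subseteq> V\<close> by (auto simp: clique_sets_def)
      ultimately show ?thesis using insert_mem_cl_iff[OF E] \<open>v \<in> V\<close> by metis
    qed
    then show ?thesis using \<omega> by auto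
  qed
  define U where "U = V \<inter> nbrs E v0"
  have U: "finite U" "clique_sets E U (card C) = {}" using V small[OF v0(1), of V] by (auto simp: U_def)
  obtain I0 J0 where I0: "initial (rainbow r (C - {\<alpha>}) (Suc k)) I0" "card I0 = card (clique_sets E U (Suc k))"
    and J0: "initial (rainbow r (C - {\<alpha>}) (Suc l)) J0" "card J0 = card (clique_sets E U (Suc l))"
    and IJ0: "J0 \<subseteq> spanned (Suc k) I0 (Suc l)"
    using realizable_initial[OF IH[OF \<alpha>(1) U, of "Suc k" "Suc l"] r fC] kl by auto
  \<comment> \<open>A second realisation of the cliques of U, now with target level l:
    \<open>J1\<close> will contain the links of all vertices added later. Its base has the size of
    \<open>I0\<close> and hence coincides with it.\<close>
  obtain I1 J1 where I1: "initial (rainbow r (C - {\<alpha>}) (Suc k)) I1" "card I1 = card (clique_sets E U (Suc k))"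
    and J1: "initial (rainbow r (C - {\<alpha>}) l) J1" "card J1 = card (clique_sets E U l)"
    and IJ1: "J1 \<subseteq> spanned (Suc k) I1 l"
    using realizable_initial[OF IH[OF \<alpha>(1) U, of "Suc k" l] r fC] kl by auto
  have "I1 = I0" using initial_rainbow_unique[OF I1(1) I0(1)] I1 I0 by simp
  then have IJ1': "J1 \<subseteq> spanned (Suc k) I0 l" using IJ1 by simp
  have "\<exists>F H. finite F \<and> F \<subseteq> rainbow r C (Suc k) \<and> I0 \<subseteq> F \<and> finite H \<and>
    H \<subseteq> rainbow r C (Suc l) \<inter> spanned (Suc k) F (Suc l) \<and>
    card F = card (clique_sets E (U \<union> X) (Suc k)) \<and> card H = card (clique_sets E (U \<union> X) (Suc l))"
    if "finite X" "X \<subseteq> V - U" for X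
    using that
  proof (induction X rule: finite_induct)
    case empty
    have "finite I0" "I0 \<subseteq> rainbow r C (Suc k)" "finite J0" "J0 \<subseteq> rainbow r C (Suc l)"
      using I0 J0 rainbow_mono[of "C - {\<alpha>}" C r "Suc k"] rainbow_mono[of "C - {\<alpha>}" C r "Suc l"]
      by (auto simp: initial_def)
    then show ?case using I0 J0 IJ0 by (intro exI[of _ I0] exI[of _ J0]) auto
  next
    case (insert v X)
    then obtain F H where F: "finite F" "F \<subseteq> rainbow r C (Suc k)" "I0 \<subseteq> F"
      and H: "finite H" "H \<subseteq> rainbow r C (Suc l) \<inter> spanned (Suc k) F (Suc l)"
      and c: "card F = card (clique_sets E (U \<union> X) (Suc k))" "card H = card (clique_sets E (U \<union> X) (Suc l))"
      by auto
    have v: "v \<in> V" "v \<notin> U \<union> X" using insert by auto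
    have sub: "U \<union> X \<subseteq> V" using insert by (auto simp: U_def)
    have fin: "finite (U \<union> X)" using sub V finite_subset by blast
    let ?L = "(U \<union> X) \<inter> nbrs E v"
    obtain I J where I: "initial (rainbow r (C - {\<alpha>}) k) I" "card I = card (clique_sets E ?L k)"
      and J: "initial (rainbow r (C - {\<alpha>}) l) J" "card J = card (clique_sets E ?L l)"
      and IJ: "J \<subseteq> spanned k I l"
      using realizable_initial[OF IH[OF \<alpha>(1) _ small[OF v(1) sub], of k l] r fC] kl fin by auto
    \<comment> \<open>The link counted at the time of insertion is only part of the full link, which
      the choice of \<open>v0\<close> bounds by the size of \<open>J1\<close>.\<close>
    have "card (clique_sets E ?L l) \<le> f v"
      unfolding f_def using sub V by (intro card_mono cl_finite cl_mono) auto
    also have "\<dots> \<le> card J1" using v0(2)[OF v(1)] J1(2) by (simp add: f_def U_def)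
    finally have "J \<subseteq> J1"
      using initial_mono[OF J(1) J1(1)] J(2) rainbow_finite by simp
    then have JF: "J \<subseteq> spanned (Suc k) F l" using IJ1' spanned_mono[OF F(3), of "Suc k" l] by blast
    have fs: "finite I" "I \<subseteq> rainbow r (C - {\<alpha>}) k" "finite J" "J \<subseteq> rainbow r (C - {\<alpha>}) l"
      using I J by (auto simp: initial_def)
    obtain F' H' where F': "finite F'" "F' \<subseteq> rainbow r C (Suc k)" "F \<subseteq> F'"
      "finite H'" "H' \<subseteq> rainbow r C (Suc l) \<inter> spanned (Suc k) F' (Suc l)"
      "card F' = card F + card I" "card H' = card H + card J"
      using rainbow_extend[OF r \<alpha> F(1,2) H fs(1,2,3,4) IJ JF] by blast
    moreover have "card (clique_sets E (U \<union> insert v X) (Suc n)) = card (clique_sets E (U \<union> X) (Suc n)) + card (clique_sets E ?L n)" for n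
      using card_cl_insert[OF E v(2) fin] by simp
    ultimately show ?case using c I J F(3) by (intro exI[of _ F'] exI[of _ H']) auto
  qed
  from this[of "V - U"] obtain F H where "finite F" "F \<subseteq> rainbow r C (Suc k)" "finite H"
    "H \<subseteq> rainbow r C (Suc l) \<inter> spanned (Suc k) F (Suc l)"
    "card F = card (clique_sets E (U \<union> (V - U)) (Suc k))" "card H = card (clique_sets E (U \<union> (V - U)) (Suc l))"
    using V by auto
  moreover have "U \<union> (V - U) = V" by (auto simp: U_def)
  ultimately show ?thesis unfolding realizable_def by auto
qed

theorem cliques_realizable:
  assumes r: "r > 0" and C: "finite C" "C \<subseteq> {..<r}" and V: "finite V" and E: "symp E"
    and \<omega>: "clique_sets E V (Suc (card C)) = {}" and kl: "k \<le> l"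
  shows "realizable r C k l (card (clique_sets E V k)) (card (clique_sets E V l))"
  using C V \<omega> kl
proof (induction "card C" arbitrary: C V k l rule: less_induct)
  case (less C V k l)
  have step: "realizable r C (Suc k') (Suc l') (card (clique_sets E V (Suc k'))) (card (clique_sets E V (Suc l')))" if "k' < l'" for k' l'
  proof (rule cliques_realizable_step[OF r less.prems(1-3) E less.prems(4) that])
    fix \<alpha> U k'' l'' assume a: "\<alpha> \<in> C" "finite U" "clique_sets E U (card C) = {}" "(k''::nat) \<le> l''"
    have "card (C - {\<alpha>}) < card C" using a less.prems by (meson card_Diff1_less)
    moreover have "Suc (card (C - {\<alpha>})) = card C" using a less.prems card_Suc_Diff1[of C \<alpha>] by simp
    ultimately show "realizable r (C - {\<alpha>}) k'' l'' (card (clique_sets E U k'')) (card (clique_sets E U l''))"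
      using less.hyps[of "C - {\<alpha>}" U k'' l''] a less.prems by auto
  qed
  \<comment> \<open>The step needs distinct levels; for equal ones its \<open>F\<close> also serves
    as \<open>H\<close>.\<close>
  have diag: "realizable r C (Suc k') (Suc k') (card (clique_sets E V (Suc k'))) (card (clique_sets E V (Suc k')))" for k'
  proof -
    obtain F where "finite F" "F \<subseteq> rainbow r C (Suc k')" "card F = card (clique_sets E V (Suc k'))"
      using step[of k' "Suc k'"] by (auto simp: realizable_def)
    then show ?thesis unfolding realizable_def
      by (intro exI[of _ F]) (auto simp: spanned_same rainbow_def)
  qed
  have cl0: "clique_sets E V 0 = {{}}" by (auto simp: clique_sets_def)
  show ?case
  proof (cases k)
    case (Suc k')
    then obtain l' where "l = Suc l'" "k' \<le> l'" using less.prems(5) by (cases l) auto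
    then show ?thesis using Suc step[of k' l'] diag[of k'] by (cases "k' = l'") auto
  next
    case 0
    show ?thesis
    proof (cases l)
      case l: 0
      then show ?thesis unfolding 0 l realizable_def cl0
        by (intro exI[of _ "{{}}"]) (auto simp: rainbow_zero spanned_def)
    next
      case (Suc l')
      obtain H where H: "finite H" "H \<subseteq> rainbow r C (Suc l')" "card H = card (clique_sets E V (Suc l'))"
        using diag[of l'] by (auto simp: realizable_def)
      moreover have "H \<subseteq> spanned 0 {{}} (Suc l')"
        using H(2) by (auto simp: spanned_def rainbow_def dest: finite_subset)
      ultimately show ?thesis unfolding 0 Suc realizable_def cl0
        by (intro exI[of _ "{{}}"] exI[of _ H]) (auto simp: rainbow_zero)
    qed
  qed
qed

text \<open>Among the first r + 1 vertices only 0 and r share a colour: a clique on r vertices and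
  one more vertex joined to all but one of them.\<close>

lemma card_tsets_Suc:
  assumes "r > 0"
  shows "card (tsets (Suc r) (Suc m) r) = (r choose Suc m) + (r - 1 choose m)"
proof -
  have "tsets (Suc r) (Suc m) r = join {S. S \<subseteq> {..<r} \<and> card S = Suc m} (\<lambda>_. {S. S \<subseteq> {1..<r} \<and> card S = m}) {r}"
    (is "_ = join ?A (\<lambda>_. ?B) {r}")
  proof (intro equalityI subsetI)
    fix S assume S: "S \<in> tsets (Suc r) (Suc m) r"
    then have S': "finite S" "card S = Suc m" "inj_on (\<lambda>v. v mod r) S" "S \<subseteq> {..<Suc r}"
      by (auto simp: tsets_def rainbow_def)
    show "S \<in> join ?A (\<lambda>_. ?B) {r}"
    proof (cases "r \<in> S")
      case True
      have "0 \<notin> S" using inj_onD[OF S'(3), of 0 r] True assms by auto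
      have "S - {r} \<subseteq> {1..<r}"
      proof
        fix x assume x: "x \<in> S - {r}"
        then have "x < Suc r" "x \<noteq> r" "x \<noteq> 0" using S'(4) \<open>0 \<notin> S\<close> by (auto intro: ccontr)
        then show "x \<in> {1..<r}" by auto
      qed
      then have "S - {r} \<in> ?B" using S' True by simp
      moreover have "S = insert r (S - {r})" using True by auto
      ultimately show ?thesis unfolding join_def by blast
    next
      case False
      have "x < r" if "x \<in> S" for x
      proof -
        have "x < Suc r" "x \<noteq> r" using S'(4) False that by auto
        then show ?thesis by simp
      qed
      then show ?thesis using S' by (auto simp: join_def)
    qed
  next
    fix S assume "S \<in> join ?A (\<lambda>_. ?B) {r}"
    then consider "S \<in> ?A" | T where "T \<in> ?B" "S = insert r T" by (auto simp: join_def)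
    then show "S \<in> tsets (Suc r) (Suc m) r"
    proof cases
      case 1
      then show ?thesis using rainbow_of_small[of S r "Suc m"] by (auto simp: tsets_def)
    next
      case 2
      then have T: "T \<subseteq> {..<r}" "card T = m" by auto
      have "0 \<notin> (\<lambda>v. v mod r) ` T" using 2 by (auto simp: image_iff)
      then have "S \<in> rainbow r {..<r} (Suc m)"
        using rainbow_insert[OF rainbow_of_small[OF T], of r] assms 2 by simp
      then show ?thesis using 2 by (auto simp: tsets_def)
    qed
  qed
  moreover have "card (join ?A (\<lambda>_. ?B) {r}) = card ?A + card ?B"
    by (rule card_cone) auto
  ultimately show ?thesis using n_subsets[of "{..<r}" "Suc m"] n_subsets[of "{1..<r}" m] by simp
qed

text \<open>The two leading binomials count the rainbow sets on the first n + 2 vertices, so the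
  initial segment contains all of these. Each of the other y sets meets the set \<open>W\<close> of
  later vertices, and \<open>kk_meeting\<close> bounds what they span one level lower.\<close>

lemma near_clique_bound:
  assumes R: "realizable (Suc n) {..<Suc n} (Suc k) (Suc l)
      ((Suc n choose Suc k) + (n choose k) + y) ((Suc n choose Suc l) + p')" and kl: "k < l"
  shows "\<exists>h. p' \<le> (n choose l) + h \<and> kk_feasible k l y h"
proof -
  let ?r = "Suc n" and ?R = "rainbow (Suc n) {..<Suc n}"
  obtain I J where I: "initial (?R (Suc k)) I" "card I = (Suc n choose Suc k) + (n choose k) + y"
    and J: "initial (?R (Suc l)) J" "card J = (Suc n choose Suc l) + p'" and IJ: "J \<subseteq> spanned (Suc k) I (Suc l)"
    using realizable_initial[OF R] kl by auto
  have tc: "card (tsets (Suc ?r) (Suc m) ?r) = (Suc n choose Suc m) + (n choose m)" for m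
    using card_tsets_Suc[of ?r m] by simp
  have fin: "finite I" "finite J" "I \<subseteq> ?R (Suc k)" "J \<subseteq> ?R (Suc l)" using I J by (auto simp: initial_def)
  have tI: "tsets (Suc ?r) (Suc k) ?r \<subseteq> I"
    by (rule initial_mono[OF tsets_initial I(1)]) (use tc[of k] I(2) rainbow_finite in auto)
  define W where "W = (\<Union>I \<union> \<Union>J) - {..<Suc ?r}"
  have finW: "finite W" using fin rainbow_finite unfolding W_def by blast
  have meet: "{S \<in> X. S \<inter> W \<noteq> {}} = X - tsets (Suc ?r) m ?r" if "X \<subseteq> ?R m" "X \<subseteq> I \<union> J" for X m
  proof (intro equalityI subsetI)
    fix S assume S: "S \<in> X - tsets (Suc ?r) m ?r"
    then have "S \<in> ?R m" using that(1) by blast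
    then have "\<not> S \<subseteq> {..<Suc ?r}" using S by (simp add: tsets_def)
    then obtain x where "x \<in> S" "x \<notin> {..<Suc ?r}" by blast
    then have "x \<in> S \<inter> W" using S that(2) unfolding W_def by blast
    then show "S \<in> {S \<in> X. S \<inter> W \<noteq> {}}" using S by blast
  qed (auto simp: W_def tsets_def)
  have "card {S \<in> I. S \<inter> W \<noteq> {}} = y"
    using meet[of I "Suc k"] fin tI tc[of k] I(2) by (simp add: card_Diff_subset finite_tsets)
  moreover have "p' \<le> (n choose l) + card {T \<in> J. T \<inter> W \<noteq> {}}"
  proof -
    have "card J \<le> card (tsets (Suc ?r) (Suc l) ?r) + card (J - tsets (Suc ?r) (Suc l) ?r)"
      using diff_card_le_card_Diff[OF finite_tsets, of J "Suc ?r" "Suc l" ?r] by linarith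
    then show ?thesis using meet[of J "Suc l"] fin tc[of l] J(2) by simp
  qed
  moreover have "kk_feasible k l (card {S \<in> I. S \<inter> W \<noteq> {}}) (card {T \<in> J. T \<inter> W \<noteq> {}})"
    using fin rainbow_subset_ksets[of ?r "{..<?r}" "Suc k"] kl IJ by (intro kk_meeting[OF finW]) auto
  ultimately show ?thesis by metis
qed

subsection \<open>Cliques outside a given clique\<close>

definition outer_cliques :: "('a \<Rightarrow> 'a \<Rightarrow> bool) \<Rightarrow> 'a set \<Rightarrow> 'a set \<Rightarrow> nat \<Rightarrow> 'a set set" where
  "outer_cliques E V Q m = {S \<in> clique_sets E V m. \<not> S \<subseteq> Q}"

lemma card_cl_eq_out:
  assumes "finite V" "Q \<in> clique_sets E V q"
  shows "card (clique_sets E V m) = (q choose m) + card (outer_cliques E V Q m)"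
proof -
  have Q: "finite Q" "card Q = q" "Q \<subseteq> V" using assms by (auto simp: clique_sets_def)
  have "clique_sets E V m = {S. S \<subseteq> Q \<and> card S = m} \<union> outer_cliques E V Q m"
    using assms(2) by (auto simp: clique_sets_def outer_cliques_def intro: finite_subset)
  moreover have "finite (outer_cliques E V Q m)" using cl_finite[OF assms(1)] by (simp add: outer_cliques_def)
  moreover have "card ({S. S \<subseteq> Q \<and> card S = m} \<union> outer_cliques E V Q m)
      = card {S. S \<subseteq> Q \<and> card S = m} + card (outer_cliques E V Q m)"
    using Q calculation by (intro card_Un_disjoint) (auto simp: outer_cliques_def)
  ultimately have "card (clique_sets E V m) = card {S. S \<subseteq> Q \<and> card S = m} + card (outer_cliques E V Q m)" by metis
  then show ?thesis using n_subsets[OF Q(1), of m] Q by simp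
qed

text \<open>Deleting u leaves \<open>V - Q\<close> unchanged, so leaving the clique can be expressed
  for the link as meeting \<open>V - Q\<close>, the form that \<open>kk_meeting\<close>
  needs.\<close>

lemma card_out_remove:
  assumes E: "symp E" and V: "finite V" and u: "u \<in> Q" "Q \<subseteq> V"
  shows "card (outer_cliques E V Q (Suc m)) = card (outer_cliques E (V - {u}) (Q - {u}) (Suc m)) +
    card {T \<in> clique_sets E ((V - {u}) \<inter> nbrs E u) m. T \<inter> (V - Q) \<noteq> {}}"
proof -
  let ?L = "{T \<in> clique_sets E ((V - {u}) \<inter> nbrs E u) m. T \<inter> (V - Q) \<noteq> {}}"
  have "insert u (V - {u}) = V" using u by auto
  then have eq: "clique_sets E V (Suc m) = join (clique_sets E (V - {u}) (Suc m)) (\<lambda>_. clique_sets E ((V - {u}) \<inter> nbrs E u) m) {u}"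
    using cl_insert[OF E, of u "V - {u}" m] by simp
  have "outer_cliques E V Q (Suc m) = join (outer_cliques E (V - {u}) (Q - {u}) (Suc m)) (\<lambda>_. ?L) {u}"
  proof (intro equalityI subsetI)
    fix S assume S: "S \<in> outer_cliques E V Q (Suc m)"
    then consider "S \<in> clique_sets E (V - {u}) (Suc m)"
      | T where "T \<in> clique_sets E ((V - {u}) \<inter> nbrs E u) m" "S = insert u T"
      unfolding outer_cliques_def eq by (auto simp: join_def)
    then show "S \<in> join (outer_cliques E (V - {u}) (Q - {u}) (Suc m)) (\<lambda>_. ?L) {u}"
    proof cases
      case 1
      moreover have "\<not> S \<subseteq> Q - {u}" using S by (auto simp: outer_cliques_def)
      ultimately show ?thesis by (simp add: join_def outer_cliques_def)
    next
      case 2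
      have "\<not> T \<subseteq> Q" using S 2 u by (auto simp: outer_cliques_def)
      moreover have "T \<subseteq> V" using 2 by (auto simp: clique_sets_def)
      ultimately have "T \<in> ?L" using 2 by blast
      then show ?thesis using 2 by (auto simp: join_def)
    qed
  next
    fix S assume "S \<in> join (outer_cliques E (V - {u}) (Q - {u}) (Suc m)) (\<lambda>_. ?L) {u}"
    then consider "S \<in> outer_cliques E (V - {u}) (Q - {u}) (Suc m)" | T where "T \<in> ?L" "S = insert u T"
      by (auto simp: join_def)
    then show "S \<in> outer_cliques E V Q (Suc m)"
    proof cases
      case 1
      then have "S \<in> clique_sets E V (Suc m)" "u \<notin> S" using cl_mono[of "V - {u}" V] by (auto simp: outer_cliques_def clique_sets_def)
      then show ?thesis using 1 by (auto simp: outer_cliques_def)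
    next
      case 2
      then have "S \<in> clique_sets E V (Suc m)" unfolding eq join_def by blast
      moreover have "\<not> S \<subseteq> Q" using 2 by auto
      ultimately show ?thesis by (simp add: outer_cliques_def)
    qed
  qed
  moreover have "card (join (outer_cliques E (V - {u}) (Q - {u}) (Suc m)) (\<lambda>_. ?L) {u})
      = card (outer_cliques E (V - {u}) (Q - {u}) (Suc m)) + card ?L"
    using V by (intro card_cone) (auto simp: outer_cliques_def cl_finite clique_sets_def)
  ultimately show ?thesis by simp
qed

lemma card_out_insert:
  assumes E: "symp E" and V: "finite V" and v: "v \<notin> V" "v \<notin> Q"
  shows "card (outer_cliques E (insert v V) Q (Suc m)) = card (outer_cliques E V Q (Suc m)) + card (clique_sets E (V \<inter> nbrs E v) m)"
proof -
  have "outer_cliques E (insert v V) Q (Suc m) = join (outer_cliques E V Q (Suc m)) (\<lambda>_. clique_sets E (V \<inter> nbrs E v) m) {v}"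
    unfolding outer_cliques_def cl_insert[OF E v(1)] using v(2) by (auto simp: join_def)
  moreover have "card (join (outer_cliques E V Q (Suc m)) (\<lambda>_. clique_sets E (V \<inter> nbrs E v) m) {v})
      = card (outer_cliques E V Q (Suc m)) + card (clique_sets E (V \<inter> nbrs E v) m)"
    using V v by (intro card_cone) (auto simp: outer_cliques_def cl_finite clique_sets_def)
  ultimately show ?thesis by simp
qed

text \<open>A clique with n + 2 vertices that leaves \<open>Q\<close> has at most n + 1 of them in
  \<open>Q\<close>. By Pascal's rule at least \<open>Suc n choose k\<close> of its (k+1)-subsets
  then leave \<open>Q\<close> too.\<close>

lemma no_large_clique_out:
  assumes V: "finite V" and Q: "Q \<subseteq> V" and p: "card (outer_cliques E V Q (Suc k)) < (Suc n choose k)"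
  shows "outer_cliques E V Q (Suc (Suc n)) = {}"
proof (rule ccontr)
  assume "outer_cliques E V Q (Suc (Suc n)) \<noteq> {}"
  then obtain T where T: "T \<in> clique_sets E V (Suc (Suc n))" "\<not> T \<subseteq> Q" by (auto simp: outer_cliques_def)
  have fT: "finite T" "card T = Suc (Suc n)" using T by (auto simp: clique_sets_def)
  have "T \<inter> Q \<subset> T" using T by auto
  then have "card (T \<inter> Q) < card T" using fT by (intro psubset_card_mono)
  then have small: "card (T \<inter> Q) \<le> Suc n" using fT by simp
  let ?A = "{S. S \<subseteq> T \<inter> Q \<and> card S = Suc k}"
  have sub: "{S. S \<subseteq> T \<and> card S = Suc k} \<subseteq> ?A \<union> outer_cliques E V Q (Suc k)"
  proof
    fix S assume S: "S \<in> {S. S \<subseteq> T \<and> card S = Suc k}"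
    then have "S \<in> clique_sets E V (Suc k)" using cl_subset[OF T(1), of S] by auto
    then show "S \<in> ?A \<union> outer_cliques E V Q (Suc k)" using S by (auto simp: outer_cliques_def)
  qed
  have "finite ?A" using fT by simp
  then have fin: "finite (?A \<union> outer_cliques E V Q (Suc k))" using cl_finite[OF V] by (simp add: outer_cliques_def)
  have "(Suc (Suc n) choose Suc k) = card {S. S \<subseteq> T \<and> card S = Suc k}"
    using n_subsets[OF fT(1), of "Suc k"] fT by simp
  also have "\<dots> \<le> card ?A + card (outer_cliques E V Q (Suc k))"
    using card_mono[OF fin sub] card_Un_le[of ?A "outer_cliques E V Q (Suc k)"] by linarith
  also have "card ?A = (card (T \<inter> Q) choose Suc k)"
    using n_subsets[of "T \<inter> Q" "Suc k"] fT by simp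
  also have "\<dots> \<le> (Suc n choose Suc k)" using small by (rule binomial_right_mono)
  finally have "(Suc (Suc n) choose Suc k) \<le> (Suc n choose Suc k) + card (outer_cliques E V Q (Suc k))" by simp
  then show False using p by (simp del: binomial_Suc_Suc add: binomial_Suc_Suc[of "Suc n" k])
qed

lemma initial_subsets: "initial (ksets k) {S. S \<subseteq> {..<n} \<and> card S = k}"
  unfolding initial_def
proof (intro conjI ballI impI)
  show "finite {S. S \<subseteq> {..<n} \<and> card S = k}" by simp
  show "{S. S \<subseteq> {..<n} \<and> card S = k} \<subseteq> ksets k" by (auto simp: ksets_def intro: finite_subset)
  fix S T assume S: "S \<in> {S. S \<subseteq> {..<n} \<and> card S = k}" and T: "T \<in> ksets k" "set_encode T < set_encode S"
  have "T \<subseteq> {..<n}"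
  proof (rule ccontr)
    assume "\<not> T \<subseteq> {..<n}"
    then obtain x where "x \<in> T" "n \<le> x" by (meson lessThan_iff not_less subsetI)
    then have "set_encode S < set_encode T"
      using S T(1) by (intro set_encode_less_of_max[of T x]) (auto simp: ksets_def)
    then show False using T(2) by simp
  qed
  then show "T \<in> {S. S \<subseteq> {..<n} \<and> card S = k}" using T by (simp add: ksets_def)
qed

text \<open>In place of \<open>Q\<close> stands a clique on \<open>{..<Suc n}\<close>, one vertex
  per colour, and each vertex outside \<open>Q\<close> becomes a new vertex of colour n.
  Kruskal-Katona turns its link into an initial segment, which the size bound confines to
  \<open>{..<n}\<close>: colour n is avoided, and the clique spans everything required.\<close>

lemma realizable_of_small_links:
  assumes E: "symp E" and V: "finite V" and Q: "Q \<subseteq> V" and kl: "0 < k" "k < l"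
    and small: "\<And>v. v \<in> V - Q \<Longrightarrow> card {S \<in> clique_sets E V (Suc k). v \<in> S} \<le> (n choose k)"
  shows "realizable (Suc n) {..<Suc n} (Suc k) (Suc l)
    ((Suc n choose Suc k) + card (outer_cliques E V Q (Suc k))) ((Suc n choose Suc l) + card (outer_cliques E V Q (Suc l)))"
proof -
  let ?R = "rainbow (Suc n) {..<Suc n}"
  let ?B = "\<lambda>m. {S. S \<subseteq> {..<Suc n} \<and> card S = m}"
  have "\<exists>F H. finite F \<and> F \<subseteq> ?R (Suc k) \<and> ?B (Suc k) \<subseteq> F \<and> finite H \<and>
      H \<subseteq> ?R (Suc l) \<inter> spanned (Suc k) F (Suc l) \<and>
      card F = (Suc n choose Suc k) + card (outer_cliques E (Q \<union> X) Q (Suc k)) \<and>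
      card H = (Suc n choose Suc l) + card (outer_cliques E (Q \<union> X) Q (Suc l))"
    if "finite X" "X \<subseteq> V - Q" for X
    using that
  proof (induction X rule: finite_induct)
    case empty
    have o: "outer_cliques E Q Q m = {}" for m by (auto simp: outer_cliques_def clique_sets_def)
    have c: "card (?B m) = (Suc n choose m)" for m using n_subsets[of "{..<Suc n}" m] by simp
    have b: "?B m \<subseteq> ?R m" for m using rainbow_of_small[of _ "Suc n" m] by blast
    have "?B (Suc l) \<subseteq> spanned (Suc k) (?B (Suc k)) (Suc l)"
      by (auto simp: spanned_def intro: finite_subset)
    then show ?case
      using b[of "Suc k"] b[of "Suc l"] by (intro exI[of _ "?B (Suc k)"] exI[of _ "?B (Suc l)"]) (simp add: o c)
  next
    case (insert v X)
    then obtain F H where F: "finite F" "F \<subseteq> ?R (Suc k)" "?B (Suc k) \<subseteq> F"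
      and H: "finite H" "H \<subseteq> ?R (Suc l) \<inter> spanned (Suc k) F (Suc l)"
      and c: "card F = (Suc n choose Suc k) + card (outer_cliques E (Q \<union> X) Q (Suc k))"
        "card H = (Suc n choose Suc l) + card (outer_cliques E (Q \<union> X) Q (Suc l))"
      by auto
    have v: "v \<in> V - Q" "v \<notin> Q \<union> X" using insert by auto
    have sub: "Q \<union> X \<subseteq> V" using insert Q by auto
    have fin: "finite (Q \<union> X)" using sub V finite_subset by blast
    let ?L = "(Q \<union> X) \<inter> nbrs E v"
    have fL: "finite ?L" using fin by simp
    have x: "card (clique_sets E ?L k) \<le> (n choose k)"
    proof -
      have "insert v S \<in> {S \<in> clique_sets E V (Suc k). v \<in> S}" if S: "S \<in> clique_sets E ?L k" for S
      proof -
        have "v \<notin> S" using S by (auto simp: clique_sets_def nbrs_def)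
        moreover have "S \<in> clique_sets E (V \<inter> nbrs E v) k" using S sub by (auto simp: clique_sets_def)
        ultimately show ?thesis using insert_mem_cl_iff[OF E] v(1) by auto
      qed
      moreover have "inj_on (insert v) (clique_sets E ?L k)"
      proof (rule inj_onI)
        fix S T assume "S \<in> clique_sets E ?L k" "T \<in> clique_sets E ?L k" and eq: "insert v S = insert v T"
        then have "v \<notin> S" "v \<notin> T" by (auto simp: clique_sets_def nbrs_def)
        then show "S = T" using eq by (simp add: insert_ident)
      qed
      ultimately have "card (clique_sets E ?L k) \<le> card {S \<in> clique_sets E V (Suc k). v \<in> S}"
        using cl_finite[OF V, of E "Suc k"] by (intro card_inj_on_le[of "insert v"]) auto
      then show ?thesis using small[OF v(1)] by simp
    qed
    have kk_feasible: "kk_feasible k l (card (clique_sets E ?L k)) (card (clique_sets E ?L l))"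
      using cl_finite[OF fL] by (intro kk_feasibleI[of "clique_sets E ?L k" k "clique_sets E ?L l"] cl_subset_ksets cl_spanned) auto
    let ?D = "{S. S \<subseteq> {..<n} \<and> card S = k}"
    have D: "card ?D = (n choose k)" using n_subsets[of "{..<n}" k] by simp
    have DK: "?D \<subseteq> ksets k" by (auto simp: ksets_def intro: finite_subset)
    obtain I where I: "initial (ksets k) I" "card I = card (clique_sets E ?L k)"
      using initial_ksets_exists[of ?D k "card (clique_sets E ?L k)"] D DK x by auto
    obtain H2 :: "nat set set" where "finite H2" "H2 \<subseteq> ksets l" "card (clique_sets E ?L l) \<le> card H2"
      using kk_feasible spanned_subset_ksets unfolding kk_feasible_def by (metis subset_trans)
    then obtain J where J: "initial (ksets l) J" "card J = card (clique_sets E ?L l)"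
      using initial_ksets_exists by blast
    have IJ: "J \<subseteq> spanned k I l" using kruskal_katona[OF kk_feasible _ I(1) _ J(1)] I J kl by simp
    have ID: "I \<subseteq> ?D"
      by (rule initial_mono[OF I(1) initial_subsets]) (use I(2) x D in \<open>auto simp: ksets_def\<close>)
    have Jn: "T \<subseteq> {..<n}" if T: "T \<in> J" for T
    proof
      fix y assume y: "y \<in> T"
      have T': "T \<in> spanned k I l" using T IJ by blast
      then have "finite T" "card T = l" by (auto simp: spanned_def)
      then obtain S where S: "{y} \<subseteq> S" "S \<subseteq> T" "card S = k"
        using exists_subset_between[of "{y}" k T] y kl by auto
      then have "S \<in> I" using spannedD[OF T'] by blast
      then show "y \<in> {..<n}" using ID S by auto
    qed
    have fIJ: "finite I" "finite J" "J \<subseteq> ksets l" using I J by (auto simp: initial_def)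
    have JF: "J \<subseteq> spanned (Suc k) F l"
    proof
      fix T assume T: "T \<in> J"
      have "S \<in> F" if "S \<subseteq> T" "card S = Suc k" for S
      proof -
        have "{..<n} \<subseteq> {..<Suc n}" by auto
        then have "S \<subseteq> {..<Suc n}" using that(1) Jn[OF T] by (meson subset_trans)
        then show ?thesis using that(2) F(3) by blast
      qed
      then show "T \<in> spanned (Suc k) F l" using T fIJ by (auto simp: spanned_def ksets_def)
    qed
    have rb: "S \<in> rainbow (Suc n) ({..<Suc n} - {n}) m" if "S \<subseteq> {..<n}" "card S = m" for S m
    proof -
      have "w mod Suc n = w" if "w \<in> S" for w using that \<open>S \<subseteq> {..<n}\<close> by auto
      then have "(\<lambda>v. v mod Suc n) ` S = S" by auto
      moreover have "S \<subseteq> {..<Suc n}" using that by auto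
      then have "S \<in> ?R m" using rainbow_of_small[of S "Suc n" m] that by simp
      ultimately show ?thesis using that by (auto simp: rainbow_def)
    qed
    have IR: "I \<subseteq> rainbow (Suc n) ({..<Suc n} - {n}) k" using ID rb by blast
    have JR: "J \<subseteq> rainbow (Suc n) ({..<Suc n} - {n}) l" using Jn rb fIJ by (auto simp: ksets_def)
    obtain F' H' where "finite F'" "F' \<subseteq> ?R (Suc k)" "F \<subseteq> F'"
      "finite H'" "H' \<subseteq> ?R (Suc l) \<inter> spanned (Suc k) F' (Suc l)"
      "card F' = card F + card I" "card H' = card H + card J"
      using rainbow_extend[OF _ _ _ F(1,2) H fIJ(1) IR fIJ(2) JR IJ JF] by auto
    moreover have "card (outer_cliques E (Q \<union> insert v X) Q (Suc m)) = card (outer_cliques E (Q \<union> X) Q (Suc m)) + card (clique_sets E ?L m)" for m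
      using card_out_insert[OF E fin v(2), of Q m] v by simp
    ultimately show ?case using c I J F(3) by (intro exI[of _ F'] exI[of _ H']) auto
  qed
  from this[of "V - Q"] have "\<exists>F H. finite F \<and> F \<subseteq> ?R (Suc k) \<and> ?B (Suc k) \<subseteq> F \<and> finite H \<and>
      H \<subseteq> ?R (Suc l) \<inter> spanned (Suc k) F (Suc l) \<and>
      card F = (Suc n choose Suc k) + card (outer_cliques E V Q (Suc k)) \<and>
      card H = (Suc n choose Suc l) + card (outer_cliques E V Q (Suc l))"
    using V Q by (simp add: Un_absorb1)
  then show ?thesis unfolding realizable_def by metis
qed

text \<open>A vertex \<open>u\<close> of \<open>Q\<close> that is not adjacent to some \<open>v\<close> of large degree can be deleted: the
  cliques through \<open>v\<close> pay for the main term, so the remaining cliques dominate the link of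
  \<open>u\<close> and the cone inequality for Kruskal--Katona applies.\<close>

theorem cliques_outside_clique:
  assumes E: "symp E" and V: "finite V" and Q: "Q \<in> clique_sets E V q" "Suc n \<le> q" and kl: "0 < k" "k < l"
    and p: "(n choose k) \<le> card (outer_cliques E V Q (Suc k))" "card (outer_cliques E V Q (Suc k)) < (Suc n choose k)"
  shows "\<exists>h. card (outer_cliques E V Q (Suc l)) \<le> (n choose l) + h \<and>
    kk_feasible k l (card (outer_cliques E V Q (Suc k)) - (n choose k)) h"
  using V Q p
proof (induction q arbitrary: V Q rule: less_induct)
  case (less q V Q)
  note V = less.prems(1) and Q = less.prems(2) and q = less.prems(3) and p = less.prems(4,5)
  have Qf: "finite Q" "card Q = q" "Q \<subseteq> V" using Q by (auto simp: clique_sets_def)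
  have big: "outer_cliques E V Q (Suc (Suc n)) = {}" using no_large_clique_out[OF V Qf(3) p(2)] .
  have finish: ?case if "realizable (Suc n) {..<Suc n} (Suc k) (Suc l)
    ((Suc n choose Suc k) + card (outer_cliques E V Q (Suc k))) ((Suc n choose Suc l) + card (outer_cliques E V Q (Suc l)))"
    using near_clique_bound[of n k l "card (outer_cliques E V Q (Suc k)) - (n choose k)"] that p(1) kl
    by (simp add: add.assoc)
  consider "q = Suc n" | "Suc n < q" "\<forall>v\<in>V - Q. card {S \<in> clique_sets E V (Suc k). v \<in> S} \<le> (n choose k)"
    | v where "Suc n < q" "v \<in> V - Q" "(n choose k) \<le> card {S \<in> clique_sets E V (Suc k). v \<in> S}"
    using q by (metis le_neq_implies_less nat_le_linear)
  then show ?case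
  proof cases
    case 1
    \<comment> \<open>A clique with n + 2 vertices would lie inside \<open>Q\<close>, which has only
      n + 1; so n + 1 colours suffice for the whole graph.\<close>
    have "clique_sets E V (Suc (Suc n)) = {}"
    proof (rule ccontr)
      assume "clique_sets E V (Suc (Suc n)) \<noteq> {}"
      then obtain T where T: "T \<in> clique_sets E V (Suc (Suc n))" by auto
      then have "T \<subseteq> Q" using big by (auto simp: outer_cliques_def)
      then have "card T \<le> card Q" using Qf by (intro card_mono)
      then show False using T 1 Qf by (auto simp: clique_sets_def)
    qed
    then have "realizable (Suc n) {..<Suc n} (Suc k) (Suc l) (card (clique_sets E V (Suc k))) (card (clique_sets E V (Suc l)))"
      using V E kl by (intro cliques_realizable) auto
    then show ?thesis using finish card_cl_eq_out[OF V Q] 1 by simp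
  next
    case 2
    then show ?thesis using finish realizable_of_small_links[OF E V Qf(3) kl] by blast
  next
    case 3
    \<comment> \<open>Otherwise v and n + 1 vertices of \<open>Q\<close> would form a clique with n
      + 2 vertices that leaves \<open>Q\<close>.\<close>
    obtain u where u: "u \<in> Q" "\<not> E v u"
    proof (rule ccontr)
      assume "\<not> thesis"
      then have all: "E v u" if "u \<in> Q" for u using that \<open>\<And>u. u \<in> Q \<Longrightarrow> \<not> E v u \<Longrightarrow> thesis\<close> by blast
      obtain Q' where Q': "Q' \<subseteq> Q" "card Q' = Suc n" using obtain_subset_with_card_n[of "Suc n" Q] q Qf by metis
      have "Q' \<in> clique_sets E (V \<inter> nbrs E v) (Suc n)"
        using cl_subset[OF Q Q'(1)] Q' all 3(2) by (auto simp: clique_sets_def nbrs_def)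
      then have "insert v Q' \<in> clique_sets E V (Suc (Suc n))"
        using insert_mem_cl_iff[OF E, of v Q' V "Suc n"] 3(2) Q' by auto
      then show False using big 3(2) by (auto simp: outer_cliques_def)
    qed
    have nE: "\<not> E u v" using u(2) sympD[OF E] by blast
    define M where "M = (n choose k)"
    let ?V = "V - {u}" and ?Q = "Q - {u}" and ?L = "(V - {u}) \<inter> nbrs E u" and ?W = "V - Q"
    define z where "z = card (outer_cliques E ?V ?Q (Suc k))"
    define meet where "meet m = card {T \<in> clique_sets E ?L m. T \<inter> ?W \<noteq> {}}" for m
    have split: "card (outer_cliques E V Q (Suc m)) = card (outer_cliques E ?V ?Q (Suc m)) + meet m" for m
      using card_out_remove[OF E V u(1) Qf(3)] by (simp add: meet_def)
    have fin: "finite ?V" "finite ?W" "finite ?L" using V by auto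
    \<comment> \<open>As u and v are not adjacent, no clique through v contains u or lies in the
      link of u; both families survive the deletion and are disjoint. The first has at least
      \<open>M\<close> members, so \<open>z - M\<close> dominates the (k+1)-cliques in the link, as
      the third hypothesis of \<open>kk_cone\<close> demands.\<close>
    have ez: "card {S \<in> clique_sets E V (Suc k). v \<in> S} + meet (Suc k) \<le> z"
    proof -
      let ?A = "{S \<in> clique_sets E V (Suc k). v \<in> S}" and ?T = "{T \<in> clique_sets E ?L (Suc k). T \<inter> ?W \<noteq> {}}"
      have "?A \<inter> ?T = {}" using nE by (auto simp: clique_sets_def nbrs_def)
      moreover have "?A \<subseteq> outer_cliques E ?V ?Q (Suc k)"
      proof
        fix S assume S: "S \<in> ?A"
        then have "u \<notin> S" using u 3(2) by (auto simp: clique_sets_def)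
        then have "S \<in> clique_sets E ?V (Suc k)" using S by (auto simp: clique_sets_def)
        then show "S \<in> outer_cliques E ?V ?Q (Suc k)" using S 3(2) by (auto simp: outer_cliques_def)
      qed
      moreover have "?T \<subseteq> outer_cliques E ?V ?Q (Suc k)" by (auto simp: outer_cliques_def clique_sets_def)
      moreover have "finite (outer_cliques E ?V ?Q (Suc k))" using cl_finite[OF fin(1)] by (simp add: outer_cliques_def)
      ultimately have "card ?A + card ?T \<le> z"
        using card_mono[of "outer_cliques E ?V ?Q (Suc k)" "?A \<union> ?T"] V fin
        by (simp add: z_def card_Un_disjoint cl_finite)
      then show ?thesis by (simp add: meet_def)
    qed
    have pz: "card (outer_cliques E V Q (Suc k)) = z + meet k" using split by (simp add: z_def)
    have Mz: "M \<le> z" using ez 3(3) by (simp add: M_def)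
    have "\<exists>h. card (outer_cliques E ?V ?Q (Suc l)) \<le> (n choose l) + h \<and> kk_feasible k l (card (outer_cliques E ?V ?Q (Suc k)) - (n choose k)) h"
    proof (rule less.IH[of "q - 1"])
      show "q - 1 < q" "Suc n \<le> q - 1" using 3(1) by auto
      have "card ?Q = q - 1" using u Qf by simp
      then show "?Q \<in> clique_sets E ?V (q - 1)" using Q by (auto simp: clique_sets_def)
      show "(n choose k) \<le> card (outer_cliques E ?V ?Q (Suc k))" using Mz by (simp add: M_def z_def)
      show "card (outer_cliques E ?V ?Q (Suc k)) < (Suc n choose k)" using pz p(2) by (simp add: z_def)
    qed (use fin in simp)
    then obtain h1 where h1: "card (outer_cliques E ?V ?Q (Suc l)) \<le> (n choose l) + h1" "kk_feasible k l (z - M) h1"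
      by (auto simp: z_def M_def)
    \<comment> \<open>\<open>k0\<close> may be 0, a level that \<open>kk_meeting\<close>
      includes.\<close>
    obtain k0 l0 where kl0: "k = Suc k0" "l = Suc l0" "Suc k0 \<le> l0" using kl by (cases k; cases l) auto
    have "kk_feasible k0 l0 (meet k) (meet l)"
      unfolding meet_def kl0 using kl0 cl_finite[OF fin(3)]
      by (intro kk_meeting[OF fin(2)] cl_subset_ksets cl_spanned) auto
    moreover have "kk_feasible k l0 (z - M) (meet l)"
    proof -
      have "kk_feasible k l0 (meet (Suc k)) (meet l)"
        unfolding meet_def kl0(2) using kl0 cl_finite[OF fin(3)]
        by (intro kk_meeting[OF fin(2)] cl_subset_ksets cl_spanned) auto
      moreover have "meet (Suc k) \<le> z - M" using ez 3(3) by (simp add: M_def)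
      ultimately show ?thesis using kk_mono by blast
    qed
    ultimately have "kk_feasible k l (z - M + meet k) (h1 + meet l)"
      using kk_cone[of k0 l0 "z - M" h1 "meet k" "meet l"] h1(2) kl0 by simp
    then have "kk_feasible k l (card (outer_cliques E V Q (Suc k)) - (n choose k)) (h1 + meet l)"
      using pz Mz by (simp add: M_def)
    moreover have "card (outer_cliques E V Q (Suc l)) \<le> (n choose l) + (h1 + meet l)" using split[of l] h1(1) by simp
    ultimately show ?thesis by blast
  qed
qed

theorem theorem5p1:
  fixes G :: "'a pair_pre_digraph"
    and k i m nk t s :: nat
    and nk1 :: int
    and a b :: "nat \<Rightarrow> nat"
  assumes "pair_graph G"
    and "k \<ge> 1" and "i \<ge> 1"
    and "m = num_cliques G k" and "m \<ge> 1"
    and "clique_representation k m nk nk1 t a"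
    and "nk > k \<Longrightarrow> turan_representation k (nk - 1) m s b"
  shows "num_cliques G (k + i) \<le>
    (let A = (nk choose (k + i)) + int_binom nk1 (int (k + i) - 1)
               + (\<Sum>j=1..t. a (k - j) choose (k + i - j));
         B = (\<Sum>j=0..s. turan_binom (b (k - j)) (k + i - j) (nk - 1 - j))
     in if nk > k then max A B else A)"
proof -
  interpret pair_graph G by fact
  define V where "V = pverts G"
  define E where "E = (\<lambda>u v. (u, v) \<in> parcs G)"
  have clique_sets: "num_cliques G n = card (clique_sets E V n)" for n
    by (simp add: num_cliques_def cliques_def clique_sets_def V_def E_def)
  have V: "finite V" by (simp add: V_def)
  have E: "symp E" by (auto simp: E_def intro!: sympI arcs_symmetric)
  define A where "A = (nk choose (k + i)) + int_binom nk1 (int (k + i) - 1)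
    + (\<Sum>j=1..t. a (k - j) choose (k + i - j))"
  define B where "B = (\<Sum>j=0..s. turan_binom (b (k - j)) (k + i - j) (nk - 1 - j))"
  define Y where "Y = (\<Sum>j=1..t. a (k - j) choose (k - j))"
  have rep: "m = (nk choose k) + int_binom nk1 (int k - 1) + Y" "int nk > nk1" "nk1 \<ge> int k - 2" "t < k"
    "\<And>j. 1 \<le> j \<Longrightarrow> j < t \<Longrightarrow> a (k - j) > a (k - j - 1)"
    "int_binom nk1 (int k - 2) > Y \<or> k = 1 \<and> nk1 = -1"
    using assms(6) by (auto simp: clique_representation_def Y_def)
  have "num_cliques G (k + i) \<le> A \<or> nk > k \<and> num_cliques G (k + i) \<le> B"
  proof (cases "k = 1")
    case True
    \<comment> \<open>For k = 1 the strict inequality would compare with a vanishing binomial, so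
      only the degenerate disjunct survives; then \<open>nk\<close> is the number of vertices and
      the first bound is trivial.\<close>
    have "nk1 = -1" using rep(6) True by (auto simp: int_binom_def)
    moreover have "t = 0" using rep(4) True by simp
    ultimately have mnk: "m = nk" using rep(1) True by (simp add: int_binom_def Y_def)
    have "clique_sets E V 1 = (\<lambda>v. {v}) ` V" by (auto simp: clique_sets_def card_1_singleton_iff)
    then have "m = card V" using assms(4) True by (simp add: clique_sets card_image)
    moreover have "clique_sets E V (k + i) \<subseteq> {S. S \<subseteq> V \<and> card S = k + i}" by (auto simp: clique_sets_def)
    then have "card (clique_sets E V (k + i)) \<le> (card V choose (k + i))"
      using card_mono[of "{S. S \<subseteq> V \<and> card S = k + i}"] n_subsets[OF V] V by simp
    ultimately show ?thesis using mnk by (simp add: clique_sets A_def)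
  next
    case False
    define k0 where "k0 = k - 1"
    define l0 where "l0 = k + i - 1"
    have k0: "k = Suc k0" "0 < k0" and l0: "k + i = Suc l0" "k0 < l0"
      using False assms(2,3) by (auto simp: k0_def l0_def)
    define n where "n = nat nk1"
    have n: "nk1 = int n" "n < nk" using rep(2,3) k0 by (auto simp: n_def)
    have ib: "int_binom nk1 (int (Suc j) - 1) = (n choose j)" for j
      by (auto simp: int_binom_def n(1) binomial_eq_0)
    have Y: "Y < (n choose (k0 - 1))"
    proof -
      have "int k - 2 = int (Suc (k0 - 1)) - 1" using k0 by simp
      then show ?thesis using rep(6) ib[of "k0 - 1"] False by simp
    qed
    have m: "card (clique_sets E V (Suc k0)) = (nk choose Suc k0) + ((n choose k0) + Y)"
      using rep(1) assms(4) ib[of k0] k0 by (simp add: clique_sets)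
    have A: "A = (nk choose Suc l0) + (n choose l0) + (\<Sum>j=1..t. a (k - j) choose (Suc l0 - j))"
      using ib[of l0] by (simp add: A_def l0)
    show ?thesis
    proof (cases "clique_sets E V nk = {}")
      case False
      then obtain Q where Q: "Q \<in> clique_sets E V nk" by auto
      have p: "card (outer_cliques E V Q (Suc k0)) = (n choose k0) + Y"
        using card_cl_eq_out[OF V Q, of "Suc k0"] m by simp
      \<comment> \<open>Pascal's rule converts the bound on Y into the upper end of the window
        required by \<open>cliques_outside_clique\<close>; the lower end is immediate.\<close>
      have "(n choose k0) + Y < (Suc n choose k0)"
      proof -
        have "(Suc n choose Suc (k0 - 1)) = (n choose (k0 - 1)) + (n choose Suc (k0 - 1))" by simp
        then show ?thesis using Y k0(2) by simp
      qed
      then obtain h where h: "card (outer_cliques E V Q (Suc l0)) \<le> (n choose l0) + h" "kk_feasible k0 l0 Y h"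
        using cliques_outside_clique[OF E V Q _ k0(2) l0(2), of n] n(2) p by auto
      have "h \<le> (\<Sum>j=1..t. a (k - j) choose (Suc l0 - j))"
      proof (cases t)
        \<comment> \<open>\<open>kk_bound\<close> presupposes at least one term. Here Y = 0, and the
          empty family spans no set with k0 or more elements.\<close>
        case 0
        obtain F H :: "nat set set" where FH: "finite F" "card F \<le> Y" "H \<subseteq> spanned k0 F l0" "h \<le> card H"
          using h(2) by (auto simp: kk_feasible_def)
        have "F = {}" using FH 0 by (simp add: Y_def)
        have "H = {}"
        proof (rule ccontr)
          assume "H \<noteq> {}"
          then obtain T where T: "T \<in> spanned k0 F l0" using FH by auto
          then have "k0 \<le> card T" using l0(2) by (auto simp: spanned_def)
          then obtain S where "S \<subseteq> T" "card S = k0" using obtain_subset_with_card_n by metis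
          then show False using spannedD[OF T] \<open>F = {}\<close> by auto
        qed
        then show ?thesis using FH(4) by simp
      next
        case (Suc t')
        have shift: "(\<Sum>j=1..t. f j) = (\<Sum>j=0..t'. f (Suc j))" for f :: "nat \<Rightarrow> nat"
          unfolding Suc using sum.shift_bounds_cl_Suc_ivl[of f 0 t'] by simp
        \<comment> \<open>Seen from level k0 = k - 1, the a-terms begin with index 0 and form an
          ordinary cascade.\<close>
        have "kk_feasible k0 l0 (\<Sum>j=0..t'. a (k0 - j) choose (k0 - j)) h"
          using h(2) unfolding Y_def shift by (simp add: k0(1))
        then have "h \<le> (\<Sum>j=0..t'. a (k0 - j) choose (l0 - j))"
        proof (rule kk_bound)
          show "k0 \<le> l0" "t' < k0" using l0(2) rep(4) Suc k0(1) by auto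
          show "a (k0 - j - 1) < a (k0 - j)" if "j < t'" for j
            using rep(5)[of "Suc j"] that Suc k0(1) by simp
        qed
        then show ?thesis unfolding shift by (simp add: k0(1))
      qed
      then have "card (clique_sets E V (Suc l0)) \<le> A"
        using h(1) card_cl_eq_out[OF V Q, of "Suc l0"] A by simp
      then show ?thesis by (simp add: clique_sets l0)
    next
      case True
      \<comment> \<open>Since m is positive there is a k-clique, and it would contain a clique of
        size \<open>nk\<close> if \<open>nk\<close> were at most k. Hence the Turan representation
        is available.\<close>
      have nk: "nk > k"
      proof (rule ccontr)
        assume "\<not> nk > k"
        moreover obtain S where S: "S \<in> clique_sets E V k"
          using assms(4,5) by (metis clique_sets card.empty ex_in_conv not_one_le_zero)
        ultimately have "nk \<le> card S" by (auto simp: clique_sets_def)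
        then obtain T where "T \<subseteq> S" "card T = nk" using obtain_subset_with_card_n by metis
        then show False using cl_subset[OF S] True by auto
      qed
      define r where "r = nk - 1"
      have r: "0 < r" "k \<le> r" "Suc r = nk" using nk assms(2) by (auto simp: r_def)
      have trep: "m = (\<Sum>j=0..s. turan_binom (b (k - j)) (k - j) (r - j))" "s < k"
        "\<And>j. j < s \<Longrightarrow> b (k - j - 1) < b (k - j) - b (k - j) div (r - j)"
        using assms(7)[OF nk] by (auto simp: turan_representation_def r_def)
      have "realizable r {..<r} k (k + i) (card (clique_sets E V k)) (card (clique_sets E V (k + i)))"
        using cliques_realizable[OF r(1) _ _ V E, of "{..<r}" k "k + i"] True r by simp
      then obtain F H where "finite F" "F \<subseteq> rainbow r {..<r} k" "finite H"
        "H \<subseteq> rainbow r {..<r} (k + i) \<inter> spanned k F (k + i)"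
        "card F = m" "card H = card (clique_sets E V (k + i))"
        using assms(4) by (auto simp: realizable_def clique_sets)
      then have "card (clique_sets E V (k + i)) \<le> B"
        using turan_representation_bound[OF trep(2) r(2) trep(3), of F H "k + i"] trep(1)
        by (simp add: B_def r_def)
      then show ?thesis using nk by (simp add: clique_sets)
    qed
  qed
  then show ?thesis by (auto simp: Let_def A_def B_def)
qed

end
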